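(* Let $H:[0,T]\times\mathbb{R}^n\times\mathbb{R}^n\to\mathbb{R}$ satisfy (H1)–(H4) and (HLC), with $c(\cdot)$, each $k_R(\cdot)$ and $t\mapsto H(t,0,0)$ integrable on $[0,T]$. Let $(\mathbb{R}^{n+1},f,l)$ be the Steiner representation of $H$ and let $$V(t_0,x_0)=\inf_{(x,a)(\cdot)\in S_f(t_0,x_0)}\Big\{g(x(T))+\int_{t_0}^T l(t,x(t),a(t))\,dt\Big\}.$$ If $g:\mathbb{R}^n\to\mathbb{R}$ is continuous, then $V$ is continuous on $[0,T]\times\mathbb{R}^n$; if $g$ is lower semicontinuous, then $V$ is lower semicontinuous on $[0,T]\times\mathbb{R}^n$.
   Context: Hypotheses: (H1) $H(\cdot,x,p)$ Lebesgue measurable; (H2) $H(t,\cdot,\cdot)$ continuous; (H3) $H(t,x,\cdot)$ convex; (H4) there is measurable $c\ge0$ with $|H(t,x,p)-H(t,x,q)|\le c(t)(1+|x|)|p-q|$; (HLC) for each $R>0$ there is measurable $k_R\ge0$ with $|H(t,x,p)-H(t,y,p)|\le k_R(t)(1+|p|)|x-y|$ for $x,y\in\bar B_R$, all $p$. $H^*(t,x,v)=\sup_p\{\langle v,p\rangle-H(t,x,p)\}$. $S_f(t_0,x_0)$: pairs $x(\cdot)$ absolutely continuous on $[t_0,T]$, $a(\cdot)\in L^1([t_0,T],\mathbb{R}^{n+1})$, $\dot x=f(t,x,a)$ a.e., $x(t_0)=x_0$. Steiner representation: $E(t,x)=\mathrm{epi}\,H^*(t,x,\cdot)\subset\mathbb{R}^{n+1}$;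 $\Phi(t,x,a)=E(t,x)\cap\bar B(a,2d(a,E(t,x)))$; Steiner point $s_m(K)=m\int_{S^{m-1}}p\max_{y\in K}\langle p,y\rangle\,\mu(dp)$ ($\mu$ normalized rotation-invariant measure on the unit sphere); $(f,l)(t,x,a)=s_{n+1}(\Phi(t,x,a))$ with $f\in\mathbb{R}^n$, $l\in\mathbb{R}$. *)

theory Defs
  imports "HOL-Analysis.Analysis"
begin

definition abs_cont_on :: "(real \<Rightarrow> 'b::real_normed_vector) \<Rightarrow> real \<Rightarrow> real \<Rightarrow> bool" where
  "abs_cont_on x a b \<longleftrightarrow>
     (\<forall>\<epsilon>>0. \<exists>\<delta>>0. \<forall>(n::nat) (u::nat \<Rightarrow> real) v.
        (\<forall>i<n. a \<le> u i \<and> u i \<le> v i \<and> v i \<le> b) \<and>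
        (\<forall>i<n. \<forall>j<n. i \<noteq> j \<longrightarrow> {u i<..<v i} \<inter> {u j<..<v j} = {}) \<and>
        (\<Sum>i<n. v i - u i) < \<delta>
        \<longrightarrow> (\<Sum>i<n. norm (x (v i) - x (u i))) < \<epsilon>)"

definition lsc_on :: "'a::topological_space set \<Rightarrow> ('a \<Rightarrow> ereal) \<Rightarrow> bool" where
  "lsc_on D F \<longleftrightarrow> (\<forall>z\<in>D. \<forall>c. c < F z \<longrightarrow> (\<forall>\<^sub>F w in at z within D. c < F w))"

definition conj_H :: "(real \<Rightarrow> 'a::euclidean_space \<Rightarrow> 'a \<Rightarrow> real) \<Rightarrow> real \<Rightarrow> 'a \<Rightarrow> 'a \<Rightarrow> ereal" where
  "conj_H H t x v = (SUP p. ereal (v \<bullet> p - H t x p))"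

definition epiE :: "(real \<Rightarrow> 'a::euclidean_space \<Rightarrow> 'a \<Rightarrow> real) \<Rightarrow> real \<Rightarrow> 'a \<Rightarrow> ('a \<times> real) set" where
  "epiE H t x = {(v, r). conj_H H t x v \<le> ereal r}"

definition PhiS :: "(real \<Rightarrow> 'a::euclidean_space \<Rightarrow> 'a \<Rightarrow> real) \<Rightarrow> real \<Rightarrow> 'a \<Rightarrow> 'a \<times> real \<Rightarrow> ('a \<times> real) set" where
  "PhiS H t x a = epiE H t x \<inter> cball a (2 * infdist a (epiE H t x))"

definition sphere_measure :: "'b::euclidean_space measure" where
  "sphere_measure = (THE \<mu>. sets \<mu> = sets (restrict_space borel (sphere (0::'b) 1)) \<and>
       space \<mu> = sphere (0::'b) 1 \<and> emeasure \<mu> (space \<mu>) = 1 \<and>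
       (\<forall>R. orthogonal_transformation R \<longrightarrow> distr \<mu> \<mu> R = \<mu>))"

definition steiner_point :: "'b::euclidean_space set \<Rightarrow> 'b" where
  "steiner_point K = real DIM('b) *\<^sub>R
     integral\<^sup>L sphere_measure (\<lambda>p. (SUP y\<in>K. p \<bullet> y) *\<^sub>R p)"

definition steiner_f :: "(real \<Rightarrow> 'a::euclidean_space \<Rightarrow> 'a \<Rightarrow> real) \<Rightarrow> real \<Rightarrow> 'a \<Rightarrow> 'a \<times> real \<Rightarrow> 'a" where
  "steiner_f H t x a = fst (steiner_point (PhiS H t x a))"

definition steiner_l :: "(real \<Rightarrow> 'a::euclidean_space \<Rightarrow> 'a \<Rightarrow> real) \<Rightarrow> real \<Rightarrow> 'a \<Rightarrow> 'a \<times> real \<Rightarrow> real" where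
  "steiner_l H t x a = snd (steiner_point (PhiS H t x a))"

definition traj_set :: "(real \<Rightarrow> 'a::euclidean_space \<Rightarrow> 'a \<times> real \<Rightarrow> 'a) \<Rightarrow> real \<Rightarrow> real \<Rightarrow> 'a
      \<Rightarrow> ((real \<Rightarrow> 'a) \<times> (real \<Rightarrow> 'a \<times> real)) set" where
  "traj_set f T t0 x0 = {(x, a). abs_cont_on x t0 T \<and> a absolutely_integrable_on {t0..T} \<and>
      (AE t in lebesgue. t \<in> {t0..T} \<longrightarrow>
          (x has_vector_derivative f t (x t) (a t)) (at t within {t0..T})) \<and>
      x t0 = x0}"

text \<open>Cost of a pair: g(x(T)) + integral of l; the integral is taken to be +infinity when
  the integrand is not integrable (l is bounded below by the integrable -H(t,x(t),0)).\<close>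
definition cost :: "(real \<Rightarrow> 'a::euclidean_space \<Rightarrow> 'a \<times> real \<Rightarrow> real) \<Rightarrow> ('a \<Rightarrow> real) \<Rightarrow> real \<Rightarrow> real
      \<Rightarrow> (real \<Rightarrow> 'a) \<Rightarrow> (real \<Rightarrow> 'a \<times> real) \<Rightarrow> ereal" where
  "cost l g T t0 x a = ereal (g (x T)) +
     (if set_integrable lebesgue {t0..T} (\<lambda>t. l t (x t) (a t))
      then ereal (set_lebesgue_integral lebesgue {t0..T} (\<lambda>t. l t (x t) (a t))) else \<infinity>)"

definition value_fun :: "(real \<Rightarrow> 'a::euclidean_space \<Rightarrow> 'a \<Rightarrow> real) \<Rightarrow> ('a \<Rightarrow> real) \<Rightarrow> real
      \<Rightarrow> real \<Rightarrow> 'a \<Rightarrow> ereal" where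
  "value_fun H g T t0 x0 =
     (INF xa\<in>traj_set (steiner_f H) T t0 x0. cost (steiner_l H) g T t0 (fst xa) (snd xa))"

end

theory Submission
  imports Defs "HOL-Complex_Analysis.Great_Picard"
begin

text \<open>
  The Steiner point of a convex body \<open>K\<close> lies in \<open>K\<close>. Hence \<open>(f, l)(t, x, a)\<close> always lies in the
  epigraph \<open>E(t, x)\<close> of the conjugate Hamiltonian and equals \<open>a\<close> when \<open>a \<in> E(t, x)\<close>, so that \<open>V\<close> is
  the value of the Bolza problem of minimising \<open>g(x(T)) + \<integral> r\<close> over pairs with
  \<open>(x'(t), r(t)) \<in> E(t, x(t))\<close>; no regularity of \<open>f\<close> and \<open>l\<close> in \<open>x\<close> is needed.

  By duality, \<open>E(t, x)\<close> depends on \<open>x\<close> in a locally Lipschitz way for the Hausdorff distance, with an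
  integrable constant. Filippov's successive projections then turn a nearly optimal pair for one
  initial point into a nearby pair for a neighbouring initial point, which gives upper semicontinuity
  for continuous \<open>g\<close>. For lower semicontinuity, velocities are dominated by an integrable function, so
  a subsequence of nearly optimal arcs converges uniformly with weakly convergent velocities, and
  \<open>r \<ge> v \<bullet> p - H(t, x, p)\<close>, tested with simple functions \<open>p\<close>, passes to the limit.
\<close>

section \<open>The rotation invariant measure on the sphere\<close>

text \<open>\<open>sphere_measure\<close> is a definite description, so nothing can be said about
  Steiner points before the invariant measure is known to exist and to be unique. The two
  semicontinuity proofs meet different obstacles. Velocities are bounded by
  \<open>c t * (1 + norm x)\<close>, but costs only from below, because an epigraph is unbounded
  upwards. Costs therefore have no weak compactness, and the limit cost must be rebuilt from the
  limit velocity, as a supremum over countably many \<open>p\<close>. Moreover the initial times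
  vary: arcs are extended by zero velocity and zero cost to the times before their start, and the
  error lives on the short interval between two initial times, where an integrable function controls
  it. All growth estimates use the weight \<open>exp (2 * integral {a..t} c)\<close>. Under it,
  integration against \<open>c\<close> halves a bound; this explains the constants of the Gronwall
  estimate and the geometric convergence of Filippov's iteration.\<close>

lemma distr_orthogonal_lborel:
  fixes R :: "'b::euclidean_space \<Rightarrow> 'b"
  assumes R: "orthogonal_transformation R"
  shows "distr lborel borel R = lborel"
proof -
  let ?\<nu> = "distr lborel borel R"
  have linR: "linear R" using R by (rule orthogonal_transformation_linear)
  have Rm [measurable]: "R \<in> borel_measurable borel"
    using linR by (intro borel_measurable_continuous_onI linear_continuous_on)
      (simp add: linear_conv_bounded_linear)
  \<comment> \<open>The image measure inherits translation invariance: a shift by \<open>z\<close>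
    after \<open>R\<close> is a shift by the preimage \<open>w\<close> before
    \<open>R\<close>.\<close>
  have shift: "distr ?\<nu> borel ((+) z) = ?\<nu>" for z
  proof -
    obtain w where w: "R w = z"
      using orthogonal_transformation_surj[OF R] by (metis surjD)
    have "distr ?\<nu> borel ((+) z) = distr lborel borel ((+) z \<circ> R)"
      by (rule distr_distr) auto
    also have "(+) z \<circ> R = R \<circ> (+) w"
      using w linear_add[OF linR] by (auto simp: fun_eq_iff)
    also have "distr lborel borel (R \<circ> (+) w) = distr (distr lborel borel ((+) w)) borel R"
      by (rule distr_distr[symmetric]) auto
    finally show ?thesis by (simp add: lborel_distr_plus)
  qed
  have sf: "sigma_finite_measure ?\<nu>"
  proof
    let ?A = "range (\<lambda>n::nat. ball (0::'b) (real n))"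
    have "R -` ball 0 (real n) = ball 0 (real n)" for n :: nat
      using orthogonal_transformation_norm[OF R] by (auto simp: dist_norm)
    then have "emeasure ?\<nu> (ball 0 (real n)) \<noteq> \<infinity>" for n
      using emeasure_lborel_ball_finite[of "0::'b" "real n"] by (simp add: emeasure_distr)
    moreover have "\<Union>?A = UNIV"
      by (auto simp: dist_norm) (meson reals_Archimedean2)
    ultimately show "\<exists>A. countable A \<and> A \<subseteq> sets ?\<nu> \<and> \<Union>A = space ?\<nu> \<and> (\<forall>a\<in>A. emeasure ?\<nu> a \<noteq> \<infinity>)"
      by (intro exI[of _ ?A]) auto
  qed
  \<comment> \<open>Uniqueness of Haar measure by double counting the pairs with \<open>x\<close> in
    \<open>A\<close> and \<open>x + y\<close> in \<open>B\<close>. Integrated directly, it gives the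
    left side; after the substitution of \<open>x - y\<close> for \<open>x\<close>, it gives the
    right side.\<close>
  have key: "emeasure lborel A * emeasure ?\<nu> B = emeasure lborel B * emeasure ?\<nu> (uminus -` A)"
    if [measurable]: "A \<in> sets borel" "B \<in> sets borel"
      and sf: "sigma_finite_measure \<nu>" and \<nu>: "\<nu> = ?\<nu>" 
      for A B :: "'b set" and \<nu>
  proof -
    have [measurable_cong]: "sets \<nu> = sets borel" by (simp add: \<nu>)
    interpret \<nu>: sigma_finite_measure \<nu> by fact
    interpret pair_sigma_finite lborel \<nu> ..
    have sh: "distr \<nu> borel ((+) z) = \<nu>" for z using shift \<nu> by simp
    have 1: "(\<integral>\<^sup>+y. indicator B (x + y) \<partial>\<nu>) = emeasure \<nu> B" for x
    proof -
      have "emeasure \<nu> B = (\<integral>\<^sup>+y. indicator B y \<partial>distr \<nu> borel ((+) x))"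
        by (subst sh) simp
      also have "\<dots> = (\<integral>\<^sup>+y. indicator B (x + y) \<partial>\<nu>)"
        by (subst nn_integral_distr) auto
      finally show ?thesis ..
    qed
    have 2: "(\<integral>\<^sup>+x. indicator A x * indicator B (x + y) \<partial>lborel)
        = (\<integral>\<^sup>+x. indicator A (x - y) * indicator B x \<partial>lborel)" for y :: 'b
    proof -
      have "(\<integral>\<^sup>+x. indicator A (x - y) * indicator B x \<partial>lborel)
          = (\<integral>\<^sup>+x. indicator A (x - y) * indicator B x \<partial>distr lborel borel ((+) y))"
        by (simp add: lborel_distr_plus)
      also have "\<dots> = (\<integral>\<^sup>+x. indicator A x * indicator B (x + y) \<partial>lborel)"
        by (subst nn_integral_distr) (auto simp: add.commute)
      finally show ?thesis ..
    qed
    have 3: "(\<integral>\<^sup>+y. indicator A (x - y) \<partial>\<nu>) = emeasure \<nu> (uminus -` A)" for x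
    proof -
      have [measurable]: "uminus -` A \<in> sets borel"
        using measurable_sets_borel[OF borel_measurable_uminus[OF measurable_ident] that(1)]
        by simp
      have "emeasure \<nu> (uminus -` A) = (\<integral>\<^sup>+y. indicator (uminus -` A) y \<partial>distr \<nu> borel ((+) (-x)))"
        by (subst sh) simp
      also have "\<dots> = (\<integral>\<^sup>+y. indicator (uminus -` A) (-x + y) \<partial>\<nu>)"
        by (subst nn_integral_distr) auto
      also have "\<dots> = (\<integral>\<^sup>+y. indicator A (x - y) \<partial>\<nu>)"
        by (intro nn_integral_cong) (auto simp: indicator_def)
      finally show ?thesis ..
    qed
    have "emeasure lborel A * emeasure \<nu> B = (\<integral>\<^sup>+x. indicator A x * (\<integral>\<^sup>+y. indicator B (x + y) \<partial>\<nu>) \<partial>lborel)"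
      unfolding 1 by (subst nn_integral_multc) auto
    also have "\<dots> = (\<integral>\<^sup>+x. (\<integral>\<^sup>+y. indicator A x * indicator B (x + y) \<partial>\<nu>) \<partial>lborel)"
      by (intro nn_integral_cong nn_integral_cmult[symmetric]) auto
    also have "\<dots> = (\<integral>\<^sup>+y. (\<integral>\<^sup>+x. indicator A x * indicator B (x + y) \<partial>lborel) \<partial>\<nu>)"
      by (rule Fubini'[symmetric]) auto
    also have "\<dots> = (\<integral>\<^sup>+y. (\<integral>\<^sup>+x. indicator A (x - y) * indicator B x \<partial>lborel) \<partial>\<nu>)"
      unfolding 2 ..
    also have "\<dots> = (\<integral>\<^sup>+x. (\<integral>\<^sup>+y. indicator A (x - y) * indicator B x \<partial>\<nu>) \<partial>lborel)"
      by (rule Fubini') auto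
    also have "\<dots> = (\<integral>\<^sup>+x. (\<integral>\<^sup>+y. indicator A (x - y) \<partial>\<nu>) * indicator B x \<partial>lborel)"
      by (intro nn_integral_cong nn_integral_multc) auto
    also have "\<dots> = emeasure \<nu> (uminus -` A) * emeasure lborel B"
      unfolding 3 by (subst nn_integral_cmult) auto
    finally show ?thesis by (simp add: mult.commute \<nu>)
  qed
  let ?B = "ball (0::'b) 1"
  have RB: "R -` ?B = ?B"
    using orthogonal_transformation_norm[OF R] by (auto simp: dist_norm)
  have Bpos: "emeasure lborel ?B \<noteq> 0"
  proof
    assume "emeasure lborel ?B = 0"
    then have "negligible ?B"
      by (simp add: negligible_iff_emeasure0)
    then show False
      using open_not_negligible[of ?B] by auto
  qed
  have Bfin: "emeasure lborel ?B \<noteq> \<infinity>"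
    using emeasure_lborel_ball_finite[of "0::'b" 1] by simp
  \<comment> \<open>\<open>R\<close> maps the unit ball onto itself, so both measures agree on it,
    and the proportionality factor in \<open>key\<close> is 1.\<close>
  have flip: "emeasure ?\<nu> (uminus -` A) = emeasure lborel A" if A: "A \<in> sets borel" for A
  proof -
    have "emeasure lborel A * emeasure ?\<nu> ?B = emeasure lborel ?B * emeasure ?\<nu> (uminus -` A)"
      using A by (intro key[OF _ _ sf refl]) auto
    moreover have "emeasure ?\<nu> ?B = emeasure lborel ?B"
      by (simp add: emeasure_distr RB)
    ultimately show ?thesis
      using Bpos Bfin by (metis ennreal_mult_cancel_left mult.commute infinity_ennreal_def)
  qed
  have flip0: "emeasure lborel (uminus -` A) = emeasure lborel A" if A: "A \<in> sets borel" for A :: "'b set"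
  proof -
    have "emeasure (distr lborel borel (uminus :: 'b \<Rightarrow> 'b)) A = emeasure lborel (uminus -` A)"
      using A by (simp add: emeasure_distr)
    moreover have "lborel = distr lborel borel (\<lambda>x::'b. 0 + (-1) *\<^sub>R x)"
      using lborel_affine[of "-1" "0::'b"] by (simp add: density_1)
    ultimately show ?thesis by (simp add: o_def)
  qed
  show ?thesis
  proof (rule measure_eqI)
    fix A assume "A \<in> sets ?\<nu>"
    then have A: "A \<in> sets borel" by simp
    have A': "uminus -` A \<in> sets borel"
      using measurable_sets_borel[OF borel_measurable_uminus[OF measurable_ident] A] by simp
    have "uminus -` (uminus -` A) = A" by (auto simp: vimage_def)
    then show "emeasure ?\<nu> A = emeasure lborel A"
      using flip[OF A'] flip0[OF A] by simp
  qed simp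
qed

section \<open>Reflections and their transitivity on spheres\<close>

definition reflect :: "'b::real_inner \<Rightarrow> 'b \<Rightarrow> 'b" where
  "reflect u x = x - (2 * (x \<bullet> u)) *\<^sub>R u"

lemma orthogonal_transformation_reflect:
  assumes "norm u = 1"
  shows "orthogonal_transformation (reflect u)"
proof -
  have "u \<bullet> u = 1" using assms by (simp add: norm_eq_1)
  then show ?thesis
    unfolding orthogonal_transformation_def reflect_def
    by (auto intro!: linearI simp: algebra_simps inner_commute)
qed

text \<open>Equal norms make the hyperplane bisecting \<open>x\<close> and \<open>y\<close> pass
  through the origin, so the reflection in it is linear and exchanges the two points.\<close>

lemma reflect_transitive:
  fixes x y :: "'b::euclidean_space"
  assumes "norm x = norm y"
  shows "\<exists>R. orthogonal_transformation R \<and> R x = y"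
proof (cases "x = y")
  case True
  then show ?thesis using orthogonal_transformation_id by blast
next
  case False
  define u where "u = (x - y) /\<^sub>R norm (x - y)"
  have nz: "norm (x - y) \<noteq> 0" using False by simp
  have xy: "x \<bullet> x = y \<bullet> y" using assms by (simp add: norm_eq)
  have "(norm (x - y))^2 = 2 * (x \<bullet> (x - y))"
    unfolding power2_norm_eq_inner using xy by (simp add: algebra_simps inner_commute)
  moreover have "2 * (x \<bullet> u) / norm (x - y) = 2 * (x \<bullet> (x - y)) / (norm (x - y))\<^sup>2"
    by (simp add: u_def power2_eq_square divide_inverse)
  moreover have "(norm (x - y))\<^sup>2 \<noteq> 0" using nz by simp
  ultimately have "2 * (x \<bullet> u) / norm (x - y) = 1"
    by (metis divide_self)
  moreover have "(2 * (x \<bullet> u)) *\<^sub>R u = (2 * (x \<bullet> u) / norm (x - y)) *\<^sub>R (x - y)"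
    by (simp add: u_def divide_inverse)
  ultimately have "(2 * (x \<bullet> u)) *\<^sub>R u = x - y"
    by (metis scaleR_one)
  then have "reflect u x = y"
    by (simp add: reflect_def)
  moreover have "norm u = 1" using nz by (simp add: u_def)
  ultimately show ?thesis using orthogonal_transformation_reflect by blast
qed

section \<open>Uniqueness of the invariant probability measure\<close>

text \<open>The condition under the description operator in \<open>sphere_measure\<close>.\<close>

definition rotation_invariant_on_sphere :: "'b::euclidean_space measure \<Rightarrow> bool" where
  "rotation_invariant_on_sphere \<mu> \<longleftrightarrow> sets \<mu> = sets (restrict_space borel (sphere (0::'b) 1)) \<and>
       space \<mu> = sphere (0::'b) 1 \<and> emeasure \<mu> (space \<mu>) = 1 \<and>
       (\<forall>R. orthogonal_transformation R \<longrightarrow> distr \<mu> \<mu> R = \<mu>)"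

lemma orthogonal_transformation_borel:
  fixes R :: "'b::euclidean_space \<Rightarrow> 'b"
  assumes "orthogonal_transformation R"
  shows "R \<in> borel_measurable borel"
  using orthogonal_transformation_linear[OF assms]
  by (intro borel_measurable_continuous_onI linear_continuous_on) (simp add: linear_conv_bounded_linear)

locale rotation_invariant =
  fixes \<mu> :: "'b::euclidean_space measure"
  assumes rot: "rotation_invariant_on_sphere \<mu>"
begin

lemma sets_eq [measurable_cong]: "sets \<mu> = sets (restrict_space borel (sphere (0::'b) 1))"
  and space_eq [simp]: "space \<mu> = sphere 0 1"
  and total: "emeasure \<mu> (sphere 0 1) = 1"
  and invariant: "orthogonal_transformation R \<Longrightarrow> distr \<mu> \<mu> R = \<mu>"
  using rot unfolding rotation_invariant_on_sphere_def by auto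

sublocale finite_measure \<mu>
  by standard (simp add: total)

lemma id_measurable [measurable]: "(\<lambda>x. x) \<in> borel_measurable \<mu>"
  by (subst measurable_cong_sets[OF sets_eq refl]) (rule measurable_restrict_space1, simp)

lemma orth_measurable: "orthogonal_transformation R \<Longrightarrow> R \<in> \<mu> \<rightarrow>\<^sub>M \<mu>"
  by (subst measurable_cong_sets[OF sets_eq sets_eq])
    (auto intro!: measurable_restrict_space3 orthogonal_transformation_borel
      simp: orthogonal_transformation_norm)

lemma open_sets: "open U \<Longrightarrow> U \<inter> sphere 0 1 \<in> sets \<mu>"
  by (auto simp: sets_eq sets_restrict_space)

lemma emeasure_ball_eq:
  assumes "norm x = 1" "norm y = 1"
  shows "emeasure \<mu> (ball x r \<inter> sphere 0 1) = emeasure \<mu> (ball y r \<inter> sphere 0 1)"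
proof -
  obtain R where R: "orthogonal_transformation R" "R x = y"
    using reflect_transitive assms by metis
  have "norm (R z) = norm z" and "dist (R x) (R z) = dist x z" for z
    using orthogonal_transformation_norm[OF R(1)] linear_diff[OF orthogonal_transformation_linear[OF R(1)]]
    by (auto simp: dist_norm simp flip: linear_diff[OF orthogonal_transformation_linear[OF R(1)]])
  then have "R -` (ball y r \<inter> sphere 0 1) \<inter> sphere 0 1 = ball x r \<inter> sphere 0 1"
    using R(2) by auto
  moreover have "emeasure (distr \<mu> \<mu> R) (ball y r \<inter> sphere 0 1) = emeasure \<mu> (R -` (ball y r \<inter> sphere 0 1) \<inter> sphere 0 1)"
    using R by (subst emeasure_distr) (auto intro: orth_measurable open_sets)
  ultimately show ?thesis using invariant[OF R(1)] by simp
qed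

text \<open>By compactness finitely many balls of radius \<open>r\<close> cover the sphere. They all
  have the same measure, so measure zero would contradict total mass 1.\<close>

lemma emeasure_ball_pos:
  assumes "norm x = 1" "r > 0"
  shows "emeasure \<mu> (ball x r \<inter> sphere 0 1) \<noteq> 0"
proof
  assume 0: "emeasure \<mu> (ball x r \<inter> sphere 0 1) = 0"
  obtain C where C: "C \<subseteq> sphere (0::'b) 1" "finite C" "sphere (0::'b) 1 \<subseteq> (\<Union>c\<in>C. ball c r)"
    by (rule compactE_image[OF compact_sphere, of "sphere 0 1" "\<lambda>c. ball c r" 0 1]) (use assms in auto)
  have "emeasure \<mu> (\<Union>c\<in>C. ball c r \<inter> sphere 0 1) \<le> (\<Sum>c\<in>C. emeasure \<mu> (ball c r \<inter> sphere 0 1))"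
    using C by (intro emeasure_subadditive_finite) (auto intro: open_sets)
  also have "\<dots> = 0"
    using C 0 assms by (intro sum.neutral ballI) (subst emeasure_ball_eq[of _ x], auto)
  also have "(\<Union>c\<in>C. ball c r \<inter> sphere 0 1) = sphere 0 1"
    using C by auto
  finally show False using total by simp
qed

end

text \<open>Integrate the indicator of \<open>dist x y < r\<close> with \<open>x\<close> in
  \<open>V\<close> against the product measure. Each inner integral is the measure of a ball,
  independent of its centre; \<open>e\<close> merely represents all centres. For \<open>x\<close> in
  \<open>V\<close> the indicator vanishes unless \<open>y\<close> lies in \<open>U\<close>.\<close>

lemma rotation_invariant_Fubini:
  fixes \<mu> \<nu> :: "'b::euclidean_space measure"
  assumes "rotation_invariant_on_sphere \<mu>" "rotation_invariant_on_sphere \<nu>"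
    and U: "open U" and V: "open V" and VU: "\<And>x. x \<in> V \<Longrightarrow> norm x = 1 \<Longrightarrow> ball x r \<inter> sphere 0 1 \<subseteq> U"
    and e: "norm e = 1"
  shows "emeasure \<mu> (V \<inter> sphere 0 1) * emeasure \<nu> (ball e r \<inter> sphere 0 1)
    \<le> emeasure \<nu> (U \<inter> sphere 0 1) * emeasure \<mu> (ball e r \<inter> sphere 0 1)"
proof -
  interpret \<mu>: rotation_invariant \<mu> by standard fact
  interpret \<nu>: rotation_invariant \<nu> by standard fact
  interpret pair_sigma_finite \<mu> \<nu> ..
  have [measurable]: "U \<in> sets borel" "V \<in> sets borel" using U V by auto
  have [measurable]: "Measurable.pred (\<mu> \<Otimes>\<^sub>M \<nu>) (\<lambda>z. dist (fst z) (snd z) < r)"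
    by measurable
  have ind: "(\<integral>\<^sup>+y. indicator {y. dist x y < r} y \<partial>\<nu>) = emeasure \<nu> (ball x r \<inter> sphere 0 1)" for x
  proof -
    have "emeasure \<nu> (ball x r \<inter> sphere 0 1) = (\<integral>\<^sup>+y. indicator (ball x r \<inter> sphere 0 1) y \<partial>\<nu>)"
      by (subst nn_integral_indicator) (auto intro: \<nu>.open_sets)
    also have "\<dots> = (\<integral>\<^sup>+y. indicator {y. dist x y < r} y \<partial>\<nu>)"
      by (intro nn_integral_cong) (auto simp: indicator_def)
    finally show ?thesis ..
  qed
  have ind': "(\<integral>\<^sup>+x. indicator {y. dist x y < r} y \<partial>\<mu>) = emeasure \<mu> (ball y r \<inter> sphere 0 1)" for y
  proof -
    have "emeasure \<mu> (ball y r \<inter> sphere 0 1) = (\<integral>\<^sup>+x. indicator (ball y r \<inter> sphere 0 1) x \<partial>\<mu>)"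
      by (subst nn_integral_indicator) (auto intro: \<mu>.open_sets)
    also have "\<dots> = (\<integral>\<^sup>+x. indicator {y. dist x y < r} y \<partial>\<mu>)"
      by (intro nn_integral_cong) (auto simp: indicator_def dist_commute)
    finally show ?thesis ..
  qed
  have m1 [measurable]: "(\<lambda>z. indicator {y. dist (fst z) y < r} (snd z) :: ennreal) \<in> borel_measurable (\<mu> \<Otimes>\<^sub>M \<nu>)"
  proof -
    have "(\<lambda>z. if dist (fst z) (snd z) < r then 1 else 0 :: ennreal) \<in> borel_measurable (\<mu> \<Otimes>\<^sub>M \<nu>)"
      by measurable
    then show ?thesis by (simp add: indicator_def)
  qed
  have m2 [measurable]: "(\<lambda>y. indicator {y. dist x y < r} y :: ennreal) \<in> borel_measurable \<nu>" for x
  proof -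
    have "(\<lambda>y. if dist x y < r then 1 else 0 :: ennreal) \<in> borel_measurable \<nu>"
      by measurable
    then show ?thesis by (simp add: indicator_def)
  qed
  have m3 [measurable]: "(\<lambda>x. indicator {y. dist x y < r} y :: ennreal) \<in> borel_measurable \<mu>" for y
  proof -
    have "(\<lambda>x. if dist x y < r then 1 else 0 :: ennreal) \<in> borel_measurable \<mu>"
      by measurable
    then show ?thesis by (simp add: indicator_def)
  qed
  have "emeasure \<mu> (V \<inter> sphere 0 1) * emeasure \<nu> (ball e r \<inter> sphere 0 1)
      = (\<integral>\<^sup>+x. indicator (V \<inter> sphere 0 1) x * emeasure \<nu> (ball e r \<inter> sphere 0 1) \<partial>\<mu>)"
    using \<mu>.open_sets[OF V] by (subst nn_integral_multc) auto
  also have "\<dots> = (\<integral>\<^sup>+x. indicator V x * (\<integral>\<^sup>+y. indicator {y. dist x y < r} y \<partial>\<nu>) \<partial>\<mu>)"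
    unfolding ind using e by (intro nn_integral_cong) (auto simp: indicator_def intro: \<nu>.emeasure_ball_eq)
  also have "\<dots> = (\<integral>\<^sup>+x. (\<integral>\<^sup>+y. indicator V x * indicator {y. dist x y < r} y \<partial>\<nu>) \<partial>\<mu>)"
    by (intro nn_integral_cong nn_integral_cmult[symmetric]) auto
  also have "\<dots> \<le> (\<integral>\<^sup>+x. (\<integral>\<^sup>+y. indicator U y * indicator {y. dist x y < r} y \<partial>\<nu>) \<partial>\<mu>)"
    using VU by (intro nn_integral_mono) (auto simp: indicator_def subset_eq)
  also have "\<dots> = (\<integral>\<^sup>+y. (\<integral>\<^sup>+x. indicator U y * indicator {y. dist x y < r} y \<partial>\<mu>) \<partial>\<nu>)"
    by (rule Fubini'[symmetric]) (use m1 in \<open>auto simp: case_prod_beta'\<close>)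
  also have "\<dots> = (\<integral>\<^sup>+y. indicator U y * (\<integral>\<^sup>+x. indicator {y. dist x y < r} y \<partial>\<mu>) \<partial>\<nu>)"
    by (intro nn_integral_cong nn_integral_cmult) auto
  also have "\<dots> = (\<integral>\<^sup>+y. indicator (U \<inter> sphere 0 1) y * emeasure \<mu> (ball e r \<inter> sphere 0 1) \<partial>\<nu>)"
    unfolding ind' using e by (intro nn_integral_cong) (auto simp: indicator_def intro: \<mu>.emeasure_ball_eq)
  also have "\<dots> = emeasure \<nu> (U \<inter> sphere 0 1) * emeasure \<mu> (ball e r \<inter> sphere 0 1)"
    using \<nu>.open_sets[OF U] by (subst nn_integral_multc) auto
  finally show ?thesis .
qed

text \<open>Points of \<open>U\<close> farther than \<open>1 / Suc n\<close> from the complement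
  keep their whole ball in \<open>U\<close>, so the Fubini inequality applies, and the common
  positive ball measure cancels. These sets increase to \<open>U\<close>.\<close>

lemma rotation_invariant_open_le:
  fixes \<mu> \<nu> :: "'b::euclidean_space measure"
  assumes \<mu>: "rotation_invariant_on_sphere \<mu>" and \<nu>: "rotation_invariant_on_sphere \<nu>" and U: "open U"
  shows "emeasure \<mu> (U \<inter> sphere 0 1) \<le> emeasure \<nu> (U \<inter> sphere 0 1)"
proof -
  interpret \<mu>: rotation_invariant \<mu> by standard fact
  interpret \<nu>: rotation_invariant \<nu> by standard fact
  obtain e :: 'b where e: "norm e = 1"
    using norm_Basis SOME_Basis by blast
  \<comment> \<open>With the whole space for both open sets the Fubini inequality compares total
    masses, in both directions.\<close>
  have h_eq: "emeasure \<nu> (ball e r \<inter> sphere 0 1) = emeasure \<mu> (ball e r \<inter> sphere 0 1)" for r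
    using rotation_invariant_Fubini[OF \<mu> \<nu> open_UNIV open_UNIV _ e, of r]
      rotation_invariant_Fubini[OF \<nu> \<mu> open_UNIV open_UNIV _ e, of r] \<mu>.total \<nu>.total
    by (intro antisym) auto
  have h_fin: "emeasure \<mu> (ball e r \<inter> sphere 0 1) \<noteq> \<infinity>" for r
    using \<mu>.emeasure_finite by auto
  show ?thesis
  \<comment> \<open>\<open>infdist\<close> to the empty set is 0 by convention, so for an empty
    complement the sets \<open>V n\<close> would be empty instead of the whole space.\<close>
  proof (cases "U = UNIV")
    case True
    then show ?thesis using \<mu>.total \<nu>.total by simp
  next
    case False
    define V where "V n = {x. 1 / real (Suc n) < infdist x (- U)}" for n :: nat
    have openV: "open (V n)" for n
      unfolding V_def by (intro open_Collect_less continuous_intros)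
    have incV: "incseq V"
    proof (rule incseq_SucI)
      fix n
      have "1 / real (Suc (Suc n)) \<le> 1 / real (Suc n)"
        by (simp add: divide_simps)
      then show "V n \<subseteq> V (Suc n)"
        unfolding V_def by auto
    qed
    have UV: "(\<Union>n. V n) = U"
    proof (intro equalityI subsetI)
      fix x assume "x \<in> (\<Union>n. V n)"
      then obtain n where "1 / real (Suc n) < infdist x (- U)" by (auto simp: V_def)
      then have "infdist x (- U) \<noteq> 0"
        by (smt (verit) divide_nonneg_nonneg of_nat_0_le_iff)
      then show "x \<in> U" by (metis ComplI infdist_zero)
    next
      fix x assume "x \<in> U"
      then have "infdist x (- U) \<noteq> 0"
        using U False in_closed_iff_infdist_zero[of "- U" x] by (auto simp: closed_def)
      then have "0 < infdist x (- U)" using infdist_nonneg[of x "- U"] by linarith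
      then obtain n where "1 / real (Suc n) < infdist x (- U)"
        using reals_Archimedean by (metis inverse_eq_divide)
      then show "x \<in> (\<Union>n. V n)" by (auto simp: V_def)
    qed
    have le: "emeasure \<mu> (V n \<inter> sphere 0 1) \<le> emeasure \<nu> (U \<inter> sphere 0 1)" for n
    proof -
      let ?r = "1 / real (Suc n)"
      have "emeasure \<mu> (V n \<inter> sphere 0 1) * emeasure \<nu> (ball e ?r \<inter> sphere 0 1)
        \<le> emeasure \<nu> (U \<inter> sphere 0 1) * emeasure \<mu> (ball e ?r \<inter> sphere 0 1)"
      proof (rule rotation_invariant_Fubini[OF \<mu> \<nu> U openV _ e])
        fix x assume x: "x \<in> V n"
        show "ball x ?r \<inter> sphere 0 1 \<subseteq> U"
        proof
          fix y assume y: "y \<in> ball x ?r \<inter> sphere 0 1"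
          show "y \<in> U"
          proof (rule ccontr)
            assume "y \<notin> U"
            then have "infdist x (- U) \<le> dist x y" by (intro infdist_le) auto
            then show False using x y by (auto simp: V_def)
          qed
        qed
      qed
      then have "emeasure \<mu> (ball e ?r \<inter> sphere 0 1) * emeasure \<mu> (V n \<inter> sphere 0 1)
        \<le> emeasure \<mu> (ball e ?r \<inter> sphere 0 1) * emeasure \<nu> (U \<inter> sphere 0 1)"
        unfolding h_eq by (simp only: mult.commute)
      moreover have "emeasure \<mu> (ball e ?r \<inter> sphere 0 1) \<noteq> 0"
        by (rule \<mu>.emeasure_ball_pos[OF e]) simp
      moreover have "emeasure \<mu> (ball e ?r \<inter> sphere 0 1) \<noteq> top"
        using h_fin[of ?r] by (simp only: infinity_ennreal_def not_False_eq_True)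
      ultimately show ?thesis
        by (blast dest: iffD1[OF ennreal_mult_le_mult_iff])
    qed
    have "(\<lambda>n. emeasure \<mu> (V n \<inter> sphere 0 1)) \<longlonglongrightarrow> emeasure \<mu> (\<Union>n. V n \<inter> sphere 0 1)"
      
    proof (rule Lim_emeasure_incseq)
      show "range (\<lambda>n. V n \<inter> sphere 0 1) \<subseteq> sets \<mu>" using openV \<mu>.open_sets by blast
      show "incseq (\<lambda>n. V n \<inter> sphere 0 1)" using incV unfolding incseq_def by blast
    qed
    moreover have "(\<Union>n. V n \<inter> sphere 0 1) = U \<inter> sphere 0 1" using UV by auto
    ultimately have "(\<lambda>n. emeasure \<mu> (V n \<inter> sphere 0 1)) \<longlonglongrightarrow> emeasure \<mu> (U \<inter> sphere 0 1)"
      by (simp only:)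
    then show ?thesis by (rule LIMSEQ_le_const2) (use le in blast)
  qed
qed

text \<open>The traces of open sets generate the Borel sets of the sphere and are stable under
  intersection, so agreement on them is enough.\<close>

lemma rotation_invariant_unique:
  assumes \<mu>: "rotation_invariant_on_sphere \<mu>" and \<nu>: "rotation_invariant_on_sphere \<nu>"
  shows "\<mu> = \<nu>"
proof -
  interpret \<mu>: rotation_invariant \<mu> by standard fact
  interpret \<nu>: rotation_invariant \<nu> by standard fact
  let ?E = "(\<lambda>U. U \<inter> sphere 0 1) ` {U :: 'a set. open U}"
  have gen: "sets (restrict_space borel (sphere (0::'a) 1)) = sigma_sets (sphere 0 1) ?E"
  proof -
    have "sets (restrict_space borel (sphere (0::'a) 1)) = (\<lambda>A. A \<inter> sphere 0 1) ` sigma_sets UNIV {U. open U}"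
      by (simp add: sets_restrict_space borel_def Int_commute)
    also have "\<dots> = sigma_sets (sphere 0 1) ?E"
    proof -
      have "sphere (0::'a) 1 \<in> sets borel" by (rule borel_closed) simp
      then have "sphere (0::'a) 1 \<in> sigma_sets UNIV {U. open U}"
        by (simp add: borel_def)
      then show ?thesis
        using sigma_sets_Int[of "sphere (0::'a) 1" UNIV "{U. open U}"]
        unfolding Int_commute[of "sphere (0::'a) 1"] by auto
    qed
    finally show ?thesis .
  qed
  show ?thesis
  proof (rule measure_eqI_generator_eq[where E = ?E and A = "\<lambda>_. sphere 0 1"])
    show "Int_stable ?E"
    proof (clarsimp simp: Int_stable_def)
      fix a b :: "'a set" assume "open a" "open b"
      then show "a \<inter> sphere 0 1 \<inter> (b \<inter> sphere 0 1) \<in> ?E"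
        by (intro image_eqI[of _ _ "a \<inter> b"]) auto
    qed
    show "emeasure \<mu> X = emeasure \<nu> X" if "X \<in> ?E" for X
      using that rotation_invariant_open_le[OF \<mu> \<nu>] rotation_invariant_open_le[OF \<nu> \<mu>]
      by (auto intro!: antisym)
    show "range (\<lambda>_. sphere 0 1) \<subseteq> ?E" by (auto intro!: image_eqI[of _ _ UNIV])
    show "emeasure \<mu> (sphere 0 1) \<noteq> \<infinity>" using \<mu>.total by simp
    show "sets \<mu> = sigma_sets (sphere 0 1) ?E" "sets \<nu> = sigma_sets (sphere 0 1) ?E"
      unfolding gen[symmetric] by (rule \<mu>.sets_eq \<nu>.sets_eq)+
  qed auto
qed

section \<open>Existence of the invariant probability measure\<close>

text \<open>The cone measure: the uniform distribution on the unit ball, projected radially.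
  Orthogonal maps preserve that distribution and commute with the radial projection.\<close>

lemma rotation_invariant_exists: "\<exists>\<mu> :: 'b::euclidean_space measure. rotation_invariant_on_sphere \<mu>"
proof -
  let ?B = "ball (0::'b) 1" and ?S = "sphere (0::'b) 1"
  obtain e :: 'b where e: "norm e = 1"
    using norm_Basis SOME_Basis by blast
  \<comment> \<open>The value \<open>e\<close> at the origin is a dummy that keeps \<open>h\<close>
    inside the sphere.\<close>
  define h where "h x = (if x = 0 then e else x /\<^sub>R norm x)" for x :: 'b
  have hS: "h x \<in> ?S" for x using e by (auto simp: h_def)
  define U where "U = uniform_measure lborel ?B"
  define N where "N = restrict_space borel ?S"
  define \<mu> where "\<mu> = distr U N h"
  have "h \<in> borel_measurable borel"
    unfolding h_def by measurable
  then have hm: "h \<in> U \<rightarrow>\<^sub>M N"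
    unfolding N_def U_def using hS by (intro measurable_restrict_space2) auto
  have fin: "emeasure lborel ?B \<noteq> \<infinity>" "emeasure lborel ?B \<noteq> 0"
    using emeasure_lborel_ball_finite[of "0::'b" 1] open_not_negligible[of ?B]
    by (auto simp: negligible_iff_emeasure0)
  have spN: "space N = ?S" by (simp add: N_def space_restrict_space)
  have em: "emeasure \<mu> A = emeasure lborel (?B \<inter> h -` A) / emeasure lborel ?B"
    and bor: "h -` A \<in> sets borel" if "A \<in> sets N" for A
  proof -
    have 1: "h -` A \<inter> space U \<in> sets U" using hm that by (rule measurable_sets)
    then show "h -` A \<in> sets borel" by (simp add: U_def)
    then show "emeasure \<mu> A = emeasure lborel (?B \<inter> h -` A) / emeasure lborel ?B"
      unfolding \<mu>_def using hm that 1
      by (simp add: emeasure_distr) (simp add: U_def)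
  qed
  have "rotation_invariant_on_sphere \<mu>"
    unfolding rotation_invariant_on_sphere_def
  proof (intro conjI allI impI)
    show "sets \<mu> = sets (restrict_space borel ?S)" by (simp add: \<mu>_def N_def)
    show sp: "space \<mu> = ?S" by (simp add: \<mu>_def spN)
    have "?S \<in> sets N" using spN sets.top by metis
    moreover have "h -` ?S = UNIV" using hS by auto
    ultimately show "emeasure \<mu> (space \<mu>) = 1"
      using fin ennreal_divide_self[of "emeasure lborel ?B"] top.not_eq_extremum[of "emeasure lborel ?B"]
      by (simp add: sp em)
  next
    fix R :: "'b \<Rightarrow> 'b" assume R: "orthogonal_transformation R"
    have nR: "norm (R x) = norm x" for x using R by (rule orthogonal_transformation_norm)
    have Rm: "R \<in> N \<rightarrow>\<^sub>M N"
      unfolding N_def by (intro measurable_restrict_space3 orthogonal_transformation_borel R) (auto simp: nR)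
    have RmB: "R \<in> borel_measurable borel" using R by (rule orthogonal_transformation_borel)
    have sm: "sets \<mu> = sets N" by (simp add: \<mu>_def)
    have hR: "h (R x) = R (h x)" if "x \<noteq> 0" for x
      using that nR[of x] orthogonal_transformation_scaleR[OF R]
      by (auto simp: h_def) 
    show "distr \<mu> \<mu> R = \<mu>"
    proof (rule measure_eqI)
      fix A assume "A \<in> sets (distr \<mu> \<mu> R)"
      then have A: "A \<in> sets N" by (simp add: sm)
      have RA: "R -` A \<inter> ?S \<in> sets N"
        using measurable_sets[OF Rm A] by (simp add: spN)
      have "emeasure (distr \<mu> \<mu> R) A = emeasure \<mu> (R -` A \<inter> ?S)"
        using A Rm by (subst emeasure_distr) (auto simp: sm spN \<mu>_def cong: measurable_cong_sets)
      also have "\<dots> = emeasure lborel (?B \<inter> h -` (R -` A \<inter> ?S)) / emeasure lborel ?B"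
        by (rule em[OF RA])
      also have "emeasure lborel (?B \<inter> h -` (R -` A \<inter> ?S)) = emeasure lborel (R -` (?B \<inter> h -` A))"
      proof (rule emeasure_eq_AE)
        \<comment> \<open>At the origin \<open>h\<close> and \<open>R\<close> need not commute, so
          the two sets agree only up to that point.\<close>
        have "AE x in lborel. x \<noteq> (0::'b)" by (rule AE_lborel_singleton)
        then show "AE x in lborel. x \<in> ?B \<inter> h -` (R -` A \<inter> ?S) \<longleftrightarrow> x \<in> R -` (?B \<inter> h -` A)"
          by eventually_elim (use hS nR hR in auto)
        show "?B \<inter> h -` (R -` A \<inter> ?S) \<in> sets lborel" using bor[OF RA] by simp
        show "R -` (?B \<inter> h -` A) \<in> sets lborel"
          using measurable_sets_borel[OF RmB, of "?B \<inter> h -` A"] bor[OF A] by simp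
      qed
      also have "emeasure lborel (R -` (?B \<inter> h -` A)) = emeasure (distr lborel borel R) (?B \<inter> h -` A)"
        using RmB bor[OF A] by (subst emeasure_distr) auto
      also have "\<dots> = emeasure lborel (?B \<inter> h -` A)"
        by (simp add: distr_orthogonal_lborel[OF R])
      also have "emeasure lborel (?B \<inter> h -` A) / emeasure lborel ?B = emeasure \<mu> A"
        by (rule em[OF A, symmetric])
      finally show "emeasure (distr \<mu> \<mu> R) A = emeasure \<mu> A" .
    qed simp
  qed
  then show ?thesis by blast
qed

lemma rotation_invariant_sphere_measure:
  "rotation_invariant_on_sphere (sphere_measure :: 'b::euclidean_space measure)"
proof -
  have "sphere_measure = (THE \<mu> :: 'b measure. rotation_invariant_on_sphere \<mu>)"
    unfolding sphere_measure_def rotation_invariant_on_sphere_def ..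
  moreover have "\<exists>!\<mu> :: 'b measure. rotation_invariant_on_sphere \<mu>"
    using rotation_invariant_exists rotation_invariant_unique by blast
  ultimately show ?thesis using theI' by metis
qed

section \<open>The Steiner point of a convex body\<close>

definition support_fun :: "'b::euclidean_space set \<Rightarrow> 'b \<Rightarrow> real" where
  "support_fun K p = (SUP y\<in>K. p \<bullet> y)"

lemma support_fun_ge:
  assumes "compact K" "y \<in> K"
  shows "p \<bullet> y \<le> support_fun K p"
proof -
  have "bdd_above ((\<lambda>y. p \<bullet> y) ` K)"
    by (intro bounded_imp_bdd_above compact_imp_bounded compact_continuous_image continuous_intros assms)
  then show ?thesis unfolding support_fun_def using assms(2) by (rule cSUP_upper2) simp
qed

lemma support_fun_le:
  assumes "K \<noteq> {}" "\<And>y. y \<in> K \<Longrightarrow> p \<bullet> y \<le> b"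
  shows "support_fun K p \<le> b"
  unfolding support_fun_def using assms by (rule cSUP_least)

lemma support_fun_add_scaleR:
  assumes "compact K" "K \<noteq> {}" "0 \<le> s"
  shows "support_fun K (p + s *\<^sub>R q) \<le> support_fun K p + s * support_fun K q"
proof (rule support_fun_le[OF assms(2)])
  fix y assume y: "y \<in> K"
  show "(p + s *\<^sub>R q) \<bullet> y \<le> support_fun K p + s * support_fun K q"
    using support_fun_ge[OF assms(1) y, of p] mult_left_mono[OF support_fun_ge[OF assms(1) y, of q] assms(3)]
    by (simp add: inner_add_left)
qed

lemma continuous_support_fun:
  fixes K :: "'b::euclidean_space set"
  assumes "compact K" "K \<noteq> {}"
  shows "continuous_on UNIV (support_fun K)"
proof -
  obtain B where B: "\<And>y. y \<in> K \<Longrightarrow> norm y \<le> B" "B > 0"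
    using compact_imp_bounded[OF assms(1)] by (auto simp: bounded_pos)
  have le: "support_fun K p \<le> support_fun K q + B * norm (p - q)" for p q
  proof (rule support_fun_le[OF assms(2)])
    fix y assume y: "y \<in> K"
    have "p \<bullet> y = q \<bullet> y + (p - q) \<bullet> y" by (simp add: inner_diff_left)
    also have "(p - q) \<bullet> y \<le> norm (p - q) * norm y" by (rule norm_cauchy_schwarz)
    also have "\<dots> \<le> norm (p - q) * B" using B(1)[OF y] by (intro mult_left_mono) auto
    also have "q \<bullet> y \<le> support_fun K q" using assms(1) y by (rule support_fun_ge)
    finally show "p \<bullet> y \<le> support_fun K q + B * norm (p - q)" by (simp add: mult.commute)
  qed
  have "\<bar>support_fun K p - support_fun K q\<bar> \<le> B * norm (p - q)" for p q
    using le[of p q] le[of q p] by (simp add: norm_minus_commute)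
  then have "B-lipschitz_on UNIV (support_fun K)"
    using B(2) by (intro lipschitz_onI) (auto simp: dist_norm)
  then show ?thesis by (rule lipschitz_on_continuous_on)
qed

section \<open>Integrals over the sphere and the support inequality\<close>

context rotation_invariant
begin

lemma integrable_continuous:
  fixes f :: "'b \<Rightarrow> 'c::euclidean_space"
  assumes "continuous_on UNIV f"
  shows "integrable \<mu> f"
proof -
  have "bounded (f ` sphere 0 1)"
    by (intro compact_imp_bounded compact_continuous_image continuous_on_subset[OF assms]) auto
  then obtain B where B: "\<And>x. norm x = 1 \<Longrightarrow> norm (f x) \<le> B"
    unfolding bounded_iff by (metis imageI mem_sphere_0)
  show ?thesis
  proof (rule integrable_const_bound[of _ B])
    show "f \<in> borel_measurable \<mu>"
      using measurable_compose[OF id_measurable borel_measurable_continuous_onI[OF assms]] by simp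
  qed (use B in auto)
qed

lemma integral_orthogonal:
  fixes f :: "'b \<Rightarrow> 'c::euclidean_space"
  assumes "continuous_on UNIV f" "orthogonal_transformation R"
  shows "(\<integral>p. f (R p) \<partial>\<mu>) = (\<integral>p. f p \<partial>\<mu>)"
proof -
  have "(\<integral>p. f p \<partial>distr \<mu> \<mu> R) = (\<integral>p. f (R p) \<partial>\<mu>)"
    using assms by (intro integral_distr orth_measurable borel_measurable_integrable integrable_continuous)
  then show ?thesis using invariant[OF assms(2)] by simp
qed

text \<open>This is where the dimension factor of the Steiner point comes from: by invariance the
  integral is the same for every unit vector, and over an orthonormal basis these integrals add up
  to that of \<open>p \<bullet> p = 1\<close>.\<close>

lemma integral_inner_square:
  assumes "norm q = 1"
  shows "real DIM('b) * (\<integral>p. (p \<bullet> q)\<^sup>2 \<partial>\<mu>) = 1"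
proof -
  have *: "(\<integral>p. (p \<bullet> b)\<^sup>2 \<partial>\<mu>) = (\<integral>p. (p \<bullet> q)\<^sup>2 \<partial>\<mu>)" if b: "norm b = 1" for b
  proof -
    obtain R where R: "orthogonal_transformation R" "R b = q"
      using reflect_transitive[of b q] assms b by auto
    have "(\<integral>p. (p \<bullet> q)\<^sup>2 \<partial>\<mu>) = (\<integral>p. (R p \<bullet> q)\<^sup>2 \<partial>\<mu>)"
    proof -
      have "continuous_on UNIV (\<lambda>p. (p \<bullet> q)\<^sup>2)" by (intro continuous_intros)
      from integral_orthogonal[OF this R(1)] show ?thesis by simp
    qed
    also have "\<dots> = (\<integral>p. (p \<bullet> b)\<^sup>2 \<partial>\<mu>)"
    proof -
      have "R p \<bullet> q = p \<bullet> b" for p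
        using R(1) unfolding R(2)[symmetric] by (simp add: orthogonal_transformation_def)
      then show ?thesis by simp
    qed
    finally show ?thesis by simp
  qed
  have "real DIM('b) * (\<integral>p. (p \<bullet> q)\<^sup>2 \<partial>\<mu>) = (\<Sum>b\<in>(Basis::'b set). \<integral>p. (p \<bullet> b)\<^sup>2 \<partial>\<mu>)"
    using * by simp
  also have "\<dots> = (\<integral>p. (\<Sum>b\<in>Basis. (p \<bullet> b)\<^sup>2) \<partial>\<mu>)"
    by (rule Bochner_Integration.integral_sum[symmetric]) (intro integrable_continuous continuous_intros)
  also have "\<dots> = (\<integral>p. 1 \<partial>\<mu>)"
  proof (intro Bochner_Integration.integral_cong refl)
    fix p assume "p \<in> space \<mu>"
    then have "p \<bullet> p = 1" by (simp add: norm_eq_1)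
    then show "(\<Sum>b\<in>Basis. (p \<bullet> b)\<^sup>2) = 1"
      using euclidean_inner[of p p] by (simp only: power2_eq_square)
  qed
  also have "\<dots> = 1" using total by (simp add: measure_def)
  finally show ?thesis .
qed

text \<open>Pairing \<open>p\<close> with its mirror image \<open>p'\<close> in the hyperplane orthogonal to \<open>q\<close> and using
  subadditivity of the support function \<open>h\<close> gives
  \<open>(p \<bullet> q) * (h p - h p') \<le> 2 * (p \<bullet> q)\<^sup>2 * h q\<close>.\<close>

lemma steiner_inner_le:
  assumes K: "compact K" "K \<noteq> {}" and q: "norm q = 1"
  shows "(real DIM('b) *\<^sub>R (\<integral>p. support_fun K p *\<^sub>R p \<partial>\<mu>)) \<bullet> q \<le> support_fun K q"
proof -
  let ?h = "support_fun K"
  have ch [continuous_intros]: "continuous_on A (\<lambda>x. ?h (f x))" if "continuous_on A f" for A f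
    using continuous_on_compose2[OF continuous_support_fun[OF K] that] by simp
  have cr: "continuous_on A (reflect q)" for A
    unfolding reflect_def by (intro continuous_intros)
  have rq: "reflect q p \<bullet> q = - (p \<bullet> q)" for p
    using q by (simp add: reflect_def inner_diff_left norm_eq_1)
  have pr: "p = reflect q p + (2 * (p \<bullet> q)) *\<^sub>R q" "reflect q p = p + (2 * - (p \<bullet> q)) *\<^sub>R q" for p
    by (simp_all add: reflect_def)
  have ineq: "(p \<bullet> q) * ?h p + (reflect q p \<bullet> q) * ?h (reflect q p) \<le> 2 * (p \<bullet> q)\<^sup>2 * ?h q" for p
  proof (cases "0 \<le> p \<bullet> q")
    case True
    have "?h p \<le> ?h (reflect q p) + 2 * (p \<bullet> q) * ?h q"
      using support_fun_add_scaleR[OF K, of "2 * (p \<bullet> q)" "reflect q p" q] True pr(1)[of p] by simp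
    then have "(p \<bullet> q) * (?h p - ?h (reflect q p)) \<le> (p \<bullet> q) * (2 * (p \<bullet> q) * ?h q)"
      using True by (intro mult_left_mono) auto
    then show ?thesis by (simp add: rq algebra_simps power2_eq_square)
  next
    case False
    have "?h (reflect q p) \<le> ?h p + 2 * (- (p \<bullet> q)) * ?h q"
      using support_fun_add_scaleR[OF K, of "2 * - (p \<bullet> q)" p q] False pr(2)[of p] by simp
    then have "- (p \<bullet> q) * (?h (reflect q p) - ?h p) \<le> - (p \<bullet> q) * (2 * (- (p \<bullet> q)) * ?h q)"
      using False by (intro mult_left_mono) auto
    then show ?thesis by (simp add: rq algebra_simps power2_eq_square)
  qed
  have int1: "integrable \<mu> (\<lambda>p. (p \<bullet> q) * ?h p)"
    by (intro integrable_continuous continuous_intros)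
  have int2: "integrable \<mu> (\<lambda>p. (reflect q p \<bullet> q) * ?h (reflect q p))"
    by (intro integrable_continuous continuous_intros cr)
  have "2 * (\<integral>p. (p \<bullet> q) * ?h p \<partial>\<mu>)
      = (\<integral>p. (p \<bullet> q) * ?h p \<partial>\<mu>) + (\<integral>p. (reflect q p \<bullet> q) * ?h (reflect q p) \<partial>\<mu>)"
  proof -
    have "continuous_on UNIV (\<lambda>p. (p \<bullet> q) * ?h p)" by (intro continuous_intros)
    from integral_orthogonal[OF this orthogonal_transformation_reflect[OF q]]
    show ?thesis by simp
  qed
  also have "\<dots> = (\<integral>p. (p \<bullet> q) * ?h p + (reflect q p \<bullet> q) * ?h (reflect q p) \<partial>\<mu>)"
    using int1 int2 by (rule Bochner_Integration.integral_add[symmetric])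
  also have "\<dots> \<le> (\<integral>p. 2 * (p \<bullet> q)\<^sup>2 * ?h q \<partial>\<mu>)"
    by (intro integral_mono Bochner_Integration.integrable_add int1 int2 ineq)
      (intro integrable_continuous continuous_intros)
  also have "\<dots> = 2 * ((\<integral>p. (p \<bullet> q)\<^sup>2 \<partial>\<mu>) * ?h q)"
    by simp
  finally have "(\<integral>p. (p \<bullet> q) * ?h p \<partial>\<mu>) \<le> (\<integral>p. (p \<bullet> q)\<^sup>2 \<partial>\<mu>) * ?h q" by simp
  then have "real DIM('b) * (\<integral>p. (p \<bullet> q) * ?h p \<partial>\<mu>) \<le> real DIM('b) * ((\<integral>p. (p \<bullet> q)\<^sup>2 \<partial>\<mu>) * ?h q)"
    by (rule mult_left_mono) simp
  also have "\<dots> = ?h q"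
    using integral_inner_square[OF q] by (simp flip: mult.assoc)
  also have "(\<integral>p. (p \<bullet> q) * ?h p \<partial>\<mu>) = (\<integral>p. ?h p *\<^sub>R p \<partial>\<mu>) \<bullet> q"
  proof -
    have "integrable \<mu> (\<lambda>p. ?h p *\<^sub>R p)" by (intro integrable_continuous continuous_intros)
    then show ?thesis by (simp add: mult.commute flip: integral_inner_left)
  qed
  finally show ?thesis by simp
qed

end

text \<open>A compact convex set is the intersection of its supporting half-spaces, and
  \<open>steiner_inner_le\<close> places the Steiner point in each of them.\<close>

lemma steiner_point_mem:
  fixes K :: "'b::euclidean_space set"
  assumes K: "compact K" "K \<noteq> {}" "convex K"
  shows "steiner_point K \<in> K"
proof (rule ccontr)
  interpret rotation_invariant "sphere_measure :: 'b measure"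
    by standard (rule rotation_invariant_sphere_measure)
  define s where "s = steiner_point K"
  have s: "s = real DIM('b) *\<^sub>R (\<integral>p. support_fun K p *\<^sub>R p \<partial>sphere_measure)"
    by (simp add: s_def steiner_point_def support_fun_def)
  assume "steiner_point K \<notin> K"
  then obtain a b where ab: "a \<bullet> s < b" "\<And>x. x \<in> K \<Longrightarrow> a \<bullet> x > b"
    using separating_hyperplane_closed_point[OF K(3) compact_imp_closed[OF K(1)]]
    unfolding s_def by metis
  have "a \<noteq> 0" using ab K(2) by fastforce
  \<comment> \<open>The separation puts \<open>K\<close> on the side where \<open>a\<close> is
    large, so the outward unit normal is opposite to \<open>a\<close>.\<close>
  define q where "q = - (a /\<^sub>R norm a)"
  have q: "norm q = 1" using \<open>a \<noteq> 0\<close> by (simp add: q_def)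
  have "support_fun K q \<le> - (b / norm a)"
    using K(2) ab(2) \<open>a \<noteq> 0\<close>
    by (intro support_fun_le) (auto simp: q_def divide_simps intro: less_imp_le)
  moreover have "- (b / norm a) < s \<bullet> q"
    using ab(1) \<open>a \<noteq> 0\<close> by (simp add: q_def divide_simps inner_commute)
  moreover have "s \<bullet> q \<le> support_fun K q"
    unfolding s by (rule steiner_inner_le[OF K(1,2) q])
  ultimately show False by simp
qed

section \<open>Epigraphs of conjugate functions\<close>

text \<open>One real inequality for each \<open>p\<close> replaces the extended-real supremum; where
  the conjugate is infinite, no \<open>r\<close> qualifies. The form also shows the set as an
  intersection of half-spaces with normals \<open>(p, -1)\<close>.\<close>

definition epi_conj :: "('a::euclidean_space \<Rightarrow> real) \<Rightarrow> ('a \<times> real) set" where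
  "epi_conj h = {(v, r). \<forall>p. v \<bullet> p - r \<le> h p}"

lemma epi_conjI: "(\<And>p. fst z \<bullet> p - snd z \<le> h p) \<Longrightarrow> z \<in> epi_conj h"
  by (auto simp: epi_conj_def case_prod_beta)

lemma epi_conjD: "z \<in> epi_conj h \<Longrightarrow> fst z \<bullet> p - snd z \<le> h p"
  by (auto simp: epi_conj_def)

lemma epiE_eq_epi_conj: "epiE H t x = epi_conj (H t x)"
proof -
  have "v \<bullet> p - s \<le> r \<longleftrightarrow> v \<bullet> p - r \<le> s" for v p :: 'a and r s :: real
    by linarith
  then show ?thesis
    by (auto simp: epiE_def epi_conj_def conj_H_def SUP_le_iff)
qed

lemma epi_conj_halfspaces: "epi_conj h = (\<Inter>p. {z. (p, -1) \<bullet> z \<le> h p})"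
  by (auto simp: epi_conj_def inner_prod_def inner_commute)

lemma closed_epi_conj: "closed (epi_conj h)"
  unfolding epi_conj_halfspaces by (intro closed_INT ballI closed_halfspace_le)

lemma convex_epi_conj: "convex (epi_conj h)"
  unfolding epi_conj_halfspaces by (intro convex_INT convex_halfspace_le)

section \<open>Subgradients and distances between epigraphs\<close>

text \<open>Separate the point of the graph from the strict epigraph. The last coefficient
  \<open>a2\<close> is nonnegative since the epigraph is closed upwards. It cannot vanish: otherwise
  \<open>a1\<close> would attain its minimum at \<open>p\<close> over the whole space, forcing
  \<open>a1 = 0\<close> as well. Division by \<open>a2\<close> gives the slope.\<close>

lemma subgradient_exists:
  fixes h :: "'a::euclidean_space \<Rightarrow> real"
  assumes h: "convex_on UNIV h"
  obtains w where "\<And>q. h p + w \<bullet> (q - p) \<le> h q"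
proof -
  define A where "A = {z. h (fst z) < snd z}"
  have cA: "convex A"
    unfolding A_def
  proof (rule convexI, clarsimp)
    fix x r y s and u v :: real
    assume *: "h x < r" "h y < s" "0 \<le> u" "0 \<le> v" "u + v = 1"
    have "h (u *\<^sub>R x + v *\<^sub>R y) \<le> u * h x + v * h y"
      using h * unfolding convex_on_def by auto
    also have "\<dots> < u * r + v * s"
    proof (cases "u = 0")
      case True then show ?thesis using * by simp
    next
      case False
      then show ?thesis using * by (intro add_less_le_mono mult_strict_left_mono mult_left_mono) auto
    qed
    finally show "h (u *\<^sub>R x + v *\<^sub>R y) < u * r + v * s" .
  qed
  have "(p, h p + 1) \<in> A" "{(p, h p)} \<inter> A = {}" by (auto simp: A_def)
  then have "\<exists>a b. a \<noteq> 0 \<and> (\<forall>x\<in>{(p, h p)}. a \<bullet> x \<le> b) \<and> (\<forall>x\<in>A. b \<le> a \<bullet> x)"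
    using cA by (intro separating_hyperplane_sets) auto
  then obtain a b where a: "a \<noteq> 0" "a \<bullet> (p, h p) \<le> b" "\<And>z. z \<in> A \<Longrightarrow> b \<le> a \<bullet> z"
    by blast
  obtain a1 a2 where a12: "a = (a1, a2)" by fastforce
  have A: "a1 \<bullet> p + a2 * h p \<le> a1 \<bullet> q + a2 * s" if "h q < s" for q s
    using a(2) a(3)[of "(q, s)"] that by (auto simp: A_def a12)
  have "0 \<le> a2" using A[of p "h p + 1"] by (simp add: algebra_simps)
  moreover have "a2 \<noteq> 0"
  proof
    assume "a2 = 0"
    then have "a1 \<bullet> p \<le> a1 \<bullet> q" for q using A[of q "h q + 1"] by simp
    from this[of "p - a1"] have "a1 \<bullet> a1 \<le> 0" by (simp add: algebra_simps)
    then have "a1 = 0" using inner_ge_zero[of a1] by (simp only: order.eq_iff flip: inner_eq_zero_iff)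
    then show False using a(1) a12 \<open>a2 = 0\<close> by (simp add: zero_prod_def)
  qed
  ultimately have a2: "0 < a2" by simp
  show ?thesis
  proof (rule that[of "- (a1 /\<^sub>R a2)"])
    fix q
    have "h p + - (a1 /\<^sub>R a2) \<bullet> (q - p) \<le> s" if "h q < s" for s
      using A[OF that] a2 by (simp add: divide_simps algebra_simps)
    then show "h p + - (a1 /\<^sub>R a2) \<bullet> (q - p) \<le> h q" by (rule dense_ge)
  qed
qed

text \<open>At a subgradient Fenchel's inequality is an equality, so this point lies on the graph of
  the conjugate.\<close>

lemma subgradient_mem_epi_conj:
  assumes "\<And>q. h p + w \<bullet> (q - p) \<le> h q"
  shows "(w, w \<bullet> p - h p) \<in> epi_conj h"
  using assms by (intro epi_conjI) (simp add: algebra_simps)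

lemma epi_conj_nonempty:
  assumes "convex_on UNIV h"
  shows "epi_conj h \<noteq> {}"
  using subgradient_exists[OF assms, of 0] subgradient_mem_epi_conj by (metis empty_iff)

text \<open>Testing with large multiples of \<open>fst z\<close> shows that a slope above the linear
  growth rate of \<open>h\<close> cannot be bounded by \<open>h\<close>.\<close>

lemma epi_conj_norm_le:
  assumes z: "z \<in> epi_conj h" and L: "\<And>p. \<bar>h p - h 0\<bar> \<le> L * norm p"
  shows "norm (fst z) \<le> L"
proof (rule ccontr)
  let ?v = "fst z"
  assume "\<not> norm ?v \<le> L"
  moreover have "0 \<le> L"
  proof -
    obtain b :: 'a where "b \<in> Basis" using nonempty_Basis by blast
    then show ?thesis using L[of b] by simp
  qed
  ultimately have pos: "0 < norm ?v * (norm ?v - L)" by (intro mult_pos_pos) linarith+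
  have le: "s * (norm ?v * (norm ?v - L)) \<le> snd z + h 0" if "0 \<le> s" for s
  proof -
    have "?v \<bullet> (s *\<^sub>R ?v) \<le> snd z + h (s *\<^sub>R ?v)" using epi_conjD[OF z, of "s *\<^sub>R ?v"] by simp
    moreover have "h (s *\<^sub>R ?v) \<le> h 0 + L * (s * norm ?v)"
      using L[of "s *\<^sub>R ?v"] that by simp
    ultimately show ?thesis
      by (simp add: algebra_simps power2_norm_eq_inner[symmetric] power2_eq_square)
  qed
  \<comment> \<open>Chosen so that the left side of \<open>le\<close> equals
    \<open>\<bar>snd z + h 0\<bar> + 1\<close>, just too much.\<close>
  define s where "s = (\<bar>snd z + h 0\<bar> + 1) / (norm ?v * (norm ?v - L))"
  have "0 \<le> s" using pos by (simp add: s_def)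
  moreover have "s * (norm ?v * (norm ?v - L)) = \<bar>snd z + h 0\<bar> + 1"
    using pos unfolding s_def by (intro nonzero_eq_divide_eq[THEN iffD1]) auto
  ultimately show False using le[of s] by linarith
qed

text \<open>The vector \<open>(q1, q2)\<close> from the projection to \<open>a\<close> is an outer
  normal of the second epigraph, hence up to scaling of the form \<open>(p, -1)\<close>. In such a
  direction the support function of the epigraph of the conjugate of \<open>h\<close> is
  \<open>h p\<close> (biconjugation), so comparing \<open>h1\<close> with \<open>h2\<close> bounds
  the squared distance by \<open>\<delta> * (norm q1 + \<bar>q2\<bar>)\<close>. The last factor is
  at most twice the distance, whence the constant 2.\<close>

lemma dist_closest_point_epi_conj:
  assumes cvx: "convex_on UNIV h2" and a: "a \<in> epi_conj h1"
    and le: "\<And>p. h1 p \<le> h2 p + \<delta> * (1 + norm p)" and \<delta>: "0 \<le> \<delta>"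
  shows "dist a (closest_point (epi_conj h2) a) \<le> 2 * \<delta>"
proof -
  let ?E = "epi_conj h2"
  define b where "b = closest_point ?E a"
  obtain v r where vr: "a = (v, r)" by fastforce
  obtain b1 b2 where b12: "b = (b1, b2)" by fastforce
  define q1 q2 where "q1 = v - b1" and "q2 = r - b2"
  have bE: "b \<in> ?E"
    unfolding b_def by (rule closest_point_in_set[OF closed_epi_conj epi_conj_nonempty[OF cvx]])
  have dot: "q1 \<bullet> (w - b1) + q2 * (s - b2) \<le> 0" if "(w, s) \<in> ?E" for w s
    using closest_point_dot[OF convex_epi_conj closed_epi_conj that, of a]
    unfolding b_def[symmetric] by (simp add: b12 vr q1_def q2_def)
  \<comment> \<open>The epigraph is closed upwards, so its outer normals do not point
    upwards.\<close>
  have "(b1, b2 + 1) \<in> ?E"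
    using bE unfolding b12 by (auto simp: epi_conj_def intro: order_trans[rotated])
  then have q2: "q2 \<le> 0" using dot[of b1 "b2 + 1"] by simp
  have step: "q1 \<bullet> q1 + q2 * q2 \<le> \<delta> * (norm q1 + \<bar>q2\<bar>) + \<epsilon> * (\<delta> + r + h2 0)" if \<epsilon>: "\<epsilon> > 0" for \<epsilon>
  proof -
    \<comment> \<open>A horizontal normal, \<open>q2 = 0\<close>, corresponds to no finite
      \<open>p\<close>. The shift by \<epsilon> tilts it; the additional terms are multiples of
      \<epsilon> and disappear in the limit.\<close>
    define \<sigma> where "\<sigma> = - q2 + \<epsilon>"
    have \<sigma>: "0 < \<sigma>" using q2 \<epsilon> by (simp add: \<sigma>_def)
    define p where "p = q1 /\<^sub>R \<sigma>"
    have q1p: "q1 = \<sigma> *\<^sub>R p" using \<sigma> by (simp add: p_def)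
    obtain w where w: "\<And>q. h2 p + w \<bullet> (q - p) \<le> h2 q"
      using subgradient_exists[OF cvx] by blast
    define s where "s = w \<bullet> p - h2 p"
    have ws: "(w, s) \<in> ?E" unfolding s_def by (rule subgradient_mem_epi_conj[OF w])
    have s0: "- s \<le> h2 0" using epi_conjD[OF ws, of 0] by simp
    have 1: "\<sigma> * h2 p + \<epsilon> * s \<le> q1 \<bullet> b1 + q2 * b2"
    proof -
      have "\<sigma> * h2 p + \<epsilon> * s = q1 \<bullet> w + q2 * s"
        by (simp add: q1p s_def \<sigma>_def algebra_simps inner_commute)
      then show ?thesis using dot[OF ws] by (simp add: algebra_simps)
    qed
    have 2: "q1 \<bullet> v + q2 * r \<le> \<sigma> * h1 p + \<epsilon> * r"
    proof -
      have "p \<bullet> v \<le> r + h1 p" using epi_conjD[OF a, of p] by (simp add: vr inner_commute)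
      then have "\<sigma> * (p \<bullet> v) \<le> \<sigma> * (r + h1 p)" using \<sigma> by (intro mult_left_mono) auto
      then show ?thesis by (simp add: q1p \<sigma>_def algebra_simps)
    qed
    have 3: "\<sigma> * h1 p \<le> \<sigma> * h2 p + \<delta> * (\<sigma> + norm q1)"
    proof -
      have "\<sigma> * h1 p \<le> \<sigma> * (h2 p + \<delta> * (1 + norm p))"
        using \<sigma> le[of p] by (intro mult_left_mono) auto
      also have "\<dots> = \<sigma> * h2 p + \<delta> * (\<sigma> + norm q1)"
        using \<sigma> by (simp add: q1p algebra_simps)
      finally show ?thesis .
    qed
    have 4: "\<epsilon> * (- s) \<le> \<epsilon> * h2 0" using s0 \<epsilon> by (intro mult_left_mono) auto
    have "q1 \<bullet> q1 + q2 * q2 = (q1 \<bullet> v + q2 * r) - (q1 \<bullet> b1 + q2 * b2)"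
      by (simp add: q1_def q2_def algebra_simps)
    also have "\<dots> \<le> \<delta> * (\<sigma> + norm q1) + \<epsilon> * r + \<epsilon> * (- s)" using 1 2 3 by simp
    also have "\<dots> \<le> \<delta> * (norm q1 + \<bar>q2\<bar>) + \<epsilon> * (\<delta> + r + h2 0)"
      using 4 q2 by (simp add: \<sigma>_def algebra_simps)
    finally show ?thesis .
  qed
  have sq: "q1 \<bullet> q1 + q2 * q2 \<le> \<delta> * (norm q1 + \<bar>q2\<bar>)"
  proof (rule field_le_epsilon)
    fix e :: real assume e: "0 < e"
    define K where "K = \<bar>\<delta> + r + h2 0\<bar> + 1"
    have K: "K > 0" by (simp add: K_def)
    have "e / K * (\<delta> + r + h2 0) \<le> e / K * K"
      using e K by (intro mult_left_mono) (auto simp: K_def)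
    then have "e / K * (\<delta> + r + h2 0) \<le> e" using K by simp
    then show "q1 \<bullet> q1 + q2 * q2 \<le> \<delta> * (norm q1 + \<bar>q2\<bar>) + e"
      using step[of "e / K"] e K by (smt (verit) divide_pos_pos)
  qed
  have ab: "a - b = (q1, q2)" by (simp add: vr b12 q1_def q2_def)
  have "(dist a b)\<^sup>2 = q1 \<bullet> q1 + q2 * q2"
    by (simp add: dist_norm ab power2_norm_eq_inner)
  moreover have "norm q1 \<le> dist a b" "\<bar>q2\<bar> \<le> dist a b"
    using norm_fst_le[of q1 q2] norm_snd_le[of q2 q1] by (auto simp: dist_norm ab)
  then have "\<delta> * (norm q1 + \<bar>q2\<bar>) \<le> \<delta> * (2 * dist a b)"
    using \<delta> by (intro mult_left_mono) auto
  ultimately have "dist a b * dist a b \<le> 2 * \<delta> * dist a b"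
    using sq by (simp add: power2_eq_square)
  then show ?thesis
    unfolding b_def[symmetric] using \<delta> zero_le_dist[of a b] by (cases "dist a b = 0") auto
qed

text \<open>A subgradient at 0 gives the point \<open>(w, - h 0)\<close>. The bound measures how far
  zero velocity at zero cost is from being admissible, which is needed wherever no arc is at
  hand.\<close>

lemma infdist_zero_epi_conj_le:
  assumes cvx: "convex_on UNIV h" and L: "\<And>p. \<bar>h p - h 0\<bar> \<le> L * norm p"
  shows "dist 0 (closest_point (epi_conj h) 0) \<le> L + \<bar>h 0\<bar>"
proof -
  obtain w where w: "\<And>q. h 0 + w \<bullet> (q - 0) \<le> h q"
    using subgradient_exists[OF cvx] by blast
  have mem: "(w, w \<bullet> 0 - h 0) \<in> epi_conj h"
    by (rule subgradient_mem_epi_conj[OF w])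
  have "dist 0 (closest_point (epi_conj h) 0) \<le> dist 0 (w, w \<bullet> 0 - h 0)"
    by (rule closest_point_le[OF closed_epi_conj mem])
  also have "\<dots> \<le> norm w + \<bar>h 0\<bar>"
    using norm_Pair_le[of w "- h 0"] norm_minus_cancel[of "(w, - h 0)"] by (simp add: dist_norm)
  also have "norm w \<le> L" using epi_conj_norm_le[OF mem L] by simp
  finally show ?thesis by simp
qed

section \<open>The Steiner representation as a selection of the epigraph\<close>

lemma PhiS_props:
  assumes "convex_on UNIV (H t x)"
  shows "compact (PhiS H t x a)" "convex (PhiS H t x a)" "PhiS H t x a \<noteq> {}"
proof -
  let ?E = "epi_conj (H t x)"
  have eq: "PhiS H t x a = ?E \<inter> cball a (2 * infdist a ?E)"
    by (simp add: PhiS_def epiE_eq_epi_conj)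
  show "compact (PhiS H t x a)"
    unfolding eq by (intro closed_Int_compact closed_epi_conj compact_cball)
  show "convex (PhiS H t x a)"
    unfolding eq by (intro convex_Int convex_epi_conj convex_cball)
  obtain y where "y \<in> ?E" "infdist a ?E = dist a y"
    using infdist_attains_inf[OF closed_epi_conj epi_conj_nonempty[OF assms]] by blast
  then have "y \<in> PhiS H t x a" unfolding eq by simp
  then show "PhiS H t x a \<noteq> {}" by blast
qed

lemma steiner_mem_epi_conj:
  assumes "convex_on UNIV (H t x)"
  shows "(steiner_f H t x a, steiner_l H t x a) \<in> epi_conj (H t x)"
  using steiner_point_mem[OF PhiS_props(1,3,2)[of H t x a]] assms
  by (auto simp: steiner_f_def steiner_l_def PhiS_def epiE_eq_epi_conj)

text \<open>For \<open>a\<close> in the epigraph the radius \<open>2 * infdist\<close> is zero, so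
  the ball shrinks to the single point \<open>a\<close>.\<close>

lemma steiner_of_mem:
  assumes cvx: "convex_on UNIV (H t x)" and a: "a \<in> epi_conj (H t x)"
  shows "steiner_f H t x a = fst a" "steiner_l H t x a = snd a"
proof -
  have "steiner_point (PhiS H t x a) \<in> PhiS H t x a"
    using steiner_point_mem[OF PhiS_props(1,3,2)] cvx by blast
  moreover have "PhiS H t x a \<subseteq> {a}"
    using a by (auto simp: PhiS_def epiE_eq_epi_conj)
  ultimately show "steiner_f H t x a = fst a" "steiner_l H t x a = snd a"
    by (auto simp: steiner_f_def steiner_l_def)
qed

section \<open>Absolutely continuous functions\<close>

text \<open>Reindexing for arbitrary finite families; the intervals of a tagged division come
  indexed by pairs of a tag and an interval.\<close>

lemma abs_cont_onD:
  assumes "abs_cont_on x a b" "0 < \<epsilon>"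
  shows "\<exists>\<delta>>0. \<forall>(I :: 'i set) u v. finite I \<and> (\<forall>i\<in>I. a \<le> u i \<and> u i \<le> v i \<and> v i \<le> b) \<and>
        disjoint_family_on (\<lambda>i. {u i<..<v i}) I \<and> (\<Sum>i\<in>I. v i - u i) < \<delta>
      \<longrightarrow> (\<Sum>i\<in>I. norm (x (v i) - x (u i))) < \<epsilon>"
proof -
  obtain \<delta> where \<delta>: "\<delta> > 0" and *: "\<And>(n::nat) (u::nat \<Rightarrow> real) v.
        (\<forall>i<n. a \<le> u i \<and> u i \<le> v i \<and> v i \<le> b) \<Longrightarrow>
        (\<forall>i<n. \<forall>j<n. i \<noteq> j \<longrightarrow> {u i<..<v i} \<inter> {u j<..<v j} = {}) \<Longrightarrow>
        (\<Sum>i<n. v i - u i) < \<delta> \<Longrightarrow> (\<Sum>i<n. norm (x (v i) - x (u i))) < \<epsilon>"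
    using assms unfolding abs_cont_on_def by meson
  show ?thesis
  proof (intro exI[of _ \<delta>] conjI \<delta> allI impI, elim conjE)
    fix I :: "'i set" and u v
    assume I: "finite I" and uv: "\<forall>i\<in>I. a \<le> u i \<and> u i \<le> v i \<and> v i \<le> b"
      and disj: "disjoint_family_on (\<lambda>i. {u i<..<v i}) I" and len: "(\<Sum>i\<in>I. v i - u i) < \<delta>"
    obtain h where h: "bij_betw h {0..<card I} I"
      using ex_bij_betw_nat_finite[OF I] by blast
    have sum_h: "(\<Sum>i\<in>I. f i) = (\<Sum>i<card I. f (h i))" for f :: "'i \<Rightarrow> real"
      using sum.reindex_bij_betw[OF h, of f] by (simp add: lessThan_atLeast0)
    have hI: "h i \<in> I" if "i < card I" for i
      using h that by (auto simp: bij_betw_def)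
    have hinj: "h i \<noteq> h j" if "i < card I" "j < card I" "i \<noteq> j" for i j
      using bij_betw_imp_inj_on[OF h] that by (auto dest: inj_onD)
    have "(\<Sum>i<card I. norm (x (v (h i)) - x (u (h i)))) < \<epsilon>"
    proof (rule *)
      show "\<forall>i<card I. a \<le> u (h i) \<and> u (h i) \<le> v (h i) \<and> v (h i) \<le> b"
        using uv hI by blast
      show "\<forall>i<card I. \<forall>j<card I. i \<noteq> j \<longrightarrow> {u (h i)<..<v (h i)} \<inter> {u (h j)<..<v (h j)} = {}"
        using disj hI hinj unfolding disjoint_family_on_def by blast
      show "(\<Sum>i<card I. v (h i) - u (h i)) < \<delta>"
        using len by (simp add: sum_h)
    qed
    then show "(\<Sum>i\<in>I. norm (x (v i) - x (u i))) < \<epsilon>" by (simp add: sum_h)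
  qed
qed

text \<open>The gauge integral is estimated directly. Intervals tagged outside \<open>N\<close> are
  controlled by the derivative. Those tagged in \<open>N\<close> lie in an open set of small
  measure, where absolute continuity makes the sum of the increments small.\<close>

lemma abs_cont_on_has_integral:
  fixes x :: "real \<Rightarrow> 'b::euclidean_space"
  assumes ac: "abs_cont_on x a b" and ab: "a \<le> b" and N: "negligible N"
    and deriv: "\<And>t. t \<in> {a..b} - N \<Longrightarrow> (x has_vector_derivative v t) (at t within {a..b})"
  shows "(v has_integral (x b - x a)) {a..b}"
proof -
  \<comment> \<open>Zero on \<open>N\<close>, so intervals tagged there contribute nothing to the
    Riemann sum.\<close>
  define w where "w t = (if t \<in> N then 0 else v t)" for t
  have "(w has_integral (x b - x a)) {a..b}"
    unfolding has_integral_real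
  proof (intro allI impI)
    fix e :: real assume e: "e > 0"
    \<comment> \<open>The summand 1 keeps the denominator positive for \<open>a = b\<close> and
      makes \<open>e1 * (b - a)\<close> strictly less than \<open>e / 2\<close>.\<close>
    define e1 where "e1 = e / 2 / (b - a + 1)"
    have e1: "e1 > 0" using e ab by (simp add: e1_def)
    have "\<exists>d>0. t \<in> {a..b} - N \<longrightarrow>
         (\<forall>y\<in>{a..b}. norm (y-t) < d \<longrightarrow> norm (x y - x t - (y-t) *\<^sub>R v t) \<le> e1 * norm (y-t))" for t
    proof (cases "t \<in> {a..b} - N")
      case True
      then show ?thesis
        using deriv[OF True] e1 unfolding has_vector_derivative_def has_derivative_within_alt by blast
    qed (auto intro: exI[of _ 1])
    then obtain d where d: "\<And>t. 0 < d t"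
        "\<And>t y. \<lbrakk>t \<in> {a..b} - N; y \<in> {a..b}; norm (y-t) < d t\<rbrakk>
           \<Longrightarrow> norm (x y - x t - (y-t) *\<^sub>R v t) \<le> e1 * norm (y-t)"
      by metis
    obtain \<delta> where \<delta>: "0 < \<delta>"
      and acd: "\<forall>(I :: (real \<times> real set) set) u v. finite I \<and> (\<forall>i\<in>I. a \<le> u i \<and> u i \<le> v i \<and> v i \<le> b) \<and>
        disjoint_family_on (\<lambda>i. {u i<..<v i}) I \<and> (\<Sum>i\<in>I. v i - u i) < \<delta>
      \<longrightarrow> (\<Sum>i\<in>I. norm (x (v i) - x (u i))) < e / 2"
      using abs_cont_onD[OF ac half_gt_zero[OF e]] by blast
    obtain U where U: "open U" "N \<subseteq> U" "U \<in> lmeasurable" "measure lebesgue U < \<delta>"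
    proof -
      have "N \<in> sets lebesgue" using N by (rule negligible_imp_sets)
      then obtain T where T: "open T" "N \<subseteq> T" "T - N \<in> lmeasurable" "emeasure lebesgue (T - N) < ennreal \<delta>"
        using sets_lebesgue_outer_open[OF _ \<delta>] by metis
      have "(T - N) \<union> N \<in> lmeasurable"
        using T(3) negligible_imp_measurable[OF N] by (rule fmeasurable.Un)
      moreover have "(T - N) \<union> N = T" using T by auto
      ultimately have Tm: "T \<in> lmeasurable" by (simp only:)
      moreover have "measure lebesgue T = measure lebesgue (T - N)"
        using measure_negligible_symdiff[of "T - N" T] T N
        by (auto simp: Un_Diff intro: negligible_subset fmeasurableD)
      moreover have "measure lebesgue (T - N) < \<delta>"
        using T(4) \<delta> unfolding emeasure_eq_measure2[OF T(3)] by (simp add: ennreal_less_iff)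
      ultimately show ?thesis using T that by auto
    qed
    define G where "G t = ball t (d t) \<inter> (if t \<in> N then U else UNIV)" for t
    have gauge: "gauge G"
      using U(1,2) d(1) by (auto simp: gauge_def G_def open_Int)
    have est: "norm ((\<Sum>(t, K)\<in>p. measure lborel K *\<^sub>R w t) - (x b - x a)) < e"
      if p: "p tagged_division_of {a..b}" and fine: "G fine p" for p
    proof -
      have fin: "finite p" using p by blast
      have K: "\<exists>u v. K = {u..v} \<and> u \<le> v \<and> t \<in> {u..v} \<and> a \<le> u \<and> v \<le> b" if tK: "(t, K) \<in> p" for t K
      proof -
        obtain u v where "K = cbox u v" using tagged_division_ofD(4)[OF p tK] by blast
        moreover have "t \<in> K" "K \<subseteq> {a..b}" using tagged_division_ofD(2,3)[OF p tK] by auto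
        ultimately show ?thesis by (auto simp: subset_eq)
      qed
      have eqs: "x b - x a = (\<Sum>(t,K)\<in>p. x (Sup K) - x (Inf K))"
        "b - a = (\<Sum>(t,K)\<in>p. Sup K - Inf K)"
        using additive_tagged_division_1[OF ab p, of x] additive_tagged_division_1[OF ab p, of "\<lambda>x. x"] by auto
      define P where "P = {z \<in> p. fst z \<in> N}"
      have Pfin: "finite P" using fin by (simp add: P_def)
      have "norm (measure lborel K *\<^sub>R w t - (x (Sup K) - x (Inf K))) \<le> e1 * (Sup K - Inf K)"
        if tK: "(t, K) \<in> p - P" for t K
      proof -
        obtain u v' where uv: "K = {u..v'}" "u \<le> v'" "t \<in> {u..v'}" "a \<le> u" "v' \<le> b" using K tK by blast
        have t: "t \<in> {a..b} - N" using tK uv by (auto simp: P_def)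
        have "K \<subseteq> ball t (d t)" using fine tK by (auto simp: fine_def G_def)
        moreover have "u \<in> K" "v' \<in> K" using uv by auto
        ultimately have "u \<in> ball t (d t)" "v' \<in> ball t (d t)" by blast+
        then have nu: "norm (u - t) < d t" "norm (v' - t) < d t" by (auto simp: dist_norm norm_minus_commute)
        have 1: "norm (x u - x t - (u - t) *\<^sub>R v t) \<le> e1 * (t - u)"
          using d(2)[OF t _ nu(1)] uv t by auto
        have 2: "norm (x v' - x t - (v' - t) *\<^sub>R v t) \<le> e1 * (v' - t)"
          using d(2)[OF t _ nu(2)] uv t by auto
        have "measure lborel K *\<^sub>R w t - (x (Sup K) - x (Inf K))
          = (x u - x t - (u - t) *\<^sub>R v t) - (x v' - x t - (v' - t) *\<^sub>R v t)"
          using uv t by (simp add: w_def algebra_simps)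
        also have "norm \<dots> \<le> e1 * (t - u) + e1 * (v' - t)"
          using 1 2 by (rule norm_triangle_le_diff[OF add_mono])
        finally show ?thesis using uv by (simp add: algebra_simps)
      qed
      then have sum1: "norm (\<Sum>(t,K)\<in>p - P. measure lborel K *\<^sub>R w t - (x (Sup K) - x (Inf K)))
          \<le> (\<Sum>(t,K)\<in>p - P. e1 * (Sup K - Inf K))"
        by (intro sum_norm_le) auto
      also have "\<dots> \<le> (\<Sum>(t,K)\<in>p. e1 * (Sup K - Inf K))"
        using fin K e1 by (intro sum_mono2) fastforce+
      also have "\<dots> = e1 * (b - a)"
        unfolding eqs(2) by (simp add: sum_distrib_left case_prod_beta)
      also have "\<dots> < e / 2"
        using e ab by (simp add: e1_def divide_simps)
      finally have sum1: "norm (\<Sum>(t,K)\<in>p - P. measure lborel K *\<^sub>R w t - (x (Sup K) - x (Inf K))) < e / 2" .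
      have disj: "disjoint_family_on (\<lambda>z. {Inf (snd z)<..<Sup (snd z)}) P"
        unfolding disjoint_family_on_def
      proof (intro ballI impI)
        fix y z assume yz: "y \<in> P" "z \<in> P" "y \<noteq> z"
        have "interior (snd y) \<inter> interior (snd z) = {}"
          by (rule tagged_division_ofD(5)[OF p, of "fst y" _ "fst z"]) (use yz in \<open>auto simp: P_def\<close>)
        moreover have "{Inf (snd y)<..<Sup (snd y)} = interior (snd y)" if "y \<in> P" for y
          using K[of "fst y" "snd y"] that by (auto simp: P_def interior_atLeastAtMost_real)
        ultimately show "{Inf (snd y)<..<Sup (snd y)} \<inter> {Inf (snd z)<..<Sup (snd z)} = {}"
          using yz by simp
      qed
      have Pz: "a \<le> Inf (snd z) \<and> Inf (snd z) \<le> Sup (snd z) \<and> Sup (snd z) \<le> b" if "z \<in> P" for z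
        using K[of "fst z" "snd z"] that by (auto simp: P_def)
      have "(\<Sum>z\<in>P. Sup (snd z) - Inf (snd z)) = (\<Sum>z\<in>P. measure lebesgue {Inf (snd z)<..<Sup (snd z)})"
        using Pz by (intro sum.cong) auto
      also have "\<dots> = measure lebesgue (\<Union>z\<in>P. {Inf (snd z)<..<Sup (snd z)})"
      proof (rule measure_finite_Union[symmetric])
        show "emeasure lebesgue {Inf (snd z)<..<Sup (snd z)} \<noteq> \<infinity>" if "z \<in> P" for z
          using Pz[OF that] by simp
      qed (use Pfin disj in auto)
      also have "\<dots> \<le> measure lebesgue U"
      proof (rule measure_mono_fmeasurable)
        show "(\<Union>z\<in>P. {Inf (snd z)<..<Sup (snd z)}) \<subseteq> U"
        proof clarsimp
          fix t K y assume tK: "(t, K) \<in> P" and y: "Inf K < y" "y < Sup K"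
          obtain u v' where "K = {u..v'}" "u \<le> v'" using K[of t K] tK by (auto simp: P_def)
          then have "y \<in> K" using y by auto
          moreover have "K \<subseteq> G t" "t \<in> N" using fine tK by (auto simp: fine_def P_def)
          ultimately show "y \<in> U" by (auto simp: G_def)
        qed
      qed (use U Pfin in \<open>auto intro!: sets.finite_UN\<close>)
      finally have "(\<Sum>z\<in>P. norm (x (Sup (snd z)) - x (Inf (snd z)))) < e / 2"
        using U(4) by (intro acd[rule_format] conjI ballI Pfin disj Pz) auto
      moreover have "norm (\<Sum>(t,K)\<in>P. measure lborel K *\<^sub>R w t - (x (Sup K) - x (Inf K)))
        \<le> (\<Sum>z\<in>P. norm (x (Sup (snd z)) - x (Inf (snd z))))"
        by (rule sum_norm_le) (auto simp: P_def w_def norm_minus_commute)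
      ultimately have sum2: "norm (\<Sum>(t,K)\<in>P. measure lborel K *\<^sub>R w t - (x (Sup K) - x (Inf K))) < e / 2"
        by simp
      have "(\<Sum>(t, K)\<in>p. measure lborel K *\<^sub>R w t) - (x b - x a)
        = (\<Sum>(t,K)\<in>p. measure lborel K *\<^sub>R w t - (x (Sup K) - x (Inf K)))"
        unfolding eqs(1) by (simp add: sum_subtractf case_prod_beta)
      also have "\<dots> = (\<Sum>(t,K)\<in>p - P. measure lborel K *\<^sub>R w t - (x (Sup K) - x (Inf K)))
          + (\<Sum>(t,K)\<in>P. measure lborel K *\<^sub>R w t - (x (Sup K) - x (Inf K)))"
        by (rule sum.subset_diff) (use fin in \<open>auto simp: P_def\<close>)
      also have "norm \<dots> < e / 2 + e / 2"
        using sum1 sum2 by (rule norm_add_less)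
      finally show ?thesis by simp
    qed
    show "\<exists>\<gamma>. gauge \<gamma> \<and> (\<forall>\<D>. \<D> tagged_division_of {a..b} \<and> \<gamma> fine \<D> \<longrightarrow>
        norm ((\<Sum>(x, k)\<in>\<D>. measure lborel k *\<^sub>R w x) - (x b - x a)) < e)"
    proof (intro exI[of _ G] conjI allI impI gauge)
      fix p assume "p tagged_division_of {a..b} \<and> G fine p"
      then show "norm ((\<Sum>(x, k)\<in>p. measure lborel k *\<^sub>R w x) - (x b - x a)) < e"
        by (elim conjE) (rule est)
    qed
  qed
  then show ?thesis
    by (rule has_integral_spike[OF N, rotated]) (auto simp: w_def)
qed

text \<open>Forward difference quotients converge almost everywhere. Applied to \<open>w\<close> and
  to its reflection \<open>\<lambda>s. w (- s)\<close>, this yields the right and the left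
  derivative.\<close>

lemma indefinite_integral_has_vector_derivative_ae:
  fixes v :: "real \<Rightarrow> 'b::euclidean_space"
  assumes v: "v integrable_on {a..b}"
  obtains N where "negligible N"
    "\<And>t. t \<in> {a..b} - N \<Longrightarrow> ((\<lambda>s. integral {a..s} v) has_vector_derivative v t) (at t within {a..b})"
proof -
  define w where "w = (\<lambda>t. if t \<in> {a..b} then v t else 0)"
  have "w integrable_on UNIV" using v unfolding w_def by (simp only: Henstock_Kurzweil_Integration.integrable_restrict_UNIV)
  then have w: "w integrable_on cbox c d" for c d
    by (rule integrable_on_subcbox) simp
  have w': "(\<lambda>s. w (- s)) integrable_on cbox c d" for c d
    using w[of "- d" "- c"] Henstock_Kurzweil_Integration.integrable_reflect_real[where f = w and a = "- d" and b = "- c"] by simp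
  obtain N1 where N1: "negligible N1" and R: "\<And>x e. \<lbrakk>x \<notin> N1; 0 < e\<rbrakk> \<Longrightarrow>
      \<exists>d>0. \<forall>h. 0 < h \<and> h < d \<longrightarrow> norm (integral {x..x + h} w /\<^sub>R h - w x) < e"
    using integrable_ccontinuous_explicit[OF w] by (auto simp: cbox_interval)
  obtain N2 where N2: "negligible N2" and L: "\<And>x e. \<lbrakk>x \<notin> N2; 0 < e\<rbrakk> \<Longrightarrow>
      \<exists>d>0. \<forall>h. 0 < h \<and> h < d \<longrightarrow> norm (integral {x..x + h} (\<lambda>s. w (- s)) /\<^sub>R h - w (- x)) < e"
    using integrable_ccontinuous_explicit[OF w'] by (auto simp: cbox_interval)
  \<comment> \<open>The second exceptional set belongs to the reflected function and has to be
    reflected back.\<close>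
  define N where "N = N1 \<union> uminus ` N2"
  have N: "negligible N"
    unfolding N_def using N1 N2
    by (intro negligible_Un negligible_differentiable_image_negligible) (auto intro!: derivative_intros)
  show ?thesis
  proof (rule that[OF N])
    fix t assume t: "t \<in> {a..b} - N"
    let ?F = "\<lambda>s. integral {a..s} v"
    have diff: "?F z - ?F y = integral {y..z} w" if "a \<le> y" "y \<le> z" "z \<le> b" for y z
    proof -
      have "integral {a..y} v + integral {y..z} v = integral {a..z} v"
        using that by (intro Henstock_Kurzweil_Integration.integral_combine integrable_subinterval_real[OF v]) auto
      moreover have "integral {y..z} v = integral {y..z} w"
        using that by (intro integral_cong) (auto simp: w_def)
      ultimately show ?thesis by (metis add_diff_cancel_left')
    qed
    show "(?F has_vector_derivative v t) (at t within {a..b})"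
      unfolding has_vector_derivative_def has_derivative_within_alt
    proof (intro conjI allI impI)
      show "bounded_linear (\<lambda>x. x *\<^sub>R v t)" by (rule bounded_linear_scaleR_left)
      fix e :: real assume e: "0 < e"
      obtain d1 where d1: "d1 > 0" "\<And>h. \<lbrakk>0 < h; h < d1\<rbrakk> \<Longrightarrow> norm (integral {t..t + h} w /\<^sub>R h - w t) < e"
        using R[OF _ e, of t] t by (auto simp: N_def)
      have "- t \<notin> N2" using t by (force simp: N_def)
      then obtain d2 where d2: "d2 > 0"
        "\<And>h. \<lbrakk>0 < h; h < d2\<rbrakk> \<Longrightarrow> norm (integral {- t..- t + h} (\<lambda>s. w (- s)) /\<^sub>R h - w t) < e"
        using L[OF _ e, of "- t"] by auto
      have wt: "w t = v t" using t by (simp add: w_def)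
      have scale: "norm (I - h *\<^sub>R w t) \<le> e * h" if "norm (I /\<^sub>R h - w t) < e" "0 < h" for I h
      proof -
        have "I - h *\<^sub>R w t = h *\<^sub>R (I /\<^sub>R h - w t)" using that(2) by (simp add: algebra_simps)
        then have "norm (I - h *\<^sub>R w t) = h * norm (I /\<^sub>R h - w t)" using that(2) by simp
        also have "\<dots> \<le> h * e" using that by (intro mult_left_mono) auto
        finally show ?thesis by (simp add: mult.commute)
      qed
      have "norm (?F y - ?F t - (y - t) *\<^sub>R v t) \<le> e * norm (y - t)"
        if y: "y \<in> {a..b}" "norm (y - t) < min d1 d2" for y
      proof -
        consider "y = t" | "y > t" | "y < t" by linarith
        then show ?thesis
        proof cases
          case 2
          then show ?thesis
            using scale[OF d1(2)[of "y - t"]] diff[of t y] t y wt by simp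
        next
          case 3
          have "integral {- t..- t + (t - y)} (\<lambda>s. w (- s)) = integral {y..t} w"
            using Henstock_Kurzweil_Integration.integral_reflect_real[where f = w and a = y and b = t] by simp
          then have "norm (integral {y..t} w - (t - y) *\<^sub>R w t) \<le> e * (t - y)"
            using scale[OF d2(2)[of "t - y"]] 3 y by simp
          moreover have "?F y - ?F t - (y - t) *\<^sub>R v t = - (integral {y..t} w - (t - y) *\<^sub>R w t)"
            using diff[of y t] t y 3 wt by (simp add: algebra_simps)
          ultimately show ?thesis using 3 by (simp add: norm_minus_commute)
        qed simp
      qed
      then show "\<exists>d>0. \<forall>y\<in>{a..b}. norm (y - t) < d \<longrightarrow>
          norm (?F y - ?F t - (y - t) *\<^sub>R v t) \<le> e * norm (y - t)"
        using d1(1) d2(1) by (intro exI[of _ "min d1 d2"]) auto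
    qed
  qed
qed

lemma sum_integral_disjoint_le:
  fixes h :: "real \<Rightarrow> real"
  assumes h: "h integrable_on {a..b}" "\<And>t. t \<in> {a..b} \<Longrightarrow> 0 \<le> h t"
    and I: "finite I" "\<And>i. i \<in> I \<Longrightarrow> a \<le> u i \<and> u i \<le> v i \<and> v i \<le> b"
    and disj: "disjoint_family_on (\<lambda>i. {u i<..<v i}) I"
  shows "(\<Sum>i\<in>I. integral {u i..v i} h) \<le> integral {a..b} h"
proof -
  let ?f = "\<lambda>i t. if t \<in> {u i<..<v i} then h t else 0"
  have int: "(?f i) integrable_on {a..b}" and eq: "integral {u i..v i} h = integral {a..b} (?f i)"
    if i: "i \<in> I" for i
  proof -
    have sub: "{a..b} \<inter> {u i<..<v i} = {u i<..<v i}" using I(2)[OF i] by auto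
    have "h integrable_on {u i..v i}"
      using I(2)[OF i] by (intro integrable_subinterval_real[OF h(1)]) auto
    then have "h integrable_on {u i<..<v i}"
      using integrable_on_Icc_iff_Ioo by blast
    then show "(?f i) integrable_on {a..b}"
      using sub unfolding Henstock_Kurzweil_Integration.integrable_restrict_Int by (simp only: Int_commute)
    show "integral {u i..v i} h = integral {a..b} (?f i)"
      using sub unfolding Henstock_Kurzweil_Integration.integral_restrict_Int integral_open_interval_real
      by (simp only: Int_commute)
  qed
  have "(\<Sum>i\<in>I. integral {u i..v i} h) = integral {a..b} (\<lambda>t. \<Sum>i\<in>I. ?f i t)"
    using int eq I(1) by (subst integral_sum) auto
  also have "\<dots> \<le> integral {a..b} h"
  proof (rule integral_le)
    show "(\<lambda>t. \<Sum>i\<in>I. ?f i t) integrable_on {a..b}"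
      using int I(1) by (intro integrable_sum) auto
    fix t assume t: "t \<in> {a..b}"
    show "(\<Sum>i\<in>I. ?f i t) \<le> h t"
    proof (cases "\<exists>i\<in>I. t \<in> {u i<..<v i}")
      case True
      then obtain i where i: "i \<in> I" "t \<in> {u i<..<v i}" by blast
      have "?f j t = 0" if "j \<in> I - {i}" for j
      proof -
        have "{u i<..<v i} \<inter> {u j<..<v j} = {}"
          using disj i(1) that unfolding disjoint_family_on_def by blast
        then have "t \<notin> {u j<..<v j}" using i(2) by blast
        then show ?thesis by (simp only: if_False)
      qed
      then have "(\<Sum>i\<in>I. ?f i t) = ?f i t"
        using I(1) i(1) by (subst sum.remove[of _ i]) auto
      then show ?thesis using i by simp
    next
      case False
      then have "(\<Sum>i\<in>I. ?f i t) = 0" by (intro sum.neutral) auto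
      then show ?thesis using h(2)[OF t] by simp
    qed
  qed (use h in auto)
  finally show ?thesis .
qed

text \<open>Truncation: \<open>norm (v t)\<close> is at most \<open>real n\<close> plus an excess
  whose total integral is below \<open>\<epsilon> / 2\<close> for large \<open>n\<close>. The
  bounded part then dictates the choice of \<delta>; its \<open>n + 1\<close> avoids division by
  zero.\<close>

lemma abs_cont_on_integral:
  fixes v :: "real \<Rightarrow> 'b::euclidean_space"
  assumes v: "v absolutely_integrable_on {a..b}"
  shows "abs_cont_on (\<lambda>t. x0 + integral {a..t} v) a b"
  unfolding abs_cont_on_def
proof (intro allI impI)
  fix \<epsilon> :: real assume \<epsilon>: "0 < \<epsilon>"
  let ?g = "\<lambda>t. norm (v t)"
  have ga: "?g absolutely_integrable_on {a..b}" using absolutely_integrable_norm[OF v] by (simp add: o_def)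
  then have gi: "?g integrable_on {a..b}" by (rule set_lebesgue_integral_eq_integral(1))
  have hi: "(\<lambda>t. max (?g t - real n) 0) integrable_on {a..b}" for n :: nat
  proof (rule set_lebesgue_integral_eq_integral(1))
    show "(\<lambda>t. max (?g t - real n) 0) absolutely_integrable_on {a..b}"
      by (intro absolutely_integrable_max_1 set_integral_diff ga) auto
  qed
  have "(\<lambda>n. integral {a..b} (\<lambda>t. max (?g t - real n) 0)) \<longlonglongrightarrow> integral {a..b} (\<lambda>t. 0)"
  proof (rule dominated_convergence(2)[OF hi gi])
    fix t
    obtain N :: nat where "?g t \<le> real N" using real_arch_simple by blast
    then have "\<forall>\<^sub>F n in sequentially. max (?g t - real n) 0 = 0"
      by (auto simp: eventually_sequentially intro!: exI[of _ N] max_absorb2)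
    then show "(\<lambda>n. max (?g t - real n) 0) \<longlonglongrightarrow> 0" by (rule tendsto_eventually)
  qed auto
  then have "\<forall>\<^sub>F n in sequentially. integral {a..b} (\<lambda>t. max (?g t - real n) 0) < \<epsilon> / 2"
    using \<epsilon> by (intro order_tendstoD) auto
  then obtain n :: nat where n: "integral {a..b} (\<lambda>t. max (?g t - real n) 0) < \<epsilon> / 2"
    by (auto simp: eventually_sequentially)
  let ?h = "\<lambda>t. max (?g t - real n) 0"
  show "\<exists>\<delta>>0. \<forall>(k::nat) u w. (\<forall>i<k. a \<le> u i \<and> u i \<le> w i \<and> w i \<le> b) \<and>
        (\<forall>i<k. \<forall>j<k. i \<noteq> j \<longrightarrow> {u i<..<w i} \<inter> {u j<..<w j} = {}) \<and>
        (\<Sum>i<k. w i - u i) < \<delta>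
        \<longrightarrow> (\<Sum>i<k. norm (x0 + integral {a..w i} v - (x0 + integral {a..u i} v))) < \<epsilon>"
  proof (intro exI[of _ "\<epsilon> / (2 * (real n + 1))"] conjI allI impI; (elim conjE)?)
    show "0 < \<epsilon> / (2 * (real n + 1))" using \<epsilon> by simp
    fix k :: nat and u w
    assume uw: "\<forall>i<k. a \<le> u i \<and> u i \<le> w i \<and> w i \<le> b"
      and disj: "\<forall>i<k. \<forall>j<k. i \<noteq> j \<longrightarrow> {u i<..<w i} \<inter> {u j<..<w j} = {}"
      and len: "(\<Sum>i<k. w i - u i) < \<epsilon> / (2 * (real n + 1))"
    have vi: "v integrable_on {a..b}" using v by (rule set_lebesgue_integral_eq_integral(1))
    have bound: "norm (x0 + integral {a..w i} v - (x0 + integral {a..u i} v))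
        \<le> real n * (w i - u i) + integral {u i..w i} ?h" if "i < k" for i
    proof -
      have i: "a \<le> u i" "u i \<le> w i" "w i \<le> b" using uw that by auto
      have sub: "f integrable_on {u i..w i}" if "f integrable_on {a..b}" for f :: "real \<Rightarrow> 'c::banach"
        using i by (intro integrable_subinterval_real[OF that]) auto
      have "integral {a..u i} v + integral {u i..w i} v = integral {a..w i} v"
        using i by (intro Henstock_Kurzweil_Integration.integral_combine integrable_subinterval_real[OF vi]) auto
      then have "norm (x0 + integral {a..w i} v - (x0 + integral {a..u i} v)) = norm (integral {u i..w i} v)"
        by (metis add_diff_cancel_left add_diff_cancel_left')
      also have "\<dots> \<le> integral {u i..w i} (\<lambda>t. real n + ?h t)"
        using sub[OF vi] sub[OF hi[of n]]
        by (intro integral_norm_bound_integral integrable_add integrable_const_ivl) auto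
      also have "\<dots> = real n * (w i - u i) + integral {u i..w i} ?h"
        using sub[OF hi[of n]] i by (subst integral_add) auto
      finally show ?thesis .
    qed
    have "(\<Sum>i<k. norm (x0 + integral {a..w i} v - (x0 + integral {a..u i} v)))
        \<le> (\<Sum>i<k. real n * (w i - u i) + integral {u i..w i} ?h)"
      using bound by (intro sum_mono) auto
    also have "\<dots> = real n * (\<Sum>i<k. w i - u i) + (\<Sum>i<k. integral {u i..w i} ?h)"
      by (simp add: sum.distrib sum_distrib_left)
    also have "(\<Sum>i<k. integral {u i..w i} ?h) \<le> integral {a..b} ?h"
      using uw disj by (intro sum_integral_disjoint_le hi) (auto simp: disjoint_family_on_def)
    also have "real n * (\<Sum>i<k. w i - u i) \<le> real n * (\<epsilon> / (2 * (real n + 1)))"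
      using len by (intro mult_left_mono) auto
    also have "real n * (\<epsilon> / (2 * (real n + 1))) \<le> \<epsilon> / 2"
      using \<epsilon> by (simp add: divide_simps)
    also have "\<epsilon> / 2 + integral {a..b} ?h < \<epsilon>" using n by simp
    finally show "(\<Sum>i<k. norm (x0 + integral {a..w i} v - (x0 + integral {a..u i} v))) < \<epsilon>"
      by simp
  qed
qed

text \<open>Serves for composition with a function that is Lipschitz on the range, and with
  \<open>B = 1\<close> for restriction to a shorter interval.\<close>

lemma abs_cont_on_dominated:
  assumes x: "abs_cont_on x a b" and "b' \<le> b" and B: "B > 0"
    and le: "\<And>u w. \<lbrakk>a \<le> u; u \<le> w; w \<le> b'\<rbrakk> \<Longrightarrow> norm (y w - y u) \<le> B * norm (x w - x u)"
  shows "abs_cont_on y a b'"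
  unfolding abs_cont_on_def
proof (intro allI impI)
  fix \<epsilon> :: real assume "0 < \<epsilon>"
  then have "\<epsilon> / B > 0" using B by simp
  then obtain \<delta> where \<delta>: "\<delta> > 0" and *: "\<forall>(n::nat) (u::nat \<Rightarrow> real) v.
        (\<forall>i<n. a \<le> u i \<and> u i \<le> v i \<and> v i \<le> b) \<and>
        (\<forall>i<n. \<forall>j<n. i \<noteq> j \<longrightarrow> {u i<..<v i} \<inter> {u j<..<v j} = {}) \<and>
        (\<Sum>i<n. v i - u i) < \<delta> \<longrightarrow> (\<Sum>i<n. norm (x (v i) - x (u i))) < \<epsilon> / B"
    using x unfolding abs_cont_on_def by blast
  show "\<exists>\<delta>>0. \<forall>(n::nat) (u::nat \<Rightarrow> real) v.
        (\<forall>i<n. a \<le> u i \<and> u i \<le> v i \<and> v i \<le> b') \<and>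
        (\<forall>i<n. \<forall>j<n. i \<noteq> j \<longrightarrow> {u i<..<v i} \<inter> {u j<..<v j} = {}) \<and>
        (\<Sum>i<n. v i - u i) < \<delta> \<longrightarrow> (\<Sum>i<n. norm (y (v i) - y (u i))) < \<epsilon>"
  proof (intro exI[of _ \<delta>] conjI \<delta> allI impI, elim conjE)
    fix n :: nat and u v :: "nat \<Rightarrow> real"
    assume uv: "\<forall>i<n. a \<le> u i \<and> u i \<le> v i \<and> v i \<le> b'"
      "\<forall>i<n. \<forall>j<n. i \<noteq> j \<longrightarrow> {u i<..<v i} \<inter> {u j<..<v j} = {}" "(\<Sum>i<n. v i - u i) < \<delta>"
    have "(\<Sum>i<n. norm (y (v i) - y (u i))) \<le> (\<Sum>i<n. B * norm (x (v i) - x (u i)))"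
      using uv(1) by (intro sum_mono le) auto
    also have "\<dots> = B * (\<Sum>i<n. norm (x (v i) - x (u i)))" by (simp add: sum_distrib_left)
    also have "\<dots> < B * (\<epsilon> / B)"
      using uv \<open>b' \<le> b\<close> B by (intro mult_strict_left_mono *[rule_format]) (auto intro: order_trans)
    finally show "(\<Sum>i<n. norm (y (v i) - y (u i))) < \<epsilon>" using B by simp
  qed
qed

text \<open>The rate 2 in the exponent makes the integral against \<open>c\<close> at most half of
  the weight itself. This is the Bielecki trick for turning a Volterra operator into a
  contraction.\<close>

lemma exp_weight_integral:
  fixes c :: "real \<Rightarrow> real"
  assumes c: "c integrable_on {a..b}" "\<And>t. t \<in> {a..b} \<Longrightarrow> 0 \<le> c t" and t: "t \<in> {a..b}"
  defines "C \<equiv> \<lambda>t. integral {a..t} c"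
  shows "((\<lambda>s. c s * exp (2 * C s)) has_integral (exp (2 * C t) - 1) / 2) {a..t}"
proof -
  have ab: "a \<le> t" "t \<le> b" using t by auto
  have ct: "c integrable_on {a..t}" using ab by (intro integrable_subinterval_real[OF c(1)]) auto
  have c0: "\<And>s. s \<in> {a..t} \<Longrightarrow> 0 \<le> c s" using c(2) ab by auto
  have ca: "c absolutely_integrable_on {a..t}"
    using ct c0 by (rule nonnegative_absolutely_integrable_1)
  have mono: "C u \<le> C w" if "a \<le> u" "u \<le> w" "w \<le> t" for u w
    unfolding C_def using that c0 
    by (intro integral_subset_le integrable_subinterval_real[OF ct]) auto
  have C0: "C a = 0" by (simp add: C_def)
  \<comment> \<open>A Lipschitz constant of \<open>\<lambda>z. exp (2 * z)\<close> below
    \<open>C t\<close>, the largest value of \<open>C\<close> on the interval.\<close>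
  define B where "B = 2 * exp (2 * C t)"
  have Bpos: "B > 0" by (simp add: B_def)
  have lip: "norm (exp (2 * C w) - exp (2 * C u)) \<le> B * norm (C w - C u)"
    if "a \<le> u" "u \<le> w" "w \<le> t" for u w
  proof -
    have 1: "C u \<le> C w" "C w \<le> C t" using mono that by auto
    have "1 + (2 * C u - 2 * C w) \<le> exp (2 * C u - 2 * C w)" by (rule exp_ge_add_one_self)
    then have "1 - exp (2 * C u - 2 * C w) \<le> 2 * C w - 2 * C u" by linarith
    then have "exp (2 * C w) * (1 - exp (2 * C u - 2 * C w)) \<le> exp (2 * C w) * (2 * C w - 2 * C u)"
      by (intro mult_left_mono) auto
    also have "\<dots> \<le> exp (2 * C t) * (2 * C w - 2 * C u)"
      using 1 by (intro mult_right_mono) auto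
    finally have "exp (2 * C w) - exp (2 * C u) \<le> exp (2 * C t) * (2 * C w - 2 * C u)"
      by (simp add: algebra_simps flip: exp_add)
    then show ?thesis using 1 by (simp add: B_def algebra_simps)
  qed
  have acC: "abs_cont_on C a t"
    using abs_cont_on_integral[OF ca, of 0] by (simp add: C_def)
  have ac: "abs_cont_on (\<lambda>s. exp (2 * C s)) a t"
    by (rule abs_cont_on_dominated[OF acC order_refl Bpos lip])
  obtain N where N: "negligible N"
    and d: "\<And>s. s \<in> {a..t} - N \<Longrightarrow> (C has_vector_derivative c s) (at s within {a..t})"
    using indefinite_integral_has_vector_derivative_ae[OF ct] unfolding C_def by metis
  have "((\<lambda>s. 2 * (c s * exp (2 * C s))) has_integral (exp (2 * C t) - exp (2 * C a))) {a..t}"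
  proof (rule abs_cont_on_has_integral[OF ac ab(1) N])
    fix s assume s: "s \<in> {a..t} - N"
    have "(C has_real_derivative c s) (at s within {a..t})"
      using d[OF s] by (simp add: has_real_derivative_iff_has_vector_derivative)
    then have "((\<lambda>s. exp (2 * C s)) has_real_derivative 2 * (c s * exp (2 * C s))) (at s within {a..t})"
      by (auto intro!: derivative_eq_intros)
    then show "((\<lambda>s. exp (2 * C s)) has_vector_derivative 2 * (c s * exp (2 * C s))) (at s within {a..t})"
      by (simp add: has_real_derivative_iff_has_vector_derivative)
  qed
  from has_integral_mult_right[OF this, of "1/2"] show ?thesis by (simp add: C0)
qed

section \<open>Measurable projections\<close>

text \<open>For a simple function in place of \<open>y\<close> only countably many sections
  \<open>h t z\<close> occur; continuity in the second argument passes to the limit.\<close>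

lemma borel_measurable_caratheodory:
  fixes h :: "'s \<Rightarrow> 'b::{metric_space, second_countable_topology} \<Rightarrow> 'c::{metric_space}"
  assumes meas: "\<And>z. (\<lambda>t. h t z) \<in> borel_measurable M"
    and cont: "\<And>t. t \<in> space M \<Longrightarrow> continuous_on UNIV (h t)"
    and y: "y \<in> borel_measurable M"
  shows "(\<lambda>t. h t (y t)) \<in> borel_measurable M"
proof -
  obtain F where F: "\<And>i. simple_function M (F i)" "\<And>t. t \<in> space M \<Longrightarrow> (\<lambda>i. F i t) \<longlonglongrightarrow> y t"
    using borel_measurable_implies_sequence_metric[OF y, of undefined] by blast
  have "(\<lambda>t. h t (F i t)) \<in> borel_measurable M" for i
  proof (rule measurable_compose_countable'[where I = "F i ` space M" and g = "F i"])
    show "F i \<in> M \<rightarrow>\<^sub>M count_space (F i ` space M)"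
      using F(1)[of i] by (auto simp: simple_function_def measurable_def)
        (metis (no_types, lifting) F(1) simple_functionD(2))
    show "countable (F i ` space M)"
      using F(1)[of i] by (simp add: simple_function_def countable_finite)
  qed (rule meas)
  then show ?thesis
  proof (rule borel_measurable_LIMSEQ_metric)
    fix t assume t: "t \<in> space M"
    have "isCont (h t) (y t)" using cont[OF t] by (simp add: continuous_on_eq_continuous_at)
    then show "(\<lambda>i. h t (F i t)) \<longlonglongrightarrow> h t (y t)"
      using F(2)[OF t] by (rule isCont_tendsto_compose)
  qed
qed

lemma epi_conj_denseI:
  fixes h :: "'a::euclidean_space \<Rightarrow> real" and p :: "nat \<Rightarrow> 'a"
  assumes cont: "continuous_on UNIV h" and p: "\<And>X. open X \<Longrightarrow> X \<noteq> {} \<Longrightarrow> \<exists>j. p j \<in> X"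
    and le: "\<And>j. fst z \<bullet> p j - snd z \<le> h (p j)"
  shows "z \<in> epi_conj h"
proof (rule epi_conjI, rule ccontr)
  fix q
  let ?X = "{q. h q < fst z \<bullet> q - snd z}"
  assume "\<not> fst z \<bullet> q - snd z \<le> h q"
  then have "q \<in> ?X" by simp
  then have "?X \<noteq> {}" by blast
  moreover have "open ?X"
    using cont by (intro open_Collect_less continuous_intros) auto
  ultimately obtain j where "p j \<in> ?X" using p by blast
  then show False using le[of j] by simp
qed

text \<open>Existence of \<open>e\<close> is an uncountable union over points. Compactness makes it
  countable: a common point exists iff, for every \<open>m\<close>, some point of a countable dense
  set satisfies finitely many of the constraints up to \<open>1 / Suc m\<close>.\<close>

lemma sets_epi_conj_hit:
  fixes h :: "'s \<Rightarrow> 'a::euclidean_space \<Rightarrow> real"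
  assumes meas: "\<And>p. (\<lambda>t. h t p) \<in> borel_measurable M"
    and cont: "\<And>t. t \<in> space M \<Longrightarrow> continuous_on UNIV (h t)"
    and a: "a \<in> borel_measurable M" and \<rho>: "\<rho> \<in> borel_measurable M"
    and C: "closed C" "C \<noteq> {}"
  shows "{t \<in> space M. \<exists>e\<in>C. dist e (a t) \<le> \<rho> t \<and> e \<in> epi_conj (h t)} \<in> sets M"
proof -
  obtain D :: "'a set" where D: "countable D" "\<And>X. open X \<Longrightarrow> X \<noteq> {} \<Longrightarrow> \<exists>d\<in>D. d \<in> X"
    by (erule countable_dense_setE)
  have Dne: "D \<noteq> {}" using D(2)[of UNIV] by auto
  define p where "p = from_nat_into D"
  have p: "\<And>X. open X \<Longrightarrow> X \<noteq> {} \<Longrightarrow> \<exists>j. p j \<in> X"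
    using D Dne by (metis from_nat_into_surj p_def)
  obtain D' :: "('a \<times> real) set" where D': "countable D'" "\<And>X. open X \<Longrightarrow> X \<noteq> {} \<Longrightarrow> \<exists>d\<in>D'. d \<in> X"
    by (erule countable_dense_setE)
  note [measurable] = meas a \<rho>
  \<comment> \<open>The relaxed constraints are strict and define open sets, so a genuine solution
    has dense points nearby that satisfy them. The number of tested \<open>p j\<close> grows with
    \<open>m\<close>, so that every \<open>p j\<close> is eventually tested.\<close>
  let ?P = "\<lambda>t m e. infdist e C < 1 / real (Suc m) \<and> dist e (a t) < \<rho> t + 1 / real (Suc m) \<and>
      (\<forall>j\<in>{..<m}. fst e \<bullet> p j - snd e - h t (p j) < 1 / real (Suc m))"
  have "{t \<in> space M. \<forall>m. \<exists>e\<in>D'. ?P t m e} \<in> sets M"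
  proof -
    have "Measurable.pred M (\<lambda>t. ?P t m e)" for m e
    proof -
      have 1: "Measurable.pred M (\<lambda>t. dist e (a t) < \<rho> t + 1 / real (Suc m))" by measurable
      have 2: "Measurable.pred M (\<lambda>t. fst e \<bullet> p j - snd e - h t (p j) < 1 / real (Suc m))" for j
        by measurable
      have 3: "Measurable.pred M (\<lambda>t. \<forall>j\<in>{..<m}. fst e \<bullet> p j - snd e - h t (p j) < 1 / real (Suc m))"
        using 2 by (rule pred_intros_finite(3)[OF finite_lessThan])
      show ?thesis
        using 1 3 by (cases "infdist e C < 1 / real (Suc m)") simp_all
    qed
    then have "Measurable.pred M (\<lambda>t. \<forall>m. \<exists>e\<in>D'. ?P t m e)"
      using D'(1) by (intro pred_intros_countable pred_intros_countable_bounded) auto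
    then show ?thesis by (simp add: pred_def)
  qed
  also have "{t \<in> space M. \<forall>m. \<exists>e\<in>D'. ?P t m e}
      = {t \<in> space M. \<exists>e\<in>C. dist e (a t) \<le> \<rho> t \<and> e \<in> epi_conj (h t)}"
  proof (intro Collect_cong conj_cong refl iffI allI)
    fix t m assume t: "t \<in> space M" and "\<exists>e\<in>C. dist e (a t) \<le> \<rho> t \<and> e \<in> epi_conj (h t)"
    then obtain e where e: "e \<in> C" "dist e (a t) \<le> \<rho> t" "e \<in> epi_conj (h t)" by blast
    let ?X = "{e. infdist e C < 1 / real (Suc m)} \<inter> {e. dist e (a t) < \<rho> t + 1 / real (Suc m)} \<inter>
        (\<Inter>j\<in>{..<m}. {e. fst e \<bullet> p j - snd e - h t (p j) < 1 / real (Suc m)})"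
    have "open ?X"
      by (intro open_Int open_INT ballI finite_lessThan open_Collect_less continuous_intros)
    moreover have "e \<in> ?X"
    proof -
      have pos: "0 < 1 / real (Suc m)" by simp
      have "fst e \<bullet> p j - snd e - h t (p j) < 1 / real (Suc m)" for j
        using epi_conjD[OF e(3), of "p j"] pos by linarith
      moreover have "dist e (a t) < \<rho> t + 1 / real (Suc m)" using e(2) pos by linarith
      ultimately show ?thesis using e(1) pos by simp
    qed
    then have "?X \<noteq> {}" by blast
    ultimately show "\<exists>e\<in>D'. ?P t m e" using D'(2)[of ?X] by auto
  next
    fix t assume t: "t \<in> space M" and "\<forall>m. \<exists>e\<in>D'. ?P t m e"
    then obtain e where e: "\<And>m. ?P t m (e m)" by metis
    have "e m \<in> cball (a t) (\<rho> t + 1)" for m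
    proof -
      have "1 / real (Suc m) \<le> 1" by simp
      moreover have "dist (e m) (a t) < \<rho> t + 1 / real (Suc m)" using e[of m] by blast
      ultimately have "dist (e m) (a t) \<le> \<rho> t + 1" by linarith
      then show ?thesis by (simp add: dist_commute)
    qed
    then obtain l r where l: "strict_mono r" "(e \<circ> r) \<longlonglongrightarrow> l"
      using compact_cball[of "a t" "\<rho> t + 1"] unfolding compact_def by metis
    have inv: "(\<lambda>m. 1 / real (Suc (r m))) \<longlonglongrightarrow> 0"
      using LIMSEQ_subseq_LIMSEQ[OF LIMSEQ_inverse_real_of_nat l(1)] by (simp add: o_def inverse_eq_divide)
    have el: "(\<lambda>m. e (r m)) \<longlonglongrightarrow> l" using l(2) by (simp add: o_def)
    have "infdist l C \<le> 0"
    proof (rule LIMSEQ_le[OF tendsto_infdist[OF el] inv])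
      show "\<exists>N. \<forall>n\<ge>N. infdist (e (r n)) C \<le> 1 / real (Suc (r n))"
        using e by (meson less_imp_le)
    qed
    then have "l \<in> C" using C in_closed_iff_infdist_zero infdist_nonneg by (metis order_antisym)
    moreover have "dist l (a t) \<le> \<rho> t"
    proof (rule LIMSEQ_le)
      show "(\<lambda>m. dist (e (r m)) (a t)) \<longlonglongrightarrow> dist l (a t)" by (intro tendsto_intros el)
      show "(\<lambda>m. \<rho> t + 1 / real (Suc (r m))) \<longlonglongrightarrow> \<rho> t" using tendsto_add[OF tendsto_const inv, of "\<rho> t"] by simp
      show "\<exists>N. \<forall>n\<ge>N. dist (e (r n)) (a t) \<le> \<rho> t + 1 / real (Suc (r n))"
        using e by (meson less_imp_le)
    qed
    moreover have "l \<in> epi_conj (h t)"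
    proof (rule epi_conj_denseI[OF cont[OF t] p])
      fix j
      have "fst l \<bullet> p j - snd l - h t (p j) \<le> 0"
      proof (rule LIMSEQ_le)
        show "(\<lambda>m. fst (e (r m)) \<bullet> p j - snd (e (r m)) - h t (p j)) \<longlonglongrightarrow> fst l \<bullet> p j - snd l - h t (p j)"
          by (intro tendsto_intros el)
        show "(\<lambda>m. 1 / real (Suc (r m))) \<longlonglongrightarrow> 0" by (rule inv)
        \<comment> \<open>At level \<open>r n\<close> only the indices below \<open>r n\<close> are
          tested; \<open>n \<ge> Suc j\<close> together with \<open>n \<le> r n\<close> ensures that
          \<open>j\<close> is among them.\<close>
        have "fst (e (r n)) \<bullet> p j - snd (e (r n)) - h t (p j) \<le> 1 / real (Suc (r n))" if "n \<ge> Suc j" for n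
          using e[of "r n"] that seq_suble[OF l(1), of n] by (auto intro!: less_imp_le)
        then show "\<exists>N. \<forall>n\<ge>N. fst (e (r n)) \<bullet> p j - snd (e (r n)) - h t (p j) \<le> 1 / real (Suc (r n))"
          by blast
      qed
      then show "fst l \<bullet> p j - snd l \<le> h t (p j)" by simp
    qed
    ultimately show "\<exists>e\<in>C. dist e (a t) \<le> \<rho> t \<and> e \<in> epi_conj (h t)" by blast
  qed
  finally show ?thesis .
qed

text \<open>The hitting lemma is used twice: with constant radius and no constraint set it gives
  measurability of the distance. With that distance as radius, the only candidate left is the
  projection, so hitting \<open>C\<close> means that the projection lies in
  \<open>C\<close>.\<close>

lemma measurable_closest_point_epi_conj:
  fixes h :: "'s \<Rightarrow> 'a::euclidean_space \<Rightarrow> real"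
  assumes meas: "\<And>p. (\<lambda>t. h t p) \<in> borel_measurable M"
    and cvx: "\<And>t. t \<in> space M \<Longrightarrow> convex_on UNIV (h t)"
    and cont: "\<And>t. t \<in> space M \<Longrightarrow> continuous_on UNIV (h t)"
    and a: "a \<in> borel_measurable M"
  shows "(\<lambda>t. closest_point (epi_conj (h t)) (a t)) \<in> borel_measurable M"
proof -
  let ?b = "\<lambda>t. closest_point (epi_conj (h t)) (a t)"
  let ?d = "\<lambda>t. dist (?b t) (a t)"
  have bE: "?b t \<in> epi_conj (h t)" if "t \<in> space M" for t
    by (rule closest_point_in_set[OF closed_epi_conj epi_conj_nonempty[OF cvx[OF that]]])
  have ble: "?d t \<le> dist e (a t)" if "e \<in> epi_conj (h t)" for t e
    using closest_point_le[OF closed_epi_conj that, of "a t"] by (simp add: dist_commute)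
  have d: "?d \<in> borel_measurable M"
  proof (rule borel_measurableI_le)
    fix y
    have "{t \<in> space M. ?d t \<le> y} = {t \<in> space M. \<exists>e\<in>UNIV. dist e (a t) \<le> y \<and> e \<in> epi_conj (h t)}"
      using bE ble order_trans by (intro Collect_cong conj_cong refl) blast
    also have "\<dots> \<in> sets M"
      by (rule sets_epi_conj_hit[OF meas cont a, where \<rho> = "\<lambda>_. y"]) auto
    finally show "{t \<in> space M. ?d t \<le> y} \<in> sets M" .
  qed
  have closed: "?b -` C \<inter> space M \<in> sets M" if C: "closed C" for C
  proof (cases "C = {}")
    case False
    have "?b -` C \<inter> space M = {t \<in> space M. \<exists>e\<in>C. dist e (a t) \<le> ?d t \<and> e \<in> epi_conj (h t)}"
    proof (intro equalityI subsetI)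
      fix t assume "t \<in> {t \<in> space M. \<exists>e\<in>C. dist e (a t) \<le> ?d t \<and> e \<in> epi_conj (h t)}"
      then obtain e where t: "t \<in> space M" and e: "e \<in> C" "dist e (a t) \<le> ?d t" "e \<in> epi_conj (h t)" by blast
      have "e = ?b t"
      proof (rule closest_point_unique[OF convex_epi_conj closed_epi_conj e(3)])
        show "\<forall>z\<in>epi_conj (h t). dist (a t) e \<le> dist (a t) z"
          using e(2) ble[of _ t] by (metis dist_commute order_trans)
      qed
      then show "t \<in> ?b -` C \<inter> space M" using t e by simp
    qed (use bE in auto)
    then show ?thesis using sets_epi_conj_hit[OF meas cont a d C False] by simp
  qed simp
  show ?thesis
  proof (rule borel_measurableI)
    fix S :: "('a \<times> real) set" assume "open S"
    then have "space M - (?b -` (- S) \<inter> space M) \<in> sets M"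
      by (intro sets.compl_sets closed) (simp add: closed_def)
    also have "space M - (?b -` (- S) \<inter> space M) = ?b -` S \<inter> space M" by auto
    finally show "?b -` S \<inter> space M \<in> sets M" .
  qed
qed

section \<open>Weak limits of dominated sequences\<close>

text \<open>A Dunford-Pettis statement for a dominated sequence whose primitives already converge.
  The set functions \<open>A \<mapsto> \<integral> u n\<close> over \<open>A\<close> converge on
  every Lebesgue set; the limit is a measure dominated by that of \<open>C\<close>, hence absolutely
  continuous, and \<open>w\<close> is its Radon-Nikodym density.\<close>

lemma weak_limit_nonneg:
  fixes u :: "nat \<Rightarrow> real \<Rightarrow> real"
  assumes u: "\<And>n. integrable lebesgue (u n)" and C: "integrable lebesgue C"
    and bnd: "\<And>n t. 0 \<le> u n t" "\<And>n t. u n t \<le> C t"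
    and conv: "\<And>t. convergent (\<lambda>n. LINT s:{..t}|lebesgue. u n s)"
      "convergent (\<lambda>n. LINT s|lebesgue. u n s)"
  obtains w where "integrable lebesgue w"
    "\<And>A. A \<in> sets lebesgue \<Longrightarrow> (\<lambda>n. LINT s:A|lebesgue. u n s) \<longlonglongrightarrow> (LINT s:A|lebesgue. w s)"
proof -
  define m where "m f A = measure (density lebesgue (\<lambda>s. ennreal (f s))) A" for f and A :: "real set"
  have em: "emeasure (density lebesgue (\<lambda>s. ennreal (f s))) A = ennreal (LINT s:A|lebesgue. f s)"
    if f: "integrable lebesgue f" "\<And>t. 0 \<le> f t" and A: "A \<in> sets lebesgue" for f A
  proof -
    have "emeasure (density lebesgue (\<lambda>s. ennreal (f s))) A = (\<integral>\<^sup>+s. ennreal (f s) * indicator A s \<partial>lebesgue)"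
      using f A by (intro emeasure_density) auto
    also have "\<dots> = (\<integral>\<^sup>+s. ennreal (indicator A s *\<^sub>R f s) \<partial>lebesgue)"
      by (intro nn_integral_cong) (auto simp: indicator_def)
    also have "\<dots> = ennreal (LINT s:A|lebesgue. f s)"
      unfolding set_lebesgue_integral_def using f A
      by (intro nn_integral_eq_integral integrable_mult_indicator) auto
    finally show ?thesis .
  qed
  have m: "m f A = (LINT s:A|lebesgue. f s)" and fin: "finite_measure (density lebesgue (\<lambda>s. ennreal (f s)))"
    if f: "integrable lebesgue f" "\<And>t. 0 \<le> f t" and A: "A \<in> sets lebesgue" for f A
  proof -
    have "0 \<le> (LINT s:A|lebesgue. f s)"
      unfolding set_lebesgue_integral_def using f by (intro Bochner_Integration.integral_nonneg) auto
    then show "m f A = (LINT s:A|lebesgue. f s)"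
      unfolding m_def measure_def em[OF f A] by simp
    show "finite_measure (density lebesgue (\<lambda>s. ennreal (f s)))"
      by (rule finite_measureI) (simp add: em[OF f])
  qed
  have C0: "0 \<le> C t" for t using bnd[of _ t] order_trans by blast
  have sums: "(\<lambda>i. m f (A i)) sums m f (\<Union>i. A i)"
    if f: "integrable lebesgue f" "\<And>t. 0 \<le> f t" and A: "range A \<subseteq> sets lebesgue" "disjoint_family A"
    for f and A :: "nat \<Rightarrow> real set"
    unfolding m_def using A by (intro finite_measure.finite_measure_UNION fin[OF f, of "{}"]) auto
  have le: "0 \<le> m (u n) A" "m (u n) A \<le> m C A" if A: "A \<in> sets lebesgue" for n A
  proof -
    show "0 \<le> m (u n) A" by (simp add: m_def)
    show "m (u n) A \<le> m C A"
      unfolding m[OF u bnd(1) A] m[OF C C0 A] set_lebesgue_integral_def using bnd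
      by (intro integral_mono integrable_mult_indicator A u C) (auto simp: indicator_def)
  qed
  \<comment> \<open>The terms are dominated by \<open>m C (A i)\<close>, which is summable, so limit
    and series may be exchanged. This gives both closure under disjoint unions and countable
    additivity of the limit.\<close>
  have tannery: "(\<lambda>n. m (u n) (\<Union>i. A i)) \<longlonglongrightarrow> (\<Sum>i. L i) \<and> summable L"
    if A: "range A \<subseteq> sets lebesgue" "disjoint_family A" and L: "\<And>i. (\<lambda>n. m (u n) (A i)) \<longlonglongrightarrow> L i"
    for A :: "nat \<Rightarrow> real set" and L
  proof -
    have "\<forall>\<^sub>F (k, n) in at_top \<times>\<^sub>F sequentially. norm (m (u n) (A k)) \<le> m C (A k)"
      using le A(1) by (intro always_eventually) auto
    from tannerys_theorem[OF L this] sums[OF C C0 A]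
    have "summable (\<lambda>n. norm (L n)) \<and> (\<lambda>n. \<Sum>k. m (u n) (A k)) \<longlonglongrightarrow> suminf L"
      by (auto simp: sums_iff)
    moreover have "(\<Sum>k. m (u n) (A k)) = m (u n) (\<Union>i. A i)" for n
      using sums[OF u bnd(1) A] by (simp add: sums_iff)
    ultimately show ?thesis using summable_norm_cancel[of L] by auto
  qed
  \<comment> \<open>Dynkin induction from half-lines; complements use the convergence of the total
    masses.\<close>
  have conv_borel: "convergent (\<lambda>n. m (u n) A)" if "A \<in> sets borel" for A
  proof -
    have borel_eq: "sets (borel :: real measure) = sigma_sets UNIV (range atMost)"
      by (simp add: borel_eq_atMost)
    have sl: "A \<in> sets lebesgue" if "A \<in> sigma_sets UNIV (range atMost)" for A :: "real set"
      using that by (simp add: borel_eq[symmetric])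
    have Ag: "A \<in> sigma_sets UNIV (range atMost)" using that by (simp add: borel_eq)
    show ?thesis
    proof (rule sigma_sets_induct_disjoint[OF _ _ Ag, where P = "\<lambda>A. convergent (\<lambda>n. m (u n) A)"])
      show "Int_stable (range (atMost :: real \<Rightarrow> _))" by (auto simp: Int_stable_def)
    next
      fix A :: "real set" assume "A \<in> range atMost"
      then show "convergent (\<lambda>n. m (u n) A)" using conv(1) by (auto simp: m[OF u bnd(1)])
    next
      show "convergent (\<lambda>n. m (u n) {})" by (simp add: m_def convergent_const)
    next
      fix A :: "real set"
      assume A: "A \<in> sigma_sets UNIV (range atMost)" "convergent (\<lambda>n. m (u n) A)"
      have "m (u n) (UNIV - A) = (LINT s|lebesgue. u n s) - m (u n) A" for n
      proof -
        have "m (u n) (UNIV - A) = m (u n) UNIV - m (u n) A"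
          unfolding m_def using finite_measure.finite_measure_compl[OF fin[OF u bnd(1), of "{}"], of A n] sl[OF A(1)]
          by simp
        then show ?thesis by (simp add: m[OF u bnd(1)] set_lebesgue_integral_def)
      qed
      then show "convergent (\<lambda>n. m (u n) (UNIV - A))" using conv(2) A(2) by (simp add: convergent_diff)
    next
      fix A :: "nat \<Rightarrow> real set"
      assume A: "disjoint_family A" "range A \<subseteq> sigma_sets UNIV (range atMost)" "\<And>i. convergent (\<lambda>n. m (u n) (A i))"
      then have L: "\<And>i. (\<lambda>n. m (u n) (A i)) \<longlonglongrightarrow> lim (\<lambda>n. m (u n) (A i))"
        by (simp add: convergent_LIMSEQ_iff)
      have "range A \<subseteq> sets lebesgue" using A(2) sl by blast
      from tannery[OF this A(1) L] show "convergent (\<lambda>n. m (u n) (\<Union>i. A i))"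
        by (blast intro: convergentI)
    qed simp
  qed
  \<comment> \<open>A Lebesgue set differs from a Borel set by a null set, to which no
    \<open>u n\<close> assigns mass.\<close>
  have conv_leb: "convergent (\<lambda>n. m (u n) A)" if "A \<in> sets lebesgue" for A
  proof -
    obtain S N N' where S: "A = S \<union> N" "N \<subseteq> N'" "N' \<in> null_sets lborel" "S \<in> sets lborel"
      using sets_completionE[OF \<open>A \<in> sets lebesgue\<close>] by blast
    have N: "N \<in> null_sets lebesgue"
      using S(2,3) null_sets_completion_iff2 by blast
    have "m (u n) A = m (u n) S" for n
    proof -
      have "N \<in> null_sets (density lebesgue (\<lambda>s. ennreal (u n s)))"
      proof (rule null_sets_density_iff[THEN iffD2])
        show "(\<lambda>s. ennreal (u n s)) \<in> borel_measurable lebesgue"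
          using borel_measurable_integrable[OF u[of n]] by simp
        have "AE s in lebesgue. s \<in> N \<longrightarrow> ennreal (u n s) = 0"
          using AE_not_in[OF N] by eventually_elim simp
        then show "N \<in> sets lebesgue \<and> (AE s in lebesgue. s \<in> N \<longrightarrow> ennreal (u n s) = 0)"
          using N by blast
      qed
      then show ?thesis
        unfolding m_def measure_def S(1) using S(4) by (subst emeasure_Un_null_set) auto
    qed
    then show ?thesis using conv_borel[of S] S(4) by simp
  qed
  define \<mu> where "\<mu> A = lim (\<lambda>n. m (u n) A)" for A
  have lim: "(\<lambda>n. m (u n) A) \<longlonglongrightarrow> \<mu> A" if "A \<in> sets lebesgue" for A
    using conv_leb[OF that] by (simp add: \<mu>_def convergent_LIMSEQ_iff)
  have \<mu>0: "0 \<le> \<mu> A" and \<mu>C: "\<mu> A \<le> m C A" if A: "A \<in> sets lebesgue" for A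
    using le[OF A] by (auto intro: LIMSEQ_le_const[OF lim[OF A]] LIMSEQ_le_const2[OF lim[OF A]])
  define N where "N = measure_of UNIV (sets lebesgue) (\<lambda>A. ennreal (\<mu> A))"
  have sN: "sets N = sets lebesgue" "space N = UNIV"
    unfolding N_def using sets.sigma_sets_eq[of lebesgue] sets.space_closed[of lebesgue] by auto
  have ca: "countably_additive (sets N) (\<lambda>A. ennreal (\<mu> A))"
    unfolding sN
  proof (rule countably_additiveI)
    fix A :: "nat \<Rightarrow> real set" assume A: "range A \<subseteq> sets lebesgue" "disjoint_family A" "\<Union> (range A) \<in> sets lebesgue"
    have L: "(\<lambda>n. m (u n) (A i)) \<longlonglongrightarrow> \<mu> (A i)" for i using A by (intro lim) auto
    have "\<mu> (\<Union>i. A i) = (\<Sum>i. \<mu> (A i))" "summable (\<lambda>i. \<mu> (A i))"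
      using tannery[OF A(1,2) L] lim[OF A(3)] LIMSEQ_unique by blast+
    then show "(\<Sum>i. ennreal (\<mu> (A i))) = ennreal (\<mu> (\<Union>i. A i))"
      using A \<mu>0 by (subst suminf_ennreal2) auto
  qed
  have emN: "emeasure N A = ennreal (\<mu> A)" if "A \<in> sets lebesgue" for A
    using that ca sets.space_closed[of lebesgue] lim[of "{}"]
    by (intro emeasure_measure_of[OF N_def])
      (auto simp: sN positive_def m_def LIMSEQ_const_iff)
  have ac: "absolutely_continuous lebesgue N"
    unfolding absolutely_continuous_def
  proof
    fix A assume A: "A \<in> null_sets (lebesgue :: real measure)"
    then have Al: "A \<in> sets lebesgue" by auto
    have "AE s in lebesgue. indicat_real A s *\<^sub>R C s = 0"
      using AE_not_in[OF A] by eventually_elim simp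
    then have "(LINT s:A|lebesgue. C s) = 0"
      unfolding set_lebesgue_integral_def by (rule integral_eq_zero_AE)
    then have "m C A = 0" by (simp add: m[OF C C0 Al])
    then have "\<mu> A = 0" using \<mu>0[OF Al] \<mu>C[OF Al] by simp
    then show "A \<in> null_sets N" by (auto simp: null_sets_def sN Al emN)
  qed
  interpret sigma_finite_measure "lebesgue :: real measure"
  proof
    have "(\<Union>n::nat. ball (0::real) (real n)) = UNIV"
      by (auto simp: dist_norm) (meson reals_Archimedean2)
    moreover have "emeasure lebesgue (ball (0::real) (real n)) \<noteq> \<infinity>" for n :: nat
      using emeasure_lborel_ball_finite[of "0::real" "real n"] by simp
    ultimately show "\<exists>A. countable A \<and> A \<subseteq> sets (lebesgue :: real measure) \<and> \<Union> A = space lebesgue \<and>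
        (\<forall>a\<in>A. emeasure lebesgue a \<noteq> \<infinity>)"
      by (intro exI[of _ "range (\<lambda>n::nat. ball 0 (real n))"]) auto
  qed
  obtain f where f: "f \<in> borel_measurable lebesgue" "density lebesgue f = N"
    using Radon_Nikodym[OF ac sN(1)] by blast
  have fA: "(\<integral>\<^sup>+s. f s * indicator A s \<partial>lebesgue) = ennreal (\<mu> A)" if "A \<in> sets lebesgue" for A
    using emeasure_density[OF f(1) that] emN[OF that] f(2) by simp
  have "(\<integral>\<^sup>+s. f s \<partial>lebesgue) \<noteq> \<infinity>" using fA[of UNIV] by simp
  then have ffin: "AE s in lebesgue. f s \<noteq> \<infinity>"
    by (rule nn_integral_PInf_AE[OF f(1)])
  \<comment> \<open>\<open>enn2real\<close> sends infinity to 0, which alters \<open>f\<close> only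
    on a null set.\<close>
  define w where "w s = enn2real (f s)" for s
  have w0: "0 \<le> w s" for s by (simp add: w_def)
  have wm: "w \<in> borel_measurable lebesgue" unfolding w_def using f(1) by simp
  have wA: "(\<integral>\<^sup>+s. ennreal (indicator A s *\<^sub>R w s) \<partial>lebesgue) = ennreal (\<mu> A)" if A: "A \<in> sets lebesgue" for A
    unfolding fA[OF A, symmetric]
  proof (rule nn_integral_cong_AE)
    show "AE s in lebesgue. ennreal (indicat_real A s *\<^sub>R w s) = f s * indicator A s"
      using ffin by eventually_elim (auto simp: w_def indicator_def less_top[symmetric])
  qed
  have wi: "integrable lebesgue w"
    using wA[of UNIV] wm by (intro integrableI_nonneg) (auto simp: w_def)
  show ?thesis
  proof (rule that[OF wi])
    fix A :: "real set" assume A: "A \<in> sets lebesgue"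
    have "ennreal (LINT s:A|lebesgue. w s) = (\<integral>\<^sup>+s. ennreal (indicator A s *\<^sub>R w s) \<partial>lebesgue)"
      unfolding set_lebesgue_integral_def using wi A
      by (intro nn_integral_eq_integral[symmetric] integrable_mult_indicator) (auto simp: w0)
    then have "(LINT s:A|lebesgue. w s) = \<mu> A"
      unfolding wA[OF A] using \<mu>0[OF A] by (subst (asm) ennreal_inj)
        (auto simp: set_lebesgue_integral_def w0 intro!: Bochner_Integration.integral_nonneg)
    then show "(\<lambda>n. LINT s:A|lebesgue. u n s) \<longlonglongrightarrow> (LINT s:A|lebesgue. w s)"
      using lim[OF A] by (simp add: m[OF u bnd(1) A])
  qed
qed

text \<open>Each component becomes nonnegative by adding \<open>c\<close>, with dominating function
  \<open>2 * c\<close>. Extension by zero outside the interval moves the problem to the line, and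
  the shift is subtracted from the limit.\<close>

lemma weak_limit:
  fixes v :: "nat \<Rightarrow> real \<Rightarrow> 'b::euclidean_space"
  assumes v: "\<And>n. v n absolutely_integrable_on {a..b}" and c: "c absolutely_integrable_on {a..b}"
    and le: "\<And>n t. t \<in> {a..b} \<Longrightarrow> norm (v n t) \<le> c t"
    and conv: "\<And>t. t \<in> {a..b} \<Longrightarrow> convergent (\<lambda>n. integral {a..t} (v n))"
  obtains w where "w absolutely_integrable_on {a..b}"
    "\<And>A. A \<in> sets lebesgue \<Longrightarrow> A \<subseteq> {a..b} \<Longrightarrow> (\<lambda>n. integral A (v n)) \<longlonglongrightarrow> integral A w"
proof -
  have "\<exists>w. w absolutely_integrable_on {a..b} \<and>
      (\<forall>A. A \<in> sets lebesgue \<longrightarrow> A \<subseteq> {a..b} \<longrightarrow> (\<lambda>n. integral A (\<lambda>t. v n t \<bullet> e)) \<longlonglongrightarrow> integral A w)"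
    if e: "e \<in> Basis" for e
  proof -
    define u where "u n s = indicator {a..b} s *\<^sub>R (v n s \<bullet> e + c s)" for n s
    define C where "C s = indicator {a..b} s *\<^sub>R (2 * c s)" for s
    have ve: "(\<lambda>t. v n t \<bullet> e) absolutely_integrable_on {a..b}" for n
      by (rule absolutely_integrable_component[OF v])
    have vc: "(\<lambda>t. v n t \<bullet> e + c t) absolutely_integrable_on {a..b}" for n
      using ve c by (rule set_integral_add(1))
    have vle: "\<bar>v n s \<bullet> e\<bar> \<le> c s" if "s \<in> {a..b}" for n s
      using Basis_le_norm[OF e, of "v n s"] le[OF that, of n] by linarith
    have set_u: "(LINT s:A|lebesgue. u n s) = integral A (\<lambda>t. v n t \<bullet> e) + integral A c"
      if A: "A \<in> sets lebesgue" "A \<subseteq> {a..b}" for A n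
    proof -
      have "(LINT s:A|lebesgue. u n s) = (LINT s:A|lebesgue. v n s \<bullet> e + c s)"
        using A by (intro set_lebesgue_integral_cong) (auto simp: u_def)
      also have "\<dots> = (LINT s:A|lebesgue. v n s \<bullet> e) + (LINT s:A|lebesgue. c s)"
        using A by (intro set_integral_add(2) set_integrable_subset[OF ve] set_integrable_subset[OF c]) auto
      also have "\<dots> = integral A (\<lambda>t. v n t \<bullet> e) + integral A c"
        using A set_integrable_subset[OF ve] set_integrable_subset[OF c]
        by (simp add: set_lebesgue_integral_eq_integral(2))
      finally show ?thesis .
    qed
    have conve: "convergent (\<lambda>n. integral {a..t} (\<lambda>s. v n s \<bullet> e) + integral {a..t} c)" if t: "t \<in> {a..b}" for t
    proof -
      have "v n integrable_on {a..t}" for n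
        using t by (intro integrable_subinterval_real[OF set_lebesgue_integral_eq_integral(1)[OF v]]) auto
      then have "integral {a..t} (\<lambda>s. v n s \<bullet> e) = integral {a..t} (v n) \<bullet> e" for n
        by (rule integral_component_eq)
      moreover obtain L where "(\<lambda>n. integral {a..t} (v n)) \<longlonglongrightarrow> L"
        using conv[OF t] by (auto simp: convergent_def)
      then have "(\<lambda>n. integral {a..t} (v n) \<bullet> e + integral {a..t} c) \<longlonglongrightarrow> L \<bullet> e + integral {a..t} c"
        by (intro tendsto_intros)
      ultimately show ?thesis by (auto simp: convergent_def)
    qed
    have ui: "integrable lebesgue (u n)" for n
      using vc[of n] unfolding u_def set_integrable_def .
    have Ci: "integrable lebesgue C"
      using set_integrable_mult_right[OF c, of 2] unfolding C_def set_integrable_def by simp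
    have b1: "0 \<le> u n t" and b2: "u n t \<le> C t" for n t
      using vle[of t n] by (auto simp: u_def C_def indicator_def abs_le_iff)
    \<comment> \<open>Half-lines meet the support of \<open>u n\<close> in intervals starting at
      \<open>a\<close>, where convergence of the primitives is assumed.\<close>
    have cut: "(LINT s:{..t}|lebesgue. u n s) = (LINT s:{a..min t b}|lebesgue. u n s)" for n t
      unfolding set_lebesgue_integral_def
      by (intro Bochner_Integration.integral_cong) (auto simp: u_def indicator_def)
    have cv: "convergent (\<lambda>n. LINT s:{a..min t b}|lebesgue. u n s)" for t
    proof (cases "a \<le> min t b")
      case True
      then show ?thesis using conve[of "min t b"] by (subst set_u) auto
    next
      case False
      then have "{a..min t b} = {}" by auto
      then show ?thesis by (simp add: set_lebesgue_integral_def convergent_const)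
    qed
    have c1: "convergent (\<lambda>n. LINT s:{..t}|lebesgue. u n s)" for t
      unfolding cut by (rule cv)
    have "(LINT s|lebesgue. u n s) = (LINT s:{a..min b b}|lebesgue. u n s)" for n
      unfolding set_lebesgue_integral_def
      by (intro Bochner_Integration.integral_cong) (auto simp: u_def indicator_def)
    then have c2: "convergent (\<lambda>n. LINT s|lebesgue. u n s)"
      using cv[of b] by simp
    obtain w where w: "integrable lebesgue w" "\<And>A. A \<in> sets lebesgue \<Longrightarrow> (\<lambda>n. LINT s:A|lebesgue. u n s) \<longlonglongrightarrow> (LINT s:A|lebesgue. w s)"
      using weak_limit_nonneg[OF ui Ci b1 b2 c1 c2] by metis
    have wS: "set_integrable lebesgue A w" if "A \<in> sets lebesgue" for A
      unfolding set_integrable_def using that w(1) by (rule integrable_mult_indicator)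
    show ?thesis
    proof (intro exI[of _ "\<lambda>t. w t - c t"] conjI allI impI)
      show "(\<lambda>t. w t - c t) absolutely_integrable_on {a..b}"
        by (intro set_integral_diff(1) wS c) simp
      fix A :: "real set" assume A: "A \<in> sets lebesgue" "A \<subseteq> {a..b}"
      have cA: "set_integrable lebesgue A c" using set_integrable_subset[OF c A] .
      have "(\<lambda>n. integral A (\<lambda>t. v n t \<bullet> e) + integral A c - integral A c)
          \<longlonglongrightarrow> (LINT s:A|lebesgue. w s) - integral A c"
        using w(2)[OF A(1)] unfolding set_u[OF A] by (intro tendsto_intros)
      moreover have "integral A (\<lambda>t. w t - c t) = (LINT s:A|lebesgue. w s) - integral A c"
        using wS[OF A(1)] cA
        by (simp add: integral_diff set_lebesgue_integral_eq_integral)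
      ultimately show "(\<lambda>n. integral A (\<lambda>t. v n t \<bullet> e)) \<longlonglongrightarrow> integral A (\<lambda>t. w t - c t)" by simp
    qed
  qed
  then obtain w where w: "\<And>e. e \<in> Basis \<Longrightarrow> w e absolutely_integrable_on {a..b}"
    "\<And>e A. e \<in> Basis \<Longrightarrow> A \<in> sets lebesgue \<Longrightarrow> A \<subseteq> {a..b} \<Longrightarrow>
      (\<lambda>n. integral A (\<lambda>t. v n t \<bullet> e)) \<longlonglongrightarrow> integral A (w e)"
    by metis
  define W where "W t = (\<Sum>e\<in>Basis. w e t *\<^sub>R e)" for t
  have We: "W t \<bullet> e = w e t" if "e \<in> Basis" for t e
    using that by (simp add: W_def)
  have W: "W absolutely_integrable_on {a..b}"
    by (rule absolutely_integrable_componentwise) (simp add: We w(1))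
  show ?thesis
  proof (rule that[OF W])
    fix A :: "real set" assume A: "A \<in> sets lebesgue" "A \<subseteq> {a..b}"
    have int: "f integrable_on A" if "f absolutely_integrable_on {a..b}" for f :: "real \<Rightarrow> 'b"
      using set_lebesgue_integral_eq_integral(1)[OF set_integrable_subset[OF that A]] .
    show "(\<lambda>n. integral A (v n)) \<longlonglongrightarrow> integral A W"
    proof (subst tendsto_componentwise_iff, intro ballI)
      fix e :: 'b assume e: "e \<in> Basis"
      have "integral A (v n) \<bullet> e = integral A (\<lambda>t. v n t \<bullet> e)" for n
        using integral_component_eq[OF int[OF v]] by simp
      moreover have "integral A W \<bullet> e = integral A (w e)"
        using integral_component_eq[OF int[OF W], of e] We[OF e] by simp
      ultimately show "(\<lambda>n. integral A (v n) \<bullet> e) \<longlonglongrightarrow> integral A W \<bullet> e"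
        using w(2)[OF e A] by simp
    qed
  qed
qed

section \<open>Arcs of the differential inclusion\<close>

lemma abs_int_subinterval:
  fixes f :: "real \<Rightarrow> 'b::euclidean_space"
  assumes "f absolutely_integrable_on {a..b}" "a \<le> s" "t \<le> b"
  shows "f absolutely_integrable_on {s..t}"
  using assms by (intro set_integrable_subset[OF assms(1)]) auto

lemma abs_int_imp_integrable:
  fixes f :: "real \<Rightarrow> 'b::euclidean_space"
  shows "f absolutely_integrable_on S \<Longrightarrow> f integrable_on S"
  by (rule set_lebesgue_integral_eq_integral(1))

lemma integral_split:
  fixes f :: "real \<Rightarrow> 'b::euclidean_space"
  assumes "f absolutely_integrable_on {a..b}" "a \<le> s" "s \<le> t" "t \<le> b"
  shows "integral {a..t} f - integral {a..s} f = integral {s..t} f"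
proof -
  have "integral {a..s} f + integral {s..t} f = integral {a..t} f"
    using assms
    by (intro Henstock_Kurzweil_Integration.integral_combine abs_int_imp_integrable
        abs_int_subinterval[OF assms(1)]) auto
  then show ?thesis by (metis add_diff_cancel_left')
qed

lemma continuous_on_integral:
  fixes f :: "real \<Rightarrow> 'b::euclidean_space"
  assumes "f absolutely_integrable_on {a..b}"
  shows "continuous_on {a..b} (\<lambda>t. integral {a..t} f)"
  by (rule indefinite_integral_continuous_1[OF abs_int_imp_integrable[OF assms]])

section \<open>Exponential weights and Gronwall's inequality\<close>

lemma abs_int_mult_continuous:
  fixes c u :: "real \<Rightarrow> real"
  assumes c: "c absolutely_integrable_on {a..b}" and u: "continuous_on {a..b} u"
  shows "(\<lambda>t. c t * u t) absolutely_integrable_on {a..b}"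
proof -
  have "(\<lambda>t. u t * c t) absolutely_integrable_on {a..b}"
    using c u by (intro absolutely_integrable_bounded_measurable_product_real
        continuous_imp_measurable_on_sets_lebesgue compact_imp_bounded compact_continuous_image) auto
  then show ?thesis by (simp add: mult.commute)
qed

text \<open>The contraction step. Keeping the \<open>- 1\<close> matters later: it absorbs initial
  data of the same size.\<close>

lemma integral_exp_weight_le:
  fixes c u :: "real \<Rightarrow> real"
  assumes c: "c absolutely_integrable_on {a..b}" "\<And>t. t \<in> {a..b} \<Longrightarrow> 0 \<le> c t" and t: "t \<in> {a..b}"
    and u: "continuous_on {a..b} u" "\<And>s. s \<in> {a..t} \<Longrightarrow> u s \<le> S * exp (2 * integral {a..s} c)"
  shows "integral {a..t} (\<lambda>s. c s * u s) \<le> S * ((exp (2 * integral {a..t} c) - 1) / 2)"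
proof -
  have sub: "f integrable_on {a..t}" if "f absolutely_integrable_on {a..b}" for f :: "real \<Rightarrow> real"
    using t by (intro abs_int_imp_integrable abs_int_subinterval[OF that]) auto
  have hi: "((\<lambda>s. S * (c s * exp (2 * integral {a..s} c))) has_integral
      S * ((exp (2 * integral {a..t} c) - 1) / 2)) {a..t}"
    by (intro has_integral_mult_right exp_weight_integral[OF abs_int_imp_integrable[OF c(1)] c(2) t])
  have "integral {a..t} (\<lambda>s. c s * u s) \<le> integral {a..t} (\<lambda>s. S * (c s * exp (2 * integral {a..s} c)))"
  proof (rule integral_le)
    show "(\<lambda>s. c s * u s) integrable_on {a..t}"
      by (rule sub[OF abs_int_mult_continuous[OF c(1) u(1)]])
    show "(\<lambda>s. S * (c s * exp (2 * integral {a..s} c))) integrable_on {a..t}" using hi by blast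
    fix s assume "s \<in> {a..t}"
    then show "c s * u s \<le> S * (c s * exp (2 * integral {a..s} c))"
      using mult_left_mono[OF u(2), of s "c s"] c(2)[of s] t by (simp add: algebra_simps)
  qed
  then show ?thesis unfolding integral_unique[OF hi] .
qed

text \<open>Let \<open>S\<close> be the maximum of \<open>u\<close> divided by the weight. At a
  maximum point the integral inequality gives \<open>S \<le> A + S / 2\<close>, hence
  \<open>S \<le> 2 * A\<close>, which is the factor 2 in the bound.\<close>

lemma gronwall_integral:
  fixes c u :: "real \<Rightarrow> real"
  assumes c: "c absolutely_integrable_on {a..b}" "\<And>t. t \<in> {a..b} \<Longrightarrow> 0 \<le> c t"
    and u: "continuous_on {a..b} u" "\<And>t. t \<in> {a..b} \<Longrightarrow> 0 \<le> u t"
    and le: "\<And>t. t \<in> {a..b} \<Longrightarrow> u t \<le> A + integral {a..t} (\<lambda>s. c s * u s)"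
    and A: "0 \<le> A" and t: "t \<in> {a..b}"
  shows "u t \<le> 2 * A * exp (2 * integral {a..t} c)"
proof -
  let ?C = "\<lambda>t. integral {a..t} c"
  let ?w = "\<lambda>t. u t * exp (- (2 * ?C t))"
  have "continuous_on {a..b} ?w"
    by (intro continuous_intros u continuous_on_integral c)
  then obtain \<tau> where \<tau>: "\<tau> \<in> {a..b}" "\<And>s. s \<in> {a..b} \<Longrightarrow> ?w s \<le> ?w \<tau>"
    using continuous_attains_sup[of "{a..b}" ?w] t by auto
  define S where "S = ?w \<tau>"
  have ule: "u s \<le> S * exp (2 * ?C s)" if "s \<in> {a..b}" for s
  proof -
    have "?w s * exp (2 * ?C s) \<le> S * exp (2 * ?C s)"
      using \<tau>(2)[OF that] by (intro mult_right_mono) (auto simp: S_def)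
    then show ?thesis by (simp add: mult.assoc flip: exp_add)
  qed
  have S0: "0 \<le> S" using u(2)[OF \<tau>(1)] by (simp add: S_def)
  have C0: "0 \<le> ?C \<tau>"
    using c(2) \<tau>(1) by (intro Henstock_Kurzweil_Integration.integral_nonneg abs_int_imp_integrable
        abs_int_subinterval[OF c(1)]) auto
  have "integral {a..\<tau>} (\<lambda>s. c s * u s) \<le> S * ((exp (2 * ?C \<tau>) - 1) / 2)"
    using \<tau>(1) by (intro integral_exp_weight_le[OF c \<tau>(1) u(1)] ule) auto
  then have "u \<tau> \<le> A + S * (exp (2 * ?C \<tau>) / 2)"
    using le[OF \<tau>(1)] S0 by (simp add: algebra_simps)
  then have "u \<tau> * exp (- (2 * ?C \<tau>)) \<le> (A + S * (exp (2 * ?C \<tau>) / 2)) * exp (- (2 * ?C \<tau>))"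
    by (rule mult_right_mono) simp
  also have "\<dots> = A * exp (- (2 * ?C \<tau>)) + S / 2"
    by (simp add: algebra_simps flip: exp_add)
  also have "A * exp (- (2 * ?C \<tau>)) \<le> A * 1"
    using A C0 by (intro mult_left_mono) auto
  finally have "S \<le> 2 * A" by (simp add: S_def)
  then have "S * exp (2 * ?C t) \<le> 2 * A * exp (2 * ?C t)" by (intro mult_right_mono) auto
  then show ?thesis using ule[OF t] by linarith
qed

lemma abs_cont_on_imp_continuous_on:
  assumes "abs_cont_on x a b"
  shows "continuous_on {a..b} x"
  unfolding continuous_on_iff
proof (intro ballI allI impI)
  fix t and e :: real assume t: "t \<in> {a..b}" and e: "0 < e"
  obtain \<delta> where \<delta>: "\<delta> > 0" and *: "\<forall>(n::nat) (u::nat \<Rightarrow> real) v.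
        (\<forall>i<n. a \<le> u i \<and> u i \<le> v i \<and> v i \<le> b) \<and>
        (\<forall>i<n. \<forall>j<n. i \<noteq> j \<longrightarrow> {u i<..<v i} \<inter> {u j<..<v j} = {}) \<and>
        (\<Sum>i<n. v i - u i) < \<delta> \<longrightarrow> (\<Sum>i<n. norm (x (v i) - x (u i))) < e"
    using assms e unfolding abs_cont_on_def by blast
  have "dist (x s) (x t) < e" if s: "s \<in> {a..b}" "dist s t < \<delta>" for s
    using *[rule_format, of 1 "\<lambda>_. min s t" "\<lambda>_. max s t"] s t
    by (cases "s \<le> t") (auto simp: dist_norm min_def max_def norm_minus_commute)
  then show "\<exists>d>0. \<forall>x'\<in>{a..b}. dist x' t < d \<longrightarrow> dist (x x') (x t) < e" using \<delta> by blast
qed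

lemma absolutely_integrable_Pair:
  fixes v :: "real \<Rightarrow> 'a::euclidean_space" and r :: "real \<Rightarrow> 'b::euclidean_space"
  assumes "v absolutely_integrable_on S" "r absolutely_integrable_on S"
  shows "(\<lambda>t. (v t, r t)) absolutely_integrable_on S"
proof -
  have "bounded_linear (\<lambda>x::'a. (x, 0::'b))" "bounded_linear (\<lambda>x::'b. (0::'a, x))"
    by (intro bounded_linear_intros)+
  then have "((\<lambda>x. (x, 0::'b)) \<circ> v) absolutely_integrable_on S" "((\<lambda>x. (0::'a, x)) \<circ> r) absolutely_integrable_on S"
    using assms by (auto intro: absolutely_integrable_linear)
  from set_integral_add(1)[OF this] show ?thesis by (simp add: o_def)
qed

section \<open>A priori bounds on arcs\<close>

locale hamiltonian =
  fixes H :: "real \<Rightarrow> 'a::euclidean_space \<Rightarrow> 'a \<Rightarrow> real" and T :: real and c :: "real \<Rightarrow> real"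
  assumes H1: "\<And>x p. (\<lambda>t. H t x p) \<in> borel_measurable (lebesgue_on {0..T})"
    and H2: "\<And>t. t \<in> {0..T} \<Longrightarrow> continuous_on UNIV (\<lambda>(x, p). H t x p)"
    and H3: "\<And>t x. t \<in> {0..T} \<Longrightarrow> convex_on UNIV (H t x)"
    and H4_int: "integrable (lebesgue_on {0..T}) c"
    and H4_nonneg: "\<And>t. t \<in> {0..T} \<Longrightarrow> 0 \<le> c t"
    and H4: "\<And>t x p q. t \<in> {0..T} \<Longrightarrow>
               \<bar>H t x p - H t x q\<bar> \<le> c t * (1 + norm x) * norm (p - q)"
    and HLC: "\<And>R. R > 0 \<Longrightarrow> \<exists>k :: real \<Rightarrow> real.
               k \<in> borel_measurable (lebesgue_on {0..T}) \<and>
               integrable (lebesgue_on {0..T}) k \<and>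
               (\<forall>t\<in>{0..T}. 0 \<le> k t) \<and>
               (\<forall>t\<in>{0..T}. \<forall>x\<in>cball 0 R. \<forall>y\<in>cball 0 R. \<forall>p.
                  \<bar>H t x p - H t y p\<bar> \<le> k t * (1 + norm p) * norm (x - y))"
    and H00: "integrable (lebesgue_on {0..T}) (\<lambda>t. H t 0 0)"
begin

text \<open>The admissible pairs of the reduced Bolza problem. The velocity and cost are part of the
  data, and the inclusion holds at every time; where a construction yields it only almost
  everywhere, the null set is repaired.\<close>

definition arc :: "real \<Rightarrow> 'a \<Rightarrow> (real \<Rightarrow> 'a) \<Rightarrow> (real \<Rightarrow> 'a) \<Rightarrow> (real \<Rightarrow> real) \<Rightarrow> bool" where
  "arc s x0 x v r \<longleftrightarrow> v absolutely_integrable_on {s..T} \<and> r absolutely_integrable_on {s..T} \<and>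
     (\<forall>t\<in>{s..T}. x t = x0 + integral {s..t} v \<and> (v t, r t) \<in> epi_conj (H t (x t)))"

lemma
  assumes "arc s x0 x v r"
  shows arc_v: "v absolutely_integrable_on {s..T}"
    and arc_r: "r absolutely_integrable_on {s..T}"
    and arc_x: "t \<in> {s..T} \<Longrightarrow> x t = x0 + integral {s..t} v"
    and arc_mem: "t \<in> {s..T} \<Longrightarrow> (v t, r t) \<in> epi_conj (H t (x t))"
  using assms unfolding arc_def by blast+

lemma integrable_lebesgue_on_iff:
  fixes f :: "real \<Rightarrow> real"
  shows "integrable (lebesgue_on {0..T}) f \<longleftrightarrow> f absolutely_integrable_on {0..T}"
  by (simp add: integrable_restrict_space set_integrable_def)

lemma c_int: "0 \<le> s \<Longrightarrow> t \<le> T \<Longrightarrow> c absolutely_integrable_on {s..t}"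
  using H4_int by (auto simp: integrable_lebesgue_on_iff intro: abs_int_subinterval)

lemma H_lip: "t \<in> {0..T} \<Longrightarrow> \<bar>H t x p - H t x 0\<bar> \<le> c t * (1 + norm x) * norm p"
  using H4[of t x p 0] by simp

lemma H_cont_p: "t \<in> {0..T} \<Longrightarrow> continuous_on UNIV (H t x)"
  using continuous_on_compose2[OF H2[of t], of UNIV "\<lambda>p. (x, p)"] by (simp add: continuous_on_Pair)

lemma H_cont_x: "t \<in> {0..T} \<Longrightarrow> continuous_on UNIV (\<lambda>x. H t x p)"
  using continuous_on_compose2[OF H2[of t], of UNIV "\<lambda>x. (x, p)"] by (simp add: continuous_on_Pair)

lemma speed_le: "t \<in> {0..T} \<Longrightarrow> z \<in> epi_conj (H t x) \<Longrightarrow> norm (fst z) \<le> c t * (1 + norm x)"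
  by (rule epi_conj_norm_le) (use H_lip[of t x] in auto)

lemma H_measurable:
  assumes "0 \<le> s" and y: "y \<in> borel_measurable (lebesgue_on {s..T})" and p: "p \<in> borel_measurable (lebesgue_on {s..T})"
  shows "(\<lambda>t. H t (y t) (p t)) \<in> borel_measurable (lebesgue_on {s..T})"
proof -
  have "(\<lambda>t. (\<lambda>(x, p). H t x p) (y t, p t)) \<in> borel_measurable (lebesgue_on {s..T})"
  proof (rule borel_measurable_caratheodory[where h = "\<lambda>t (x, p). H t x p"])
    show "(\<lambda>t. case z of (x, p) \<Rightarrow> H t x p) \<in> borel_measurable (lebesgue_on {s..T})" for z
      using assms(1) by (cases z) (auto intro: measurable_restrict_mono[OF H1])
    show "continuous_on UNIV (\<lambda>(x, p). H t x p)" if "t \<in> space (lebesgue_on {s..T})" for t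
      using that assms(1) by (intro H2) auto
    show "(\<lambda>t. (y t, p t)) \<in> borel_measurable (lebesgue_on {s..T})"
      using y p by (rule borel_measurable_Pair)
  qed
  then show ?thesis by simp
qed

text \<open>Go from \<open>(x, p)\<close> to \<open>(x, 0)\<close> by the Lipschitz bound in
  \<open>p\<close>, then to \<open>(0, 0)\<close> by the local one in \<open>x\<close>. The result
  dominates all passages to the limit under the integral.\<close>

lemma H_bound:
  assumes "R > 0"
  obtains b where "b absolutely_integrable_on {0..T}" "\<And>t. t \<in> {0..T} \<Longrightarrow> 0 \<le> b t"
    "\<And>t x p. t \<in> {0..T} \<Longrightarrow> norm x \<le> R \<Longrightarrow> norm p \<le> P \<Longrightarrow> \<bar>H t x p\<bar> \<le> b t"
proof -
  obtain k where k: "integrable (lebesgue_on {0..T}) k" "\<And>t. t \<in> {0..T} \<Longrightarrow> 0 \<le> k t"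
    "\<And>t x y p. t \<in> {0..T} \<Longrightarrow> x \<in> cball 0 R \<Longrightarrow> y \<in> cball 0 R \<Longrightarrow>
       \<bar>H t x p - H t y p\<bar> \<le> k t * (1 + norm p) * norm (x - y)"
    using HLC[OF assms] by blast
  define b where "b t = \<bar>H t 0 0\<bar> + (k t * R + c t * ((1 + R) * \<bar>P\<bar>))" for t
  show ?thesis
  proof (rule that[of b])
    show "b absolutely_integrable_on {0..T}"
      using H00 k(1) H4_int unfolding b_def integrable_lebesgue_on_iff
      by (intro set_integral_add(1) set_integrable_abs set_integrable_mult_left)
    show "0 \<le> b t" if "t \<in> {0..T}" for t
      using assms k(2)[OF that] H4_nonneg[OF that] by (simp add: b_def)
    fix t and x p :: 'a assume t: "t \<in> {0..T}" and x: "norm x \<le> R" and p: "norm p \<le> P"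
    have "\<bar>H t x 0 - H t 0 0\<bar> \<le> k t * R"
      using k(3)[OF t, of x 0 0] x assms mult_left_mono[OF x k(2)[OF t]] by simp
    moreover have "c t * (1 + norm x) * norm p \<le> c t * ((1 + R) * \<bar>P\<bar>)"
      unfolding mult.assoc using x p H4_nonneg[OF t] assms by (intro mult_left_mono mult_mono) auto
    ultimately show "\<bar>H t x p\<bar> \<le> b t"
      using H_lip[OF t, of x p] unfolding b_def by linarith
  qed
qed

lemma H_abs_int:
  assumes s: "0 \<le> s" and y: "y \<in> borel_measurable (lebesgue_on {s..T})" and p: "p \<in> borel_measurable (lebesgue_on {s..T})"
    and bnd: "\<And>t. t \<in> {s..T} \<Longrightarrow> norm (y t) \<le> R" "\<And>t. t \<in> {s..T} \<Longrightarrow> norm (p t) \<le> P"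
  shows "(\<lambda>t. H t (y t) (p t)) absolutely_integrable_on {s..T}"
proof -
  obtain b where b: "b absolutely_integrable_on {0..T}"
    "\<And>t x p. t \<in> {0..T} \<Longrightarrow> norm x \<le> max R 1 \<Longrightarrow> norm p \<le> P \<Longrightarrow> \<bar>H t x p\<bar> \<le> b t"
    by (rule H_bound[of "max R 1" P]) auto
  show ?thesis
  proof (rule measurable_bounded_by_integrable_imp_absolutely_integrable[OF H_measurable[OF s y p]])
    show "b integrable_on {s..T}"
      using s by (intro abs_int_imp_integrable abs_int_subinterval[OF b(1)]) auto
    show "norm (H t (y t) (p t)) \<le> b t" if "t \<in> {s..T}" for t
      using b(2)[of t "y t" "p t"] bnd[OF that] s that by simp
  qed simp
qed

text \<open>The Gronwall factor of the whole horizon; since \<open>c\<close> is nonnegative it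
  serves every subinterval.\<close>

definition speed_factor :: real where "speed_factor = exp (2 * integral {0..T} c)"

lemma integral_c_le: 
  assumes "0 \<le> s" "s \<le> t" "t \<le> T"
  shows "0 \<le> integral {s..t} c" "exp (2 * integral {s..t} c) \<le> speed_factor"
proof -
  show "0 \<le> integral {s..t} c"
    using assms H4_nonneg by (intro Henstock_Kurzweil_Integration.integral_nonneg abs_int_imp_integrable c_int) auto
  have "integral {s..t} c \<le> integral {0..T} c"
    using assms H4_nonneg by (intro integral_subset_le abs_int_imp_integrable c_int) auto
  then show "exp (2 * integral {s..t} c) \<le> speed_factor" by (simp add: speed_factor_def)
qed

lemma arc_continuous: "arc s x0 x v r \<Longrightarrow> continuous_on {s..T} x"
proof -
  assume a: "arc s x0 x v r"
  have "continuous_on {s..T} (\<lambda>t. x0 + integral {s..t} v)"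
    by (intro continuous_intros continuous_on_integral arc_v[OF a])
  then show ?thesis using arc_x[OF a] continuous_on_cong by (metis (no_types, lifting))
qed

lemma arc_bound:
  assumes a: "arc s x0 x v r" and s: "0 \<le> s" and t: "t \<in> {s..T}"
  shows "1 + norm (x t) \<le> 2 * (1 + norm x0) * speed_factor"
proof -
  have cs: "c absolutely_integrable_on {s..T}" using s by (intro c_int) auto
  have ctx: "continuous_on {s..T} (\<lambda>t. 1 + norm (x t))"
    by (intro continuous_intros arc_continuous[OF a])
  have "1 + norm (x t) \<le> 2 * (1 + norm x0) * exp (2 * integral {s..t} c)"
  proof (rule gronwall_integral[OF cs _ ctx _ _ _ t])
    fix \<tau> assume \<tau>: "\<tau> \<in> {s..T}"
    show "0 \<le> c \<tau>" using \<tau> s by (intro H4_nonneg) auto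
    have "norm (integral {s..\<tau>} v) \<le> integral {s..\<tau>} (\<lambda>t. c t * (1 + norm (x t)))"
    proof (rule integral_norm_bound_integral)
      show "v integrable_on {s..\<tau>}"
        using \<tau> by (intro abs_int_imp_integrable abs_int_subinterval[OF arc_v[OF a]]) auto
      show "(\<lambda>t. c t * (1 + norm (x t))) integrable_on {s..\<tau>}"
        using \<tau> by (intro abs_int_imp_integrable abs_int_subinterval[OF abs_int_mult_continuous[OF cs ctx]]) auto
      fix t assume "t \<in> {s..\<tau>}"
      then have "t \<in> {s..T}" "t \<in> {0..T}" using \<tau> s by auto
      then show "norm (v t) \<le> c t * (1 + norm (x t))"
        using speed_le[OF _ arc_mem[OF a], of t] by simp
    qed
    moreover have "x \<tau> = x0 + integral {s..\<tau>} v" using arc_x[OF a \<tau>] .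
    ultimately show "1 + norm (x \<tau>) \<le> (1 + norm x0) + integral {s..\<tau>} (\<lambda>t. c t * (1 + norm (x t)))"
      using norm_triangle_ineq[of x0 "integral {s..\<tau>} v"] by simp
  qed auto
  also have "\<dots> \<le> 2 * (1 + norm x0) * speed_factor"
    using t s by (intro mult_left_mono integral_c_le) auto
  finally show ?thesis .
qed

section \<open>The value function as the value of the Bolza problem\<close>

text \<open>The pair \<open>(v, r)\<close> serves as its own control, because the Steiner selection
  fixes points of the epigraph.\<close>

lemma value_fun_le_arc:
  assumes a: "arc s x0 x v r" and s: "s \<in> {0..T}"
  shows "value_fun H g T s x0 \<le> ereal (g (x T) + integral {s..T} r)"
proof -
  define y where "y = (\<lambda>t. x0 + integral {s..t} v)"
  have v: "v absolutely_integrable_on {s..T}" and r: "r absolutely_integrable_on {s..T}"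
    and vr': "\<And>t. t \<in> {s..T} \<Longrightarrow> (v t, r t) \<in> epi_conj (H t (x t))" and yx: "\<And>t. t \<in> {s..T} \<Longrightarrow> y t = x t"
    using arc_v[OF a] arc_r[OF a] arc_mem[OF a] arc_x[OF a] unfolding y_def by metis+
  have vr: "(v t, r t) \<in> epi_conj (H t (y t))" if "t \<in> {s..T}" for t
    using vr'[OF that] yx[OF that] by simp
  have cvx: "convex_on UNIV (H t (y t))" if "t \<in> {s..T}" for t
    using that s by (intro H3) auto
  have f: "steiner_f H t (y t) (v t, r t) = v t" and l: "steiner_l H t (y t) (v t, r t) = r t" if "t \<in> {s..T}" for t
    using steiner_of_mem[where H = H and t = t and x = "y t", OF cvx[OF that] vr[OF that]] by auto
  have traj: "(y, \<lambda>t. (v t, r t)) \<in> traj_set (steiner_f H) T s x0"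
    unfolding traj_set_def mem_Collect_eq prod.case
  proof (intro conjI)
    show "abs_cont_on y s T" unfolding y_def by (rule abs_cont_on_integral[OF v])
    show "(\<lambda>t. (v t, r t)) absolutely_integrable_on {s..T}"
      by (rule absolutely_integrable_Pair[OF v r])
    show "y s = x0" by (simp add: y_def)
    obtain N where N: "negligible N"
      "\<And>t. t \<in> {s..T} - N \<Longrightarrow> ((\<lambda>t. integral {s..t} v) has_vector_derivative v t) (at t within {s..T})"
      using indefinite_integral_has_vector_derivative_ae[OF abs_int_imp_integrable[OF v]] by metis
    have "AE t in lebesgue. t \<notin> N" using N(1) by (intro AE_not_in) (simp add: negligible_iff_null_sets)
    then show "AE t in lebesgue. t \<in> {s..T} \<longrightarrow>
        (y has_vector_derivative steiner_f H t (y t) (v t, r t)) (at t within {s..T})"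
    proof eventually_elim
      case (elim t)
      then show ?case
        using N(2)[of t] f[of t] unfolding y_def
        by (auto intro!: derivative_eq_intros)
    qed
  qed
  have int: "set_integrable lebesgue {s..T} (\<lambda>t. steiner_l H t (y t) (v t, r t))"
    using r by (rule set_integrable_cong[OF refl refl, THEN iffD1, rotated]) (use l in auto)
  have "(LINT t:{s..T}|lebesgue. steiner_l H t (y t) (v t, r t)) = (LINT t:{s..T}|lebesgue. r t)"
    using l by (intro set_lebesgue_integral_cong) auto
  also have "\<dots> = integral {s..T} r" using r by (rule set_lebesgue_integral_eq_integral(2))
  finally have "cost (steiner_l H) g T s y (\<lambda>t. (v t, r t)) = ereal (g (x T) + integral {s..T} r)"
    using int yx[of T] s by (simp add: cost_def)
  then show ?thesis
    unfolding value_fun_def using traj by (intro INF_lower2[OF traj]) simp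
qed

text \<open>A cost below \<open>ereal \<alpha>\<close> excludes the infinite branch of
  \<open>cost\<close>, which is what makes \<open>r\<close> integrable. Integrability of
  \<open>v\<close> comes from the speed bound along the continuous curve \<open>x\<close>.\<close>

lemma arc_of_value_fun_less:
  assumes s: "s \<in> {0..T}" and less: "value_fun H g T s x0 < ereal \<alpha>"
  obtains x v r where "arc s x0 x v r" "g (x T) + integral {s..T} r < \<alpha>"
proof -
  obtain x a where traj: "(x, a) \<in> traj_set (steiner_f H) T s x0"
    and cost: "cost (steiner_l H) g T s x a < ereal \<alpha>"
    using less unfolding value_fun_def INF_less_iff by auto
  define v where "v t = steiner_f H t (x t) (a t)" for t
  define r where "r t = steiner_l H t (x t) (a t)" for t
  have r: "r absolutely_integrable_on {s..T}"
    using cost unfolding cost_def r_def by (auto split: if_splits)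
  have "(LINT t:{s..T}|lebesgue. r t) = integral {s..T} r"
    using r by (rule set_lebesgue_integral_eq_integral(2))
  then have c\<alpha>: "g (x T) + integral {s..T} r < \<alpha>"
    using cost r unfolding cost_def r_def by (auto split: if_splits)
  have ac: "abs_cont_on x s T" and x0: "x s = x0"
    and ae: "AE t in lebesgue. t \<in> {s..T} \<longrightarrow> (x has_vector_derivative v t) (at t within {s..T})"
    using traj by (auto simp: traj_set_def v_def)
  obtain N where N: "negligible N"
    and d: "\<And>t. t \<in> {s..T} - N \<Longrightarrow> (x has_vector_derivative v t) (at t within {s..T})"
  proof -
    from AE_E3[OF ae] obtain N where "N \<in> null_sets lebesgue"
      "\<And>t. t \<in> space lebesgue - N \<Longrightarrow> t \<in> {s..T} \<longrightarrow> (x has_vector_derivative v t) (at t within {s..T})"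
      by blast
    then show ?thesis using that[of N] by (simp add: negligible_iff_null_sets)
  qed
  have hi: "(v has_integral (x t - x s)) {s..t}" if t: "t \<in> {s..T}" for t
  proof (rule abs_cont_on_has_integral[OF _ _ N])
    show "abs_cont_on x s t" using t by (intro abs_cont_on_dominated[OF ac _ zero_less_one]) auto
    show "(x has_vector_derivative v \<tau>) (at \<tau> within {s..t})" if "\<tau> \<in> {s..t} - N" for \<tau>
      using t that by (intro has_vector_derivative_within_subset[OF d]) auto
  qed (use t in auto)
  have mem: "(v t, r t) \<in> epi_conj (H t (x t))" if "t \<in> {s..T}" for t
    unfolding v_def r_def using that s by (intro steiner_mem_epi_conj H3) auto
  have cont: "continuous_on {s..T} (\<lambda>t. 1 + norm (x t))"
    by (intro continuous_intros abs_cont_on_imp_continuous_on[OF ac])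
  have "v absolutely_integrable_on {s..T}"
  proof (rule measurable_bounded_by_integrable_imp_absolutely_integrable)
    show "v \<in> borel_measurable (lebesgue_on {s..T})"
      using hi[of T] s by (intro integrable_imp_measurable) auto
    show "(\<lambda>t. c t * (1 + norm (x t))) integrable_on {s..T}"
      using s by (intro abs_int_imp_integrable abs_int_mult_continuous c_int cont) auto
    show "norm (v t) \<le> c t * (1 + norm (x t))" if "t \<in> {s..T}" for t
      using speed_le[OF _ mem[OF that]] that s by auto
  qed simp
  then have "arc s x0 x v r"
    unfolding arc_def using r mem integral_unique[OF hi] x0 by simp
  then show ?thesis using c\<alpha> that by blast
qed

end

section \<open>Approximation of almost admissible pairs\<close>

context hamiltonian
begin

lemma epi_dist_le:
  assumes "R > 0"
  obtains k where "k absolutely_integrable_on {0..T}" "\<And>t. t \<in> {0..T} \<Longrightarrow> 0 \<le> k t"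
    "\<And>t x y a. \<lbrakk>t \<in> {0..T}; norm x \<le> R; norm y \<le> R; a \<in> epi_conj (H t x)\<rbrakk> \<Longrightarrow>
       dist a (closest_point (epi_conj (H t y)) a) \<le> k t * norm (x - y)"
proof -
  obtain k where k: "integrable (lebesgue_on {0..T}) k" "\<And>t. t \<in> {0..T} \<Longrightarrow> 0 \<le> k t"
    "\<And>t x y p. t \<in> {0..T} \<Longrightarrow> x \<in> cball 0 R \<Longrightarrow> y \<in> cball 0 R \<Longrightarrow>
       \<bar>H t x p - H t y p\<bar> \<le> k t * (1 + norm p) * norm (x - y)"
    using HLC[OF assms] by blast
  show ?thesis
  proof (rule that[of "\<lambda>t. 2 * k t"])
    show "(\<lambda>t. 2 * k t) absolutely_integrable_on {0..T}"
      using k(1) by (auto simp: integrable_lebesgue_on_iff)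
    show "0 \<le> 2 * k t" if "t \<in> {0..T}" for t using k(2)[OF that] by simp
    fix t and x y :: 'a and a assume *: "t \<in> {0..T}" "norm x \<le> R" "norm y \<le> R" "a \<in> epi_conj (H t x)"
    have "dist a (closest_point (epi_conj (H t y)) a) \<le> 2 * (k t * norm (x - y))"
    proof (rule dist_closest_point_epi_conj[OF H3[OF *(1)] *(4)])
      show "0 \<le> k t * norm (x - y)" using k(2)[OF *(1)] by simp
      show "H t x p \<le> H t y p + k t * norm (x - y) * (1 + norm p)" for p
        using k(3)[of t x y p] * by (simp add: algebra_simps abs_le_iff)
    qed
    then show "dist a (closest_point (epi_conj (H t y)) a) \<le> 2 * k t * norm (x - y)" by simp
  qed
qed

lemma fst_abs_int:
  fixes a :: "real \<Rightarrow> 'a \<times> real"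
  assumes "a absolutely_integrable_on S"
  shows "(\<lambda>t. fst (a t)) absolutely_integrable_on S" "(\<lambda>t. snd (a t)) absolutely_integrable_on S"
  using absolutely_integrable_linear[OF assms bounded_linear_fst]
    absolutely_integrable_linear[OF assms bounded_linear_snd] by (auto simp: o_def)

text \<open>Successive projections onto the epigraphs along the current curve; the reference pair
  \<open>(v, r)\<close> violates the inclusion by at most \<open>\<gamma>\<close>.\<close>

lemma filippov:
  assumes M: "1 \<le> M"
  obtains K where "0 \<le> K"
    "\<And>s x1 v r \<gamma>. \<lbrakk>s \<in> {0..T}; v absolutely_integrable_on {s..T}; r absolutely_integrable_on {s..T};
        \<gamma> absolutely_integrable_on {s..T};
        \<And>t. t \<in> {s..T} \<Longrightarrow> 1 + norm (x1 + integral {s..t} v) \<le> M;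
        \<And>t. t \<in> {s..T} \<Longrightarrow>
          dist (v t, r t) (closest_point (epi_conj (H t (x1 + integral {s..t} v))) (v t, r t)) \<le> \<gamma> t\<rbrakk> \<Longrightarrow>
      \<exists>y w q. arc s x1 y w q \<and> norm (y T - (x1 + integral {s..T} v)) \<le> K * integral {s..T} \<gamma> \<and>
        \<bar>integral {s..T} q - integral {s..T} r\<bar> \<le> K * integral {s..T} \<gamma>"
proof -
  \<comment> \<open>The iterates will satisfy
    \<open>1 + norm (y i t) \<le> M * exp (2 * integral {s..t} c)\<close>, so they share the ball of
    radius \<open>R\<close> and one Lipschitz function \<kappa>.\<close>
  define R where "R = M * speed_factor"
  have sf1: "0 < speed_factor" by (simp add: speed_factor_def)
  have R: "R > 0" using M sf1 by (simp add: R_def)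
  obtain \<kappa> where \<kappa>: "\<kappa> absolutely_integrable_on {0..T}" and \<kappa>0: "\<And>t. t \<in> {0..T} \<Longrightarrow> 0 \<le> \<kappa> t"
    and \<kappa>d: "\<And>t x y a. \<lbrakk>t \<in> {0..T}; norm x \<le> R; norm y \<le> R; a \<in> epi_conj (H t x)\<rbrakk> \<Longrightarrow>
       dist a (closest_point (epi_conj (H t y)) a) \<le> \<kappa> t * norm (x - y)"
    using epi_dist_le[OF R] by metis
  define K where "K = exp (2 * integral {0..T} \<kappa>)"
  have K0: "0 \<le> K" by (simp add: K_def)
  show ?thesis
  proof (rule that[OF K0])
    fix s x1 v r \<gamma>
    assume s: "s \<in> {0..T}" and v: "v absolutely_integrable_on {s..T}" and r: "r absolutely_integrable_on {s..T}"
      and \<gamma>: "\<gamma> absolutely_integrable_on {s..T}"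
      and bnd: "\<And>t. t \<in> {s..T} \<Longrightarrow> 1 + norm (x1 + integral {s..t} v) \<le> M"
      and defect: "\<And>t. t \<in> {s..T} \<Longrightarrow>
          dist (v t, r t) (closest_point (epi_conj (H t (x1 + integral {s..t} v))) (v t, r t)) \<le> \<gamma> t"
    have sT: "t \<in> {0..T}" if "t \<in> {s..T}" for t using that s by auto
    have ks: "\<kappa> absolutely_integrable_on {s..T}" by (rule abs_int_subinterval[OF \<kappa>]) (use s in auto)
    have ks0: "\<And>t. t \<in> {s..T} \<Longrightarrow> 0 \<le> \<kappa> t" using \<kappa>0 sT by blast
    have cs: "c absolutely_integrable_on {s..T}" using s by (intro c_int) auto
    have cs0: "\<And>t. t \<in> {s..T} \<Longrightarrow> 0 \<le> c t" using H4_nonneg sT by blast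
    have sub: "f integrable_on {s..t}" if "f absolutely_integrable_on {s..T}" "t \<in> {s..T}" for f :: "real \<Rightarrow> 'c::euclidean_space" and t
      using that by (intro abs_int_imp_integrable abs_int_subinterval[OF that(1)]) auto
    \<comment> \<open>Each iterate projects the previous velocity-cost pair onto the epigraph along
      the curve which that pair generates.\<close>
    define a where "a = rec_nat (\<lambda>t. (v t, r t))
        (\<lambda>i ai t. closest_point (epi_conj (H t (x1 + integral {s..t} (\<lambda>\<tau>. fst (ai \<tau>))))) (ai t))"
    define y where "y i t = x1 + integral {s..t} (\<lambda>\<tau>. fst (a i \<tau>))" for i t
    have a0: "a 0 t = (v t, r t)" for t by (simp add: a_def)
    have aS: "a (Suc i) t = closest_point (epi_conj (H t (y i t))) (a i t)" for i t
      by (simp add: a_def y_def)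
    have y0: "y 0 t = x1 + integral {s..t} v" for t by (simp add: y_def a0)
    define \<Gamma> where "\<Gamma> = integral {s..T} \<gamma>"
    define E where "E t = exp (2 * integral {s..t} \<kappa>)" for t
    \<comment> \<open>Bounds the \<open>i\<close>-th correction. Its integral up to \<open>t\<close>
      is at most \<open>\<Gamma> * (1/2)^i * E t\<close>, and \<kappa> times this is
      \<open>\<delta> (Suc i) t\<close>; the factor 2 makes up for the higher power of
      \<open>1/2\<close>.\<close>
    define \<delta> where "\<delta> i t = (if i = 0 then \<gamma> t else \<kappa> t * (2 * \<Gamma> * E t * (1/2)^i))" for i :: nat and t
    have \<gamma>0: "0 \<le> \<gamma> t" if "t \<in> {s..T}" for t using defect[OF that] zero_le_dist order_trans by blast
    have \<Gamma>0: "0 \<le> \<Gamma>" unfolding \<Gamma>_def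
      using \<gamma>0 by (intro Henstock_Kurzweil_Integration.integral_nonneg abs_int_imp_integrable \<gamma>)
    have E_cont: "continuous_on {s..T} E"
      unfolding E_def by (intro continuous_intros continuous_on_integral ks)
    have k_int0: "0 \<le> integral {s..t} \<kappa>" if "t \<in> {s..T}" for t
      using that ks0 by (intro Henstock_Kurzweil_Integration.integral_nonneg sub ks) auto
    have E1: "1 \<le> E t" if "t \<in> {s..T}" for t
      unfolding E_def using k_int0[OF that] by simp
    have EK: "E T \<le> K"
    proof -
      have "integral {s..T} \<kappa> \<le> integral {0..T} \<kappa>"
        using s \<kappa>0 by (intro integral_subset_le abs_int_imp_integrable ks \<kappa>) auto
      then show ?thesis by (simp add: E_def K_def)
    qed
    have \<delta>_int: "\<delta> i absolutely_integrable_on {s..T}" for i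
    proof (cases "i = 0")
      case True
      then show ?thesis using \<gamma> by (simp add: \<delta>_def[abs_def])
    next
      case False
      have "(\<lambda>t. \<kappa> t * (2 * \<Gamma> * E t * (1/2)^i)) absolutely_integrable_on {s..T}"
        by (intro abs_int_mult_continuous ks continuous_intros E_cont)
      then show ?thesis using False by (simp add: \<delta>_def[abs_def])
    qed
    have \<delta>_le: "integral {s..t} (\<delta> i) \<le> \<Gamma> * (1/2)^i * E t" if t: "t \<in> {s..T}" for i t
    proof (cases "i = 0")
      case True
      have "integral {s..t} \<gamma> \<le> \<Gamma>"
        unfolding \<Gamma>_def using t \<gamma>0 by (intro integral_subset_le sub \<gamma>) auto
      also have "\<dots> \<le> \<Gamma> * E t" using \<Gamma>0 E1[OF t] by (simp add: mult_le_cancel_left1)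
      finally show ?thesis using True by (simp add: \<delta>_def[abs_def])
    next
      case False
      have "integral {s..t} (\<lambda>t. \<kappa> t * (2 * \<Gamma> * E t * (1/2)^i))
          \<le> (2 * \<Gamma> * (1/2)^i) * ((exp (2 * integral {s..t} \<kappa>) - 1) / 2)"
        by (rule integral_exp_weight_le[OF ks ks0 t])
          (auto simp: E_def intro!: continuous_intros continuous_on_integral ks)
      also have "\<dots> = \<Gamma> * (1/2)^i * (E t - 1)" by (simp add: E_def)
      also have "\<dots> \<le> \<Gamma> * (1/2)^i * E t" using \<Gamma>0 by (intro mult_left_mono) auto
      finally show ?thesis using False by (simp add: \<delta>_def[abs_def])
    qed
    have y_cont: "continuous_on {s..T} (y i)" if "a i absolutely_integrable_on {s..T}" for i
      unfolding y_def by (intro continuous_intros continuous_on_integral fst_abs_int that)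
    have mem: "a (Suc i) t \<in> epi_conj (H t (y i t))" if t: "t \<in> {s..T}" for i t
      unfolding aS by (rule closest_point_in_set[OF closed_epi_conj epi_conj_nonempty[OF H3[OF sT[OF t]]]])
    have inv: "a i absolutely_integrable_on {s..T} \<and>
        (\<forall>t\<in>{s..T}. 1 + norm (y i t) \<le> M * exp (2 * integral {s..t} c)) \<and>
        (\<forall>t\<in>{s..T}. dist (a i t) (a (Suc i) t) \<le> \<delta> i t)" for i
    proof (induction i)
      case 0
      have "a 0 absolutely_integrable_on {s..T}"
        using absolutely_integrable_Pair[OF v r] by (simp add: a0[abs_def] a_def)
      moreover have "1 + norm (y 0 t) \<le> M * exp (2 * integral {s..t} c)" if t: "t \<in> {s..T}" for t
      proof -
        have "1 \<le> exp (2 * integral {s..t} c)" using integral_c_le(1)[of s t] s t by simp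
        then have "M * 1 \<le> M * exp (2 * integral {s..t} c)" using M by (intro mult_left_mono) auto
        then show ?thesis using bnd[OF t] by (simp add: y0)
      qed
      moreover have "dist (a 0 t) (a (Suc 0) t) \<le> \<delta> 0 t" if t: "t \<in> {s..T}" for t
        using defect[OF t] by (simp add: aS y0 a0 \<delta>_def)
      ultimately show ?case by blast
    next
      case (Suc i)
      then have ai: "a i absolutely_integrable_on {s..T}"
        and yb: "\<And>t. t \<in> {s..T} \<Longrightarrow> 1 + norm (y i t) \<le> M * exp (2 * integral {s..t} c)"
        and ad: "\<And>t. t \<in> {s..T} \<Longrightarrow> dist (a i t) (a (Suc i) t) \<le> \<delta> i t" by auto
      have yim: "y i \<in> borel_measurable (lebesgue_on {s..T})"
        by (intro continuous_imp_measurable_on_sets_lebesgue y_cont ai) simp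
      have aim: "a i \<in> borel_measurable (lebesgue_on {s..T})"
        by (rule absolutely_integrable_imp_borel_measurable[OF ai]) simp
      have aS_meas: "a (Suc i) \<in> borel_measurable (lebesgue_on {s..T})"
        unfolding aS[abs_def]
      proof (rule measurable_closest_point_epi_conj[OF _ _ _ aim])
        show "(\<lambda>t. H t (y i t) p) \<in> borel_measurable (lebesgue_on {s..T})" for p
          using s by (intro H_measurable yim) auto
        show "convex_on UNIV (H t (y i t))" "continuous_on UNIV (H t (y i t))" if "t \<in> space (lebesgue_on {s..T})" for t
          using that sT by (auto intro: H3 H_cont_p)
      qed
      have aS_int: "a (Suc i) absolutely_integrable_on {s..T}"
      proof (rule measurable_bounded_by_integrable_imp_absolutely_integrable[OF aS_meas])
        show "(\<lambda>t. norm (a i t) + \<delta> i t) integrable_on {s..T}"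
          using absolutely_integrable_norm[OF ai] \<delta>_int[of i]
          by (intro integrable_add abs_int_imp_integrable) (auto simp: o_def)
        show "norm (a (Suc i) t) \<le> norm (a i t) + \<delta> i t" if "t \<in> {s..T}" for t
          using ad[OF that] norm_triangle_ineq2[of "a (Suc i) t" "a i t"] by (simp add: dist_norm norm_minus_commute)
      qed simp
      \<comment> \<open>The new speed is bounded through the old curve, so the bound is halved up to
        the term with \<open>- M\<close>; this leaves room for the initial value, which is at most
        \<open>M\<close>.\<close>
      have yb': "1 + norm (y (Suc i) t) \<le> M * exp (2 * integral {s..t} c)" if t: "t \<in> {s..T}" for t
      proof -
        have cont: "continuous_on {s..T} (\<lambda>t. 1 + norm (y i t))"
          by (intro continuous_intros y_cont ai)
        have "norm (integral {s..t} (\<lambda>\<tau>. fst (a (Suc i) \<tau>))) \<le> integral {s..t} (\<lambda>\<tau>. c \<tau> * (1 + norm (y i \<tau>)))"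
        proof (rule integral_norm_bound_integral)
          show "(\<lambda>\<tau>. fst (a (Suc i) \<tau>)) integrable_on {s..t}"
            by (rule sub[OF fst_abs_int(1)[OF aS_int] t])
          show "(\<lambda>\<tau>. c \<tau> * (1 + norm (y i \<tau>))) integrable_on {s..t}"
            by (rule sub[OF abs_int_mult_continuous[OF cs cont] t])
          fix \<tau> assume "\<tau> \<in> {s..t}"
          then have \<tau>: "\<tau> \<in> {s..T}" using t by auto
          show "norm (fst (a (Suc i) \<tau>)) \<le> c \<tau> * (1 + norm (y i \<tau>))"
            by (rule speed_le[OF sT[OF \<tau>] mem[OF \<tau>]])
        qed
        also have "\<dots> \<le> M * ((exp (2 * integral {s..t} c) - 1) / 2)"
          by (rule integral_exp_weight_le[OF cs cs0 t cont yb]) (use t in auto)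
        finally have "norm (y (Suc i) t) \<le> norm x1 + M * ((exp (2 * integral {s..t} c) - 1) / 2)"
          unfolding y_def using norm_triangle_ineq[of x1] order_trans add_left_mono by blast
        then have "1 + norm (y (Suc i) t) \<le> (1 + norm x1) + (M * exp (2 * integral {s..t} c) - M) / 2"
          by (simp add: algebra_simps)
        also have "\<dots> \<le> M + (M * exp (2 * integral {s..t} c) - M) / 2"
          using bnd[of s] s by simp
        also have "\<dots> = (M * 1 + M * exp (2 * integral {s..t} c)) / 2" by (simp add: field_simps)
        also have "\<dots> \<le> (M * exp (2 * integral {s..t} c) + M * exp (2 * integral {s..t} c)) / 2"
          using M integral_c_le(1)[of s t] s t by (intro divide_right_mono add_mono mult_left_mono) auto
        finally show ?thesis by simp
      qed
      have yR: "norm (y i t) \<le> R" "norm (y (Suc i) t) \<le> R" if t: "t \<in> {s..T}" for t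
      proof -
        have "M * exp (2 * integral {s..t} c) \<le> R"
          unfolding R_def using M s t by (intro mult_left_mono integral_c_le) auto
        then show "norm (y i t) \<le> R" "norm (y (Suc i) t) \<le> R"
          using yb[OF t] yb'[OF t] by linarith+
      qed
      have ydiff: "norm (y i t - y (Suc i) t) \<le> \<Gamma> * (1/2)^i * E t" if t: "t \<in> {s..T}" for t
      proof -
        have "y i t - y (Suc i) t = integral {s..t} (\<lambda>\<tau>. fst (a i \<tau>) - fst (a (Suc i) \<tau>))"
          unfolding y_def using sub[OF fst_abs_int(1)[OF ai] t] sub[OF fst_abs_int(1)[OF aS_int] t]
          by (simp add: Henstock_Kurzweil_Integration.integral_diff)
        also have "norm \<dots> \<le> integral {s..t} (\<delta> i)"
        proof (rule integral_norm_bound_integral)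
          show "(\<lambda>\<tau>. fst (a i \<tau>) - fst (a (Suc i) \<tau>)) integrable_on {s..t}"
            using sub[OF fst_abs_int(1)[OF ai] t] sub[OF fst_abs_int(1)[OF aS_int] t] by (rule integrable_diff)
          show "\<delta> i integrable_on {s..t}" by (rule sub[OF \<delta>_int t])
          fix \<tau> assume "\<tau> \<in> {s..t}"
          then have "dist (a i \<tau>) (a (Suc i) \<tau>) \<le> \<delta> i \<tau>" using t by (intro ad) auto
          then show "norm (fst (a i \<tau>) - fst (a (Suc i) \<tau>)) \<le> \<delta> i \<tau>"
            using dist_fst_le[of "a i \<tau>" "a (Suc i) \<tau>"] by (simp add: dist_norm)
        qed
        also have "\<dots> \<le> \<Gamma> * (1/2)^i * E t" by (rule \<delta>_le[OF t])
        finally show ?thesis .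
      qed
      have "dist (a (Suc i) t) (a (Suc (Suc i)) t) \<le> \<delta> (Suc i) t" if t: "t \<in> {s..T}" for t
      proof -
        have "dist (a (Suc i) t) (a (Suc (Suc i)) t) \<le> \<kappa> t * norm (y i t - y (Suc i) t)"
          unfolding aS[of "Suc i"] by (rule \<kappa>d[OF sT[OF t] yR[OF t] mem[OF t]])
        also have "\<dots> \<le> \<kappa> t * (\<Gamma> * (1/2)^i * E t)"
          by (intro mult_left_mono ydiff t ks0)
        finally show ?thesis by (simp add: \<delta>_def mult_ac)
      qed
      then show ?case using aS_int yb' by blast
    qed
    have ai: "a i absolutely_integrable_on {s..T}" for i using inv by blast
    have ad: "dist (a i t) (a (Suc i) t) \<le> \<delta> i t" if "t \<in> {s..T}" for i t using inv that by blast
    \<comment> \<open>The function \<gamma> plus the geometric sum of \<open>\<delta> i t\<close>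
      over \<open>i \<ge> 1\<close>. In its integral the \<open>- 1\<close> of the exponential
      weight cancels the contribution of \<gamma>, leaving \<open>\<Gamma> * E T\<close>.\<close>
    define \<beta> where "\<beta> t = \<gamma> t + \<kappa> t * (2 * \<Gamma> * E t)" for t
    have B_int: "(\<lambda>t. \<kappa> t * (2 * \<Gamma> * E t)) absolutely_integrable_on {s..T}"
      by (intro abs_int_mult_continuous ks continuous_intros E_cont)
    have \<beta>_int: "\<beta> absolutely_integrable_on {s..T}"
      unfolding \<beta>_def by (intro set_integral_add(1) \<gamma> B_int)
    have \<beta>_le: "integral {s..T} \<beta> \<le> K * \<Gamma>"
    proof -
      have TT: "T \<in> {s..T}" using s by auto
      have "integral {s..T} (\<lambda>t. \<kappa> t * (2 * \<Gamma> * E t)) \<le> (2 * \<Gamma>) * ((exp (2 * integral {s..T} \<kappa>) - 1) / 2)"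
        by (rule integral_exp_weight_le[OF ks ks0 TT])
          (auto simp: E_def intro!: continuous_intros continuous_on_integral ks)
      then have "integral {s..T} (\<lambda>t. \<kappa> t * (2 * \<Gamma> * E t)) \<le> \<Gamma> * E T - \<Gamma>"
        by (simp add: E_def algebra_simps)
      moreover have "integral {s..T} \<beta> = \<Gamma> + integral {s..T} (\<lambda>t. \<kappa> t * (2 * \<Gamma> * E t))"
        unfolding \<beta>_def \<Gamma>_def by (intro Henstock_Kurzweil_Integration.integral_add abs_int_imp_integrable \<gamma> B_int[unfolded \<Gamma>_def])
      moreover have "\<Gamma> * E T \<le> \<Gamma> * K" using EK \<Gamma>0 by (rule mult_left_mono)
      ultimately show ?thesis by (simp add: mult.commute)
    qed
    have part: "dist (a n t) (a 0 t) \<le> \<beta> t" if t: "t \<in> {s..T}" for n t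
    proof -
      define B where "B = \<kappa> t * (2 * \<Gamma> * E t)"
      have B0: "0 \<le> B" unfolding B_def using ks0[OF t] \<Gamma>0 E1[OF t] by (intro mult_nonneg_nonneg) auto
      have "dist (a (Suc n) t) (a 0 t) \<le> \<gamma> t + B * (1 - (1/2)^n)" for n
      proof (induction n)
        case 0
        then show ?case using ad[OF t, of 0] by (simp add: dist_commute \<delta>_def)
      next
        case (Suc n)
        have "dist (a (Suc (Suc n)) t) (a 0 t) \<le> dist (a (Suc n) t) (a (Suc (Suc n)) t) + dist (a (Suc n) t) (a 0 t)"
          by (metis dist_triangle dist_commute)
        also have "\<dots> \<le> B * (1/2)^(Suc n) + (\<gamma> t + B * (1 - (1/2)^n))"
          using ad[OF t, of "Suc n"] Suc by (intro add_mono) (auto simp: \<delta>_def B_def mult_ac)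
        finally show ?case by (simp add: algebra_simps)
      qed
      then have "dist (a (Suc n) t) (a 0 t) \<le> \<gamma> t + B" for n
        using B0 by (smt (verit, ccfv_threshold) mult_left_le power_le_one zero_le_power divide_nonneg_nonneg half_gt_zero_iff)
      moreover have "dist (a 0 t) (a 0 t) \<le> \<gamma> t + B" using \<gamma>0[OF t] B0 by simp
      ultimately show ?thesis by (cases n) (auto simp: \<beta>_def B_def)
    qed
    have conv: "\<exists>l. (\<lambda>n. a n t) \<longlonglongrightarrow> l" if t: "t \<in> {s..T}" for t
    proof -
      have "summable (\<lambda>i. a (Suc i) t - a i t)"
      proof (rule summable_comparison_test'[where N = 1])
        show "summable (\<lambda>i. (\<kappa> t * (2 * \<Gamma> * E t)) * (1/2::real)^i)"
          by (intro summable_mult summable_geometric) simp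
        show "norm (a (Suc i) t - a i t) \<le> (\<kappa> t * (2 * \<Gamma> * E t)) * (1/2)^i" if "1 \<le> i" for i
          using ad[OF t, of i] that by (simp add: dist_norm norm_minus_commute \<delta>_def mult_ac)
      qed
      then have "(\<lambda>n. \<Sum>i<n. a (Suc i) t - a i t) \<longlonglongrightarrow> (\<Sum>i. a (Suc i) t - a i t)"
        by (rule summable_LIMSEQ)
      then have "(\<lambda>n. a 0 t + (a n t - a 0 t)) \<longlonglongrightarrow> a 0 t + (\<Sum>i. a (Suc i) t - a i t)"
        unfolding sum_lessThan_telescope[where f = "\<lambda>i. a i t"] by (intro tendsto_add tendsto_const)
      then have "(\<lambda>n. a n t) \<longlonglongrightarrow> a 0 t + (\<Sum>i. a (Suc i) t - a i t)" by simp
      then show ?thesis by (rule exI)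
    qed
    define b where "b t = lim (\<lambda>n. a n t)" for t
    have lim: "(\<lambda>n. a n t) \<longlonglongrightarrow> b t" if "t \<in> {s..T}" for t
      using conv[OF that] unfolding b_def convergent_def[symmetric] convergent_LIMSEQ_iff .
    have b_near: "dist (b t) (a 0 t) \<le> \<beta> t" if t: "t \<in> {s..T}" for t
      by (rule LIMSEQ_le_const2[OF tendsto_dist[OF lim[OF t] tendsto_const]]) (use part[OF t] in blast)
    define h where "h t = norm (a 0 t) + \<beta> t" for t
    have h_int: "h absolutely_integrable_on {s..T}"
      unfolding h_def using absolutely_integrable_norm[OF ai[of 0]] \<beta>_int
      by (intro set_integral_add(1)) (auto simp: o_def)
    have near_le: "norm z \<le> h t" if "dist z (a 0 t) \<le> \<beta> t" for z t
      using that norm_triangle_ineq2[of z "a 0 t"] by (simp add: h_def dist_norm)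
    have b_int: "b absolutely_integrable_on {s..T}"
    proof (rule dominated_convergence_absolutely_integrable[where f = a and h = h])
      show "a k absolutely_integrable_on {s..T}" for k by (rule ai)
      show "h integrable_on {s..T}" by (rule abs_int_imp_integrable[OF h_int])
      show "norm (b t) \<le> h t" if "t \<in> {s..T}" for t by (rule near_le[OF b_near[OF that]])
      show "(\<lambda>k. a k t) \<longlonglongrightarrow> b t" if "t \<in> {s..T}" for t by (rule lim[OF that])
    qed
    define Y where "Y t = x1 + integral {s..t} (\<lambda>\<tau>. fst (b \<tau>))" for t
    have Ylim: "(\<lambda>n. y n t) \<longlonglongrightarrow> Y t" if t: "t \<in> {s..T}" for t
      unfolding y_def Y_def
    proof (intro tendsto_add tendsto_const dominated_convergence(2)[where h = h])
      show "(\<lambda>\<tau>. fst (a k \<tau>)) integrable_on {s..t}" for k by (rule sub[OF fst_abs_int(1)[OF ai] t])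
      show "h integrable_on {s..t}" by (rule sub[OF h_int t])
      fix \<tau> assume "\<tau> \<in> {s..t}"
      then have \<tau>: "\<tau> \<in> {s..T}" using t by auto
      show "norm (fst (a k \<tau>)) \<le> h \<tau>" for k
        using near_le[OF part[OF \<tau>]] norm_fst_le[of "fst (a k \<tau>)" "snd (a k \<tau>)"] order_trans by fastforce
      show "(\<lambda>k. fst (a k \<tau>)) \<longlonglongrightarrow> fst (b \<tau>)" by (intro tendsto_fst lim \<tau>)
    qed
    \<comment> \<open>Iterate \<open>Suc n\<close> lies in the epigraph at \<open>y n t\<close>;
      continuity of \<open>H\<close> in \<open>x\<close> carries each inequality to the
      limit.\<close>
    have b_mem: "b t \<in> epi_conj (H t (Y t))" if t: "t \<in> {s..T}" for t
    proof (rule epi_conjI)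
      fix p
      have L: "(\<lambda>n. a (Suc n) t) \<longlonglongrightarrow> b t" using lim[OF t] by (rule LIMSEQ_Suc)
      have "isCont (\<lambda>x. H t x p) (Y t)"
        using H_cont_x[OF sT[OF t], of p] by (simp add: continuous_on_eq_continuous_at)
      then have "(\<lambda>n. H t (y n t) p) \<longlonglongrightarrow> H t (Y t) p"
        using Ylim[OF t] by (rule isCont_tendsto_compose)
      moreover have "(\<lambda>n. fst (a (Suc n) t) \<bullet> p - snd (a (Suc n) t)) \<longlonglongrightarrow> fst (b t) \<bullet> p - snd (b t)"
        by (intro tendsto_intros L)
      ultimately show "fst (b t) \<bullet> p - snd (b t) \<le> H t (Y t) p"
        using epi_conjD[OF mem[OF t]] by (intro LIMSEQ_le) auto
    qed
    have arc: "arc s x1 Y (\<lambda>t. fst (b t)) (\<lambda>t. snd (b t))"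
      unfolding arc_def using fst_abs_int[OF b_int] b_mem by (simp add: Y_def)
    have TT: "T \<in> {s..T}" using s by auto
    note int = sub[OF fst_abs_int(1)[OF b_int] TT] sub[OF fst_abs_int(2)[OF b_int] TT] sub[OF v TT] sub[OF r TT]
      sub[OF \<beta>_int TT]
    have near: "norm (fst (b t) - v t) \<le> \<beta> t" "norm (snd (b t) - r t) \<le> \<beta> t" if "t \<in> {s..T}" for t
      using b_near[OF that] dist_fst_le[of "b t" "a 0 t"] dist_snd_le[of "b t" "a 0 t"]
      by (auto simp: a0 dist_norm)
    have "norm (Y T - (x1 + integral {s..T} v)) = norm (integral {s..T} (\<lambda>t. fst (b t) - v t))"
      unfolding Y_def using int by (simp add: Henstock_Kurzweil_Integration.integral_diff)
    also have "\<dots> \<le> integral {s..T} \<beta>"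
      using near int by (intro integral_norm_bound_integral integrable_diff) auto
    finally have 1: "norm (Y T - (x1 + integral {s..T} v)) \<le> K * \<Gamma>" using \<beta>_le by linarith
    have "norm (integral {s..T} (\<lambda>t. snd (b t)) - integral {s..T} r) = norm (integral {s..T} (\<lambda>t. snd (b t) - r t))"
      using int by (simp add: Henstock_Kurzweil_Integration.integral_diff)
    also have "\<dots> \<le> integral {s..T} \<beta>"
      using near int by (intro integral_norm_bound_integral integrable_diff) auto
    finally have 2: "\<bar>integral {s..T} (\<lambda>t. snd (b t)) - integral {s..T} r\<bar> \<le> K * \<Gamma>" using \<beta>_le by simp
    show "\<exists>y w q. arc s x1 y w q \<and> norm (y T - (x1 + integral {s..T} v)) \<le> K * integral {s..T} \<gamma> \<and>
        \<bar>integral {s..T} q - integral {s..T} r\<bar> \<le> K * integral {s..T} \<gamma>"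
      using arc 1 2 unfolding \<Gamma>_def by blast
  qed
qed

end

section \<open>Upper semicontinuity of the value function\<close>

text \<open>Brings arcs with different initial times onto one common interval.\<close>

lemma extend_zero:
  fixes f :: "real \<Rightarrow> 'b::euclidean_space"
  assumes f: "f absolutely_integrable_on {s..b}" and s: "a \<le> s"
  shows "(\<lambda>t. if s \<le> t then f t else 0) absolutely_integrable_on {a..b}"
    and "integral {a..t} (\<lambda>t. if s \<le> t then f t else 0) = integral {s..t} f"
proof -
  have "(\<lambda>t. indicator {a..b} t *\<^sub>R (if s \<le> t then f t else 0)) = (\<lambda>t. indicator {s..b} t *\<^sub>R f t)"
    using s by (auto simp: indicator_def fun_eq_iff)
  then show "(\<lambda>t. if s \<le> t then f t else 0) absolutely_integrable_on {a..b}"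
    using f unfolding set_integrable_def by simp
  have "integral {a..t} (\<lambda>t. if t \<in> {s..} then f t else 0) = integral ({s..} \<inter> {a..t}) f"
    by (rule Henstock_Kurzweil_Integration.integral_restrict_Int)
  moreover have "{s..} \<inter> {a..t} = {s..t}" using s by auto
  ultimately show "integral {a..t} (\<lambda>t. if s \<le> t then f t else 0) = integral {s..t} f"
    by (simp only: atLeast_iff)
qed

context hamiltonian
begin

lemma epi_dist_zero_le:
  assumes "t \<in> {0..T}"
  shows "dist (0, 0) (closest_point (epi_conj (H t x)) (0, 0)) \<le> c t * (1 + norm x) + \<bar>H t x 0\<bar>"
  using infdist_zero_epi_conj_le[OF H3[OF assms] H_lip[OF assms]] by (simp add: zero_prod_def)

text \<open>Some arc must exist: Filippov's iteration is started at the constant curve with zero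
  cost, whose defect is integrable.\<close>

lemma value_fun_less_infinity:
  assumes s: "s \<in> {0..T}"
  shows "value_fun H g T s x0 < \<infinity>"
proof -
  obtain b where b: "b absolutely_integrable_on {0..T}"
    "\<And>t x p. t \<in> {0..T} \<Longrightarrow> norm x \<le> 1 + norm x0 \<Longrightarrow> norm p \<le> 0 \<Longrightarrow> \<bar>H t x p\<bar> \<le> b t"
    by (rule H_bound[of "1 + norm x0" 0]) (auto simp: add_pos_nonneg)
  obtain K where K: "\<And>s x1 v r \<gamma>. \<lbrakk>s \<in> {0..T}; v absolutely_integrable_on {s..T}; r absolutely_integrable_on {s..T};
        \<gamma> absolutely_integrable_on {s..T};
        \<And>t. t \<in> {s..T} \<Longrightarrow> 1 + norm (x1 + integral {s..t} v) \<le> 1 + norm x0;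
        \<And>t. t \<in> {s..T} \<Longrightarrow>
          dist (v t, r t) (closest_point (epi_conj (H t (x1 + integral {s..t} v))) (v t, r t)) \<le> \<gamma> t\<rbrakk> \<Longrightarrow>
      \<exists>y w q. arc s x1 y w q \<and> norm (y T - (x1 + integral {s..T} v)) \<le> K * integral {s..T} \<gamma> \<and>
        \<bar>integral {s..T} q - integral {s..T} r\<bar> \<le> K * integral {s..T} \<gamma>"
    using filippov[of "1 + norm x0"] by (metis le_add_same_cancel1 norm_ge_zero)
  have "\<exists>y w q. arc s x0 y w q \<and> norm (y T - (x0 + integral {s..T} (\<lambda>_. 0)))
      \<le> K * integral {s..T} (\<lambda>t. c t * (1 + norm x0) + b t) \<and>
        \<bar>integral {s..T} q - integral {s..T} (\<lambda>_. 0)\<bar> \<le> K * integral {s..T} (\<lambda>t. c t * (1 + norm x0) + b t)"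
  proof (rule K[OF s])
    show "(\<lambda>t. c t * (1 + norm x0) + b t) absolutely_integrable_on {s..T}"
      using s by (intro set_integral_add(1) set_integrable_mult_left c_int abs_int_subinterval[OF b(1)]) auto
    fix t assume "t \<in> {s..T}"
    then have t: "t \<in> {0..T}" using s by auto
    show "dist (0, 0) (closest_point (epi_conj (H t (x0 + integral {s..t} (\<lambda>_. 0)))) (0, 0)) \<le> c t * (1 + norm x0) + b t"
      using epi_dist_zero_le[OF t, of x0] b(2)[OF t, of x0 0] by simp
  qed auto
  then obtain y w q where "arc s x0 y w q" by blast
  from value_fun_le_arc[OF this s] show ?thesis by (rule le_less_trans) simp
qed

text \<open>Testing the inclusion with \<open>p = 0\<close> gives
  \<open>r t \<ge> - H t (x t) 0\<close>, which is bounded below uniformly because all arcs from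
  \<open>x0\<close> stay in one ball. On that ball \<open>g\<close> attains its minimum.\<close>

lemma value_fun_gt_minus_infinity:
  assumes s: "s \<in> {0..T}" and g: "continuous_on UNIV g"
  shows "- \<infinity> < value_fun H g T s x0"
proof -
  define R where "R = 2 * (1 + norm x0) * speed_factor"
  have R: "R > 0" by (simp add: R_def speed_factor_def add_pos_nonneg)
  obtain b where b: "b absolutely_integrable_on {0..T}"
    "\<And>t x p. t \<in> {0..T} \<Longrightarrow> norm x \<le> R \<Longrightarrow> norm p \<le> 0 \<Longrightarrow> \<bar>H t x p\<bar> \<le> b t"
    by (rule H_bound[OF R, of 0]) auto
  have "\<exists>z\<in>cball 0 R. \<forall>y\<in>cball 0 R. g z \<le> g y"
    using R by (intro continuous_attains_inf continuous_on_subset[OF g]) auto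
  then obtain z where z: "\<And>x. x \<in> cball 0 R \<Longrightarrow> g z \<le> g x" by blast
  have bs: "b integrable_on {s..T}"
    using s by (intro abs_int_imp_integrable abs_int_subinterval[OF b(1)]) auto
  have "\<not> value_fun H g T s x0 < ereal (g z - integral {s..T} b)"
  proof
    assume "value_fun H g T s x0 < ereal (g z - integral {s..T} b)"
    then obtain x v r where a: "arc s x0 x v r" and less: "g (x T) + integral {s..T} r < g z - integral {s..T} b"
      using arc_of_value_fun_less[OF s] by metis
    have xR: "norm (x t) \<le> R" if "t \<in> {s..T}" for t
      using arc_bound[OF a _ that] s by (simp add: R_def)
    have "integral {s..T} (\<lambda>t. - b t) \<le> integral {s..T} r"
    proof (rule integral_le)
      show "(\<lambda>t. - b t) integrable_on {s..T}" using bs by (rule integrable_neg)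
      show "r integrable_on {s..T}" by (rule abs_int_imp_integrable[OF arc_r[OF a]])
      fix t assume t: "t \<in> {s..T}"
      then show "- b t \<le> r t"
        using epi_conjD[OF arc_mem[OF a t], of 0] b(2)[of t "x t" 0] xR[OF t] s by auto
    qed
    moreover have "g z \<le> g (x T)" using z xR[of T] s by simp
    ultimately show False using less by simp
  qed
  then show ?thesis by (metis not_less order_less_le_trans MInfty_neq_ereal(1) ereal_infty_less(2))
qed

text \<open>The reference curve for Filippov starts at \<open>\<xi> n\<close> at time
  \<open>s n\<close>, rests until \<open>t0\<close> if it starts earlier, and then moves with the
  velocity of the given arc. Its defect integrates to at most \<open>\<Gamma> n\<close>, which tends
  to 0.\<close>

lemma value_fun_upper_semicontinuous:
  fixes s :: "nat \<Rightarrow> real" and \<xi> :: "nat \<Rightarrow> 'a"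
  assumes g: "continuous_on UNIV g" and t0: "t0 \<in> {0..T}" and s: "\<And>n. s n \<in> {0..T}"
    and s_lim: "s \<longlonglongrightarrow> t0" and \<xi>_lim: "\<xi> \<longlonglongrightarrow> x0"
    and less: "value_fun H g T t0 x0 < ereal \<alpha>"
  shows "\<forall>\<^sub>F n in sequentially. value_fun H g T (s n) (\<xi> n) < ereal \<alpha>"
proof -
  obtain x v r where a: "arc t0 x0 x v r" and cost: "g (x T) + integral {t0..T} r < \<alpha>"
    using arc_of_value_fun_less[OF t0 less] by metis
  define v' where "v' t = (if t0 \<le> t then v t else 0)" for t
  define r' where "r' t = (if t0 \<le> t then r t else 0)" for t
  define F where "F t = integral {t0..t} v" for t
  define G where "G t = integral {t0..t} r" for t
  have t00: "0 \<le> t0" using t0 by simp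
  have v': "v' absolutely_integrable_on {0..T}" and F: "integral {0..t} v' = F t" for t
    unfolding v'_def F_def using extend_zero[OF arc_v[OF a] t00] by auto
  have r': "r' absolutely_integrable_on {0..T}" and G: "integral {0..t} r' = G t" for t
    unfolding r'_def G_def using extend_zero[OF arc_r[OF a] t00] by auto
  have lim_int: "(\<lambda>n. integral {0..s n} f) \<longlonglongrightarrow> integral {0..t0} f" if "f absolutely_integrable_on {0..T}"
    for f :: "real \<Rightarrow> 'b::euclidean_space"
    by (rule continuous_on_tendsto_compose[OF continuous_on_integral[OF that] s_lim t0]) (use s in auto)
  have F0: "F t = 0" and G0: "G t = 0" if "t \<le> t0" for t
    using that by (cases "t = t0"; simp add: F_def G_def)+
  have F_lim: "(\<lambda>n. F (s n)) \<longlonglongrightarrow> 0" and G_lim: "(\<lambda>n. G (s n)) \<longlonglongrightarrow> 0"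
    using lim_int[OF v'] lim_int[OF r'] F0[of t0] G0[of t0] by (auto simp: F G)
  \<comment> \<open>After \<open>t0\<close> the reference curve stays within this distance of
    \<open>x\<close>. The term with \<open>F\<close> is the displacement of \<open>x\<close> that a
    late start misses.\<close>
  define \<eta> where "\<eta> n = norm (\<xi> n - x0) + norm (F (s n))" for n
  have \<eta>_lim: "\<eta> \<longlonglongrightarrow> 0"
  proof -
    have "(\<lambda>n. norm (\<xi> n - x0) + norm (F (s n))) \<longlonglongrightarrow> norm (x0 - x0) + norm (0::'a)"
      by (intro tendsto_intros \<xi>_lim F_lim)
    then show ?thesis by (simp add: \<eta>_def[abs_def])
  qed
  \<comment> \<open>The a priori bound for \<open>x\<close>, plus 1 for the deviation of the
    reference curve once \<open>\<eta> n \<le> 1\<close>.\<close>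
  define M where "M = 2 * (1 + norm x0) * speed_factor + 1"
  have sf1: "1 \<le> speed_factor" using integral_c_le[of T T] t0 by simp
  have M0: "1 + norm x0 \<le> M - 1"
  proof -
    have "(1 + norm x0) * 1 \<le> (1 + norm x0) * (2 * speed_factor)" using sf1 by (intro mult_left_mono) auto
    then show ?thesis by (simp add: M_def algebra_simps)
  qed
  then have M1: "1 \<le> M" "M > 0" using norm_ge_zero[of x0] by linarith+
  obtain \<kappa> where \<kappa>: "\<kappa> absolutely_integrable_on {0..T}" "\<And>t. t \<in> {0..T} \<Longrightarrow> 0 \<le> \<kappa> t"
    and \<kappa>d: "\<And>t x y a. \<lbrakk>t \<in> {0..T}; norm x \<le> M; norm y \<le> M; a \<in> epi_conj (H t x)\<rbrakk> \<Longrightarrow>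
       dist a (closest_point (epi_conj (H t y)) a) \<le> \<kappa> t * norm (x - y)"
    using epi_dist_le[OF M1(2)] by metis
  obtain b where b: "b absolutely_integrable_on {0..T}" "\<And>t. t \<in> {0..T} \<Longrightarrow> 0 \<le> b t"
    "\<And>t x p. t \<in> {0..T} \<Longrightarrow> norm x \<le> M \<Longrightarrow> norm p \<le> 0 \<Longrightarrow> \<bar>H t x p\<bar> \<le> b t"
    by (rule H_bound[OF M1(2), of 0]) auto
  obtain K where K0: "0 \<le> K" and K: "\<And>s x1 v r \<gamma>. \<lbrakk>s \<in> {0..T}; v absolutely_integrable_on {s..T}; r absolutely_integrable_on {s..T};
        \<gamma> absolutely_integrable_on {s..T};
        \<And>t. t \<in> {s..T} \<Longrightarrow> 1 + norm (x1 + integral {s..t} v) \<le> M;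
        \<And>t. t \<in> {s..T} \<Longrightarrow>
          dist (v t, r t) (closest_point (epi_conj (H t (x1 + integral {s..t} v))) (v t, r t)) \<le> \<gamma> t\<rbrakk> \<Longrightarrow>
      \<exists>y w q. arc s x1 y w q \<and> norm (y T - (x1 + integral {s..T} v)) \<le> K * integral {s..T} \<gamma> \<and>
        \<bar>integral {s..T} q - integral {s..T} r\<bar> \<le> K * integral {s..T} \<gamma>"
    using filippov[OF M1(1)] by metis
  define B where "B t = c t * (1 + M) + b t" for t
  have B: "B absolutely_integrable_on {0..T}"
    unfolding B_def by (intro set_integral_add(1) set_integrable_mult_left c_int b(1)) auto
  \<comment> \<open>The defect of resting: equal to \<open>B\<close> before \<open>t0\<close> and
    zero afterwards. Its integral from \<open>s n\<close> to \<open>T\<close> is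
    \<open>X t0 - X (s n)\<close>, for early and late starts alike.\<close>
  define \<psi> where "\<psi> t = B t - (if t0 \<le> t then B t else 0)" for t
  have \<psi>: "\<psi> absolutely_integrable_on {0..T}"
    unfolding \<psi>_def using t0
    by (intro set_integral_diff(1) B extend_zero(1)[OF abs_int_subinterval[OF B]]) auto
  define X where "X t = integral {0..t} \<psi>" for t
  have X_T: "X T = X t0"
  proof -
    have "X T - X t0 = integral {t0..T} \<psi>"
      unfolding X_def using t0 by (intro integral_split[OF \<psi>]) auto
    also have "\<dots> = integral {t0..T} (\<lambda>_. 0)" by (intro integral_cong) (auto simp: \<psi>_def)
    finally show ?thesis by simp
  qed
  have X_lim: "(\<lambda>n. X (s n)) \<longlonglongrightarrow> X t0" unfolding X_def by (rule lim_int[OF \<psi>])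
  define \<Gamma> where "\<Gamma> n = \<eta> n * integral {0..T} \<kappa> + (X t0 - X (s n))" for n
  have \<Gamma>_lim: "\<Gamma> \<longlonglongrightarrow> 0"
  proof -
    have "(\<lambda>n. \<eta> n * integral {0..T} \<kappa> + (X t0 - X (s n))) \<longlonglongrightarrow> 0 * integral {0..T} \<kappa> + (X t0 - X t0)"
      by (intro tendsto_intros \<eta>_lim X_lim)
    then show ?thesis by (simp add: \<Gamma>_def[abs_def])
  qed
  have near: "\<exists>y w q. arc (s n) (\<xi> n) y w q \<and> norm (y T - x T) \<le> K * \<Gamma> n + \<eta> n \<and>
      integral {s n..T} q \<le> integral {t0..T} r - G (s n) + K * \<Gamma> n" if \<eta>1: "\<eta> n \<le> 1" for n
  proof -
    define \<gamma> where "\<gamma> t = \<kappa> t * \<eta> n + \<psi> t" for t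
    have sn: "0 \<le> s n" "s n \<le> T" using s[of n] by auto
    have \<gamma>i: "\<gamma> absolutely_integrable_on {0..T}"
      unfolding \<gamma>_def by (intro set_integral_add(1) set_integrable_mult_left \<kappa> \<psi>)
    have y0: "\<xi> n + integral {s n..t} v' = \<xi> n + (F t - F (s n))" if "t \<in> {s n..T}" for t
      using integral_split[OF v', of "s n" t] that sn by (simp add: F)
    have \<eta>n: "norm (\<xi> n - x0) \<le> \<eta> n" by (simp add: \<eta>_def)
    have xT: "x t - (\<xi> n + (F t - F (s n))) = - (\<xi> n - x0) + F (s n)" if "t0 \<le> t" "t \<le> T" for t
      using arc_x[OF a, of t] that by (simp add: F_def)
    have diff: "norm (x t - (\<xi> n + (F t - F (s n)))) \<le> \<eta> n" if "t0 \<le> t" "t \<le> T" for t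
      unfolding xT[OF that] \<eta>_def using norm_triangle_ineq[of "- (\<xi> n - x0)" "F (s n)"]
      by (simp only: norm_minus_cancel)
    have xM: "1 + norm (x t) \<le> M - 1" if "t0 \<le> t" "t \<le> T" for t
      using arc_bound[OF a t00, of t] that by (simp add: M_def)
    have \<xi>M: "1 + norm (\<xi> n) \<le> M"
      using \<eta>n \<eta>1 M0 norm_triangle_ineq2[of "\<xi> n" x0] by linarith
    have yM: "1 + norm (\<xi> n + integral {s n..t} v') \<le> M" if t: "t \<in> {s n..T}" for t
    proof (cases "t0 \<le> t")
      case True
      then show ?thesis
        using xM[of t] diff[of t] \<eta>1 t norm_triangle_ineq2[of "\<xi> n + (F t - F (s n))" "x t"]
        by (simp add: y0[OF t] norm_minus_commute)
    next
      case False
      then show ?thesis using \<xi>M t by (simp add: y0[OF t] F0)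
    qed
    have "\<exists>y w q. arc (s n) (\<xi> n) y w q \<and> norm (y T - (\<xi> n + integral {s n..T} v')) \<le> K * integral {s n..T} \<gamma> \<and>
        \<bar>integral {s n..T} q - integral {s n..T} r'\<bar> \<le> K * integral {s n..T} \<gamma>"
    proof (rule K[OF s _ _ _ yM])
      fix t assume t: "t \<in> {s n..T}"
      then have tT: "t \<in> {0..T}" using sn by auto
      show "dist (v' t, r' t) (closest_point (epi_conj (H t (\<xi> n + integral {s n..t} v'))) (v' t, r' t)) \<le> \<gamma> t"
      proof (cases "t0 \<le> t")
        case True
        have "dist (v t, r t) (closest_point (epi_conj (H t (\<xi> n + integral {s n..t} v'))) (v t, r t))
            \<le> \<kappa> t * norm (x t - (\<xi> n + integral {s n..t} v'))"
          using True t xM[of t] yM[OF t] by (intro \<kappa>d[OF tT] arc_mem[OF a]) auto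
        also have "\<dots> \<le> \<kappa> t * \<eta> n"
          unfolding y0[OF t] using True t by (intro mult_left_mono diff \<kappa>(2) tT) auto
        finally show ?thesis using True by (simp add: v'_def r'_def \<gamma>_def \<psi>_def)
      next
        case False
        have eq: "\<xi> n + integral {s n..t} v' = \<xi> n" using False t by (simp add: y0[OF t] F0)
        have "dist (0, 0) (closest_point (epi_conj (H t (\<xi> n))) (0, 0)) \<le> c t * (1 + norm (\<xi> n)) + \<bar>H t (\<xi> n) 0\<bar>"
          by (rule epi_dist_zero_le[OF tT])
        also have "\<dots> \<le> B t"
          unfolding B_def using \<xi>M H4_nonneg[OF tT] by (intro add_mono mult_left_mono b(3)[OF tT]) auto
        also have "\<dots> \<le> \<gamma> t" using False \<kappa>(2)[OF tT] by (simp add: \<gamma>_def \<psi>_def \<eta>_def)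
        finally show ?thesis unfolding eq using False by (simp add: v'_def r'_def)
      qed
    qed (use sn in \<open>auto intro: abs_int_subinterval[OF v'] abs_int_subinterval[OF r'] abs_int_subinterval[OF \<gamma>i]\<close>)
    then obtain y w q where arc: "arc (s n) (\<xi> n) y w q"
      and yT: "norm (y T - (\<xi> n + integral {s n..T} v')) \<le> K * integral {s n..T} \<gamma>"
      and q: "\<bar>integral {s n..T} q - integral {s n..T} r'\<bar> \<le> K * integral {s n..T} \<gamma>" by blast
    have "integral {s n..T} \<gamma> \<le> \<Gamma> n"
    proof -
      have "integral {s n..T} \<gamma> = integral {s n..T} (\<lambda>t. \<kappa> t * \<eta> n) + integral {s n..T} \<psi>"
        unfolding \<gamma>_def using sn
        by (intro Henstock_Kurzweil_Integration.integral_add abs_int_imp_integrable set_integrable_mult_left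
            abs_int_subinterval[OF \<psi>] abs_int_subinterval[OF \<kappa>(1)]) auto
      also have "integral {s n..T} (\<lambda>t. \<kappa> t * \<eta> n) = \<eta> n * integral {s n..T} \<kappa>"
        by (simp add: mult.commute)
      also have "integral {s n..T} \<psi> = X t0 - X (s n)"
        using X_T integral_split[OF \<psi>, of "s n" T] sn by (simp add: X_def)
      also have "\<eta> n * integral {s n..T} \<kappa> \<le> \<eta> n * integral {0..T} \<kappa>"
        using sn \<kappa>(2) by (intro mult_left_mono integral_subset_le abs_int_imp_integrable
            abs_int_subinterval[OF \<kappa>(1)]) (auto simp: \<eta>_def)
      finally show ?thesis by (simp add: \<Gamma>_def)
    qed
    then have K\<Gamma>: "K * integral {s n..T} \<gamma> \<le> K * \<Gamma> n" using K0 by (rule mult_left_mono)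
    have TT: "T \<in> {s n..T}" using sn by auto
    have "norm (y T - x T) \<le> norm (y T - (\<xi> n + integral {s n..T} v')) + norm (x T - (\<xi> n + (F T - F (s n))))"
      using norm_triangle_sub[of "y T - x T" "y T - (\<xi> n + integral {s n..T} v')"]
        norm_triangle_ineq4[of "y T - (\<xi> n + (F T - F (s n)))" "x T - (\<xi> n + (F T - F (s n)))"]
      by (simp add: y0[OF TT])
    then have 1: "norm (y T - x T) \<le> K * \<Gamma> n + \<eta> n"
      using yT K\<Gamma> diff[of T] t0 by auto
    have "integral {s n..T} r' = integral {t0..T} r - G (s n)"
      using integral_split[OF r', of "s n" T] sn by (simp add: G G_def)
    then have 2: "integral {s n..T} q \<le> integral {t0..T} r - G (s n) + K * \<Gamma> n"
      using q K\<Gamma> by linarith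
    from arc 1 2 show ?thesis by blast
  qed
  \<comment> \<open>Half of the gap is spent on \<open>g\<close>, half on the running cost.\<close>
  define \<epsilon> where "\<epsilon> = (\<alpha> - (g (x T) + integral {t0..T} r)) / 2"
  have \<epsilon>: "\<epsilon> > 0" using cost by (simp add: \<epsilon>_def)
  obtain \<delta> where \<delta>: "\<delta> > 0" "\<And>z. dist z (x T) < \<delta> \<Longrightarrow> dist (g z) (g (x T)) < \<epsilon>"
    using g \<epsilon> unfolding continuous_on_iff by (metis UNIV_I)
  have "(\<lambda>n. K * \<Gamma> n + \<eta> n) \<longlonglongrightarrow> K * 0 + 0" by (intro tendsto_intros \<Gamma>_lim \<eta>_lim)
  then have e1: "\<forall>\<^sub>F n in sequentially. K * \<Gamma> n + \<eta> n < \<delta>" using \<delta>(1) by (intro order_tendstoD(2)) auto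
  have "(\<lambda>n. - G (s n) + K * \<Gamma> n) \<longlonglongrightarrow> - 0 + K * 0" by (intro tendsto_intros \<Gamma>_lim G_lim)
  then have e2: "\<forall>\<^sub>F n in sequentially. - G (s n) + K * \<Gamma> n < \<epsilon>" using \<epsilon> by (intro order_tendstoD(2)) auto
  have e3: "\<forall>\<^sub>F n in sequentially. \<eta> n < 1" by (rule order_tendstoD(2)[OF \<eta>_lim]) simp
  from e1 e2 e3 show ?thesis
  proof eventually_elim
    case (elim n)
    then obtain y w q where y: "arc (s n) (\<xi> n) y w q" "norm (y T - x T) \<le> K * \<Gamma> n + \<eta> n"
      "integral {s n..T} q \<le> integral {t0..T} r - G (s n) + K * \<Gamma> n"
      using near[of n] by auto
    have "dist (g (y T)) (g (x T)) < \<epsilon>" using y(2) elim(1) by (intro \<delta>(2)) (simp add: dist_norm)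
    then have "g (y T) < g (x T) + \<epsilon>" by (simp add: dist_real_def abs_less_iff)
    then have "g (y T) + integral {s n..T} q < g (x T) + \<epsilon> + integral {t0..T} r + \<epsilon>"
      using y(3) elim(2) by linarith
    also have "\<dots> = \<alpha>" by (simp add: \<epsilon>_def field_simps)
    finally show ?case
      using value_fun_le_arc[OF y(1) s, of g] by (simp add: le_less_trans)
  qed
qed

end

section \<open>Lower semicontinuity of the value function\<close>

text \<open>Subtracting \<open>f 0\<close> makes the sequence nonnegative. Monotone convergence
  bounds the integral of the supremum, which is thus finite off a null set.\<close>

lemma beppo_levi:
  fixes f :: "nat \<Rightarrow> real \<Rightarrow> real"
  assumes f: "\<And>m. f m absolutely_integrable_on S" and S: "S \<in> sets lebesgue"
    and mono: "\<And>m t. t \<in> S \<Longrightarrow> f m t \<le> f (Suc m) t"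
    and bnd: "\<And>m. integral S (f m) \<le> L"
  obtains r N where "negligible N" "r absolutely_integrable_on S" "integral S r \<le> L"
    "\<And>t m. t \<in> S - N \<Longrightarrow> f m t \<le> r t"
proof -
  define h where "h m t = indicator S t *\<^sub>R (f m t - f 0 t)" for m t
  have hi: "integrable lebesgue (h m)" for m
    using set_integral_diff(1)[OF f[of m] f[of 0]] unfolding h_def set_integrable_def .
  have hm: "h m \<in> borel_measurable lebesgue" for m using hi by (rule borel_measurable_integrable)
  have f0: "f 0 t \<le> f m t" if "t \<in> S" for m t
    using mono[OF that] by (induction m) (auto intro: order_trans)
  have h0: "0 \<le> h m t" for m t using f0[of t m] by (simp add: h_def indicator_def)
  have hmono: "h m t \<le> h (Suc m) t" for m t using mono[of t m] by (simp add: h_def indicator_def)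
  define G where "G t = (SUP m. ennreal (h m t))" for t
  have Gm: "G \<in> borel_measurable lebesgue" unfolding G_def using hm by measurable
  have hint: "(\<integral>\<^sup>+t. ennreal (h m t) \<partial>lebesgue) = ennreal (integral S (f m) - integral S (f 0))" for m
  proof -
    have "(\<integral>\<^sup>+t. ennreal (h m t) \<partial>lebesgue) = ennreal (LINT t|lebesgue. h m t)"
      using hi h0 by (intro nn_integral_eq_integral) auto
    also have "(LINT t|lebesgue. h m t) = (LINT t:S|lebesgue. f m t - f 0 t)"
      by (simp add: set_lebesgue_integral_def h_def)
    also have "\<dots> = integral S (f m) - integral S (f 0)"
      using f by (simp add: set_integral_diff(2) set_lebesgue_integral_eq_integral(2))
    finally show ?thesis .
  qed
  have "(\<integral>\<^sup>+t. G t \<partial>lebesgue) = (SUP m. \<integral>\<^sup>+t. ennreal (h m t) \<partial>lebesgue)"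
    unfolding G_def using hm hmono
    by (intro nn_integral_monotone_convergence_SUP) (auto intro!: incseq_SucI ennreal_leI simp: le_fun_def)
  also have "\<dots> \<le> ennreal (L - integral S (f 0))"
    unfolding hint using bnd by (intro SUP_least ennreal_leI) simp
  finally have GL: "(\<integral>\<^sup>+t. G t \<partial>lebesgue) \<le> ennreal (L - integral S (f 0))" .
  then have "(\<integral>\<^sup>+t. G t \<partial>lebesgue) \<noteq> \<infinity>" by (auto simp: top_unique)
  then have fin: "AE t in lebesgue. G t \<noteq> \<infinity>" by (rule nn_integral_PInf_AE[OF Gm])
  then obtain N where N: "N \<in> null_sets lebesgue" "\<And>t. t \<in> space lebesgue - N \<Longrightarrow> G t \<noteq> \<infinity>"
    by (rule AE_E3) blast
  define g where "g t = enn2real (G t)" for t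
  have g0: "0 \<le> g t" for t by (simp add: g_def)
  have gm: "g \<in> borel_measurable lebesgue" unfolding g_def using Gm by simp
  have gG: "(\<integral>\<^sup>+t. ennreal (g t) \<partial>lebesgue) = (\<integral>\<^sup>+t. G t \<partial>lebesgue)"
    using fin by (intro nn_integral_cong_AE) (auto simp: g_def less_top[symmetric] elim!: eventually_mono)
  have gi: "integrable lebesgue g"
    using gm GL gG by (intro integrableI_nonneg) (auto simp: g_def le_less_trans)
  have gint: "(LINT t|lebesgue. g t) \<le> L - integral S (f 0)"
  proof -
    have "ennreal (LINT t|lebesgue. g t) \<le> ennreal (L - integral S (f 0))"
      using nn_integral_eq_integral[OF gi] GL gG by (simp add: g0)
    moreover have "0 \<le> L - integral S (f 0)" using bnd[of 0] by simp
    ultimately show ?thesis by (simp add: ennreal_le_iff)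
  qed
  have gS: "g absolutely_integrable_on S"
    unfolding set_integrable_def using S gi by (rule integrable_mult_indicator)
  show ?thesis
  proof (rule that[of N "\<lambda>t. f 0 t + g t"])
    show "negligible N" using N(1) by (simp add: negligible_iff_null_sets)
    show "(\<lambda>t. f 0 t + g t) absolutely_integrable_on S" using f gS by (rule set_integral_add(1))
    have "integral S g = (LINT t:S|lebesgue. g t)" using gS by (simp add: set_lebesgue_integral_eq_integral(2))
    also have "\<dots> \<le> (LINT t|lebesgue. g t)"
      unfolding set_lebesgue_integral_def using gi S
      by (intro integral_mono integrable_mult_indicator) (auto simp: indicator_def g0)
    finally show "integral S (\<lambda>t. f 0 t + g t) \<le> L"
      using gint f[of 0] gS by (simp add: Henstock_Kurzweil_Integration.integral_add abs_int_imp_integrable)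
    fix t m assume t: "t \<in> S - N"
    have "ennreal (h m t) \<le> G t" unfolding G_def by (rule SUP_upper) simp
    then have "enn2real (ennreal (h m t)) \<le> g t"
      unfolding g_def using N(2)[of t] t by (intro enn2real_mono) (auto simp: less_top[symmetric])
    then show "f m t \<le> f 0 t + g t" using h0[of m t] t by (simp add: h_def)
  qed
qed

text \<open>Splitting over the level sets of \<open>p\<close> reduces the pairing to integrals of
  \<open>u\<close> over measurable sets, where weak convergence is available.\<close>

lemma integral_inner_finite_range:
  fixes u p :: "real \<Rightarrow> 'a::euclidean_space"
  assumes u: "u absolutely_integrable_on S" and S: "S \<in> sets lebesgue"
    and p: "p \<in> borel_measurable (lebesgue_on S)" and fin: "finite (p ` S)"
  shows "integral S (\<lambda>t. u t \<bullet> p t) = (\<Sum>z\<in>p ` S. integral {t \<in> S. p t = z} u \<bullet> z)"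
    and "\<And>z. {t \<in> S. p t = z} \<in> sets lebesgue"
proof -
  show A: "{t \<in> S. p t = z} \<in> sets lebesgue" for z
  proof -
    have "p -` {z} \<inter> space (lebesgue_on S) \<in> sets (lebesgue_on S)"
      using p by (rule measurable_sets) simp
    moreover have "p -` {z} \<inter> space (lebesgue_on S) = {t \<in> S. p t = z}" by auto
    ultimately show ?thesis using S by (simp add: sets_restrict_space_iff)
  qed
  have uA: "u integrable_on {t \<in> S. p t = z}" for z
    by (rule abs_int_imp_integrable[OF set_integrable_subset[OF u A]]) auto
  have uz: "(\<lambda>t. u t \<bullet> z) integrable_on {t \<in> S. p t = z}" for z
    using integrable_linear[OF uA bounded_linear_inner_left] by (simp add: o_def)
  have sub: "{t \<in> S. p t = z} \<inter> S = {t \<in> S. p t = z}" for z by auto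
  have "integral S (\<lambda>t. u t \<bullet> p t) = integral S (\<lambda>t. \<Sum>z\<in>p ` S. if t \<in> {t \<in> S. p t = z} then u t \<bullet> z else 0)"
  proof (rule integral_cong)
    fix t assume t: "t \<in> S"
    have "(\<Sum>z\<in>p ` S. if t \<in> {t \<in> S. p t = z} then u t \<bullet> z else 0) = (\<Sum>z\<in>p ` S. if p t = z then u t \<bullet> z else 0)"
      using t by simp
    also have "\<dots> = u t \<bullet> p t" using fin t by (subst sum.delta') auto
    finally show "u t \<bullet> p t = (\<Sum>z\<in>p ` S. if t \<in> {t \<in> S. p t = z} then u t \<bullet> z else 0)" by simp
  qed
  also have "\<dots> = (\<Sum>z\<in>p ` S. integral S (\<lambda>t. if t \<in> {t \<in> S. p t = z} then u t \<bullet> z else 0))"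
  proof (rule Henstock_Kurzweil_Integration.integral_sum[OF fin])
    show "(\<lambda>t. if t \<in> {t \<in> S. p t = z} then u t \<bullet> z else 0) integrable_on S" for z
      unfolding Henstock_Kurzweil_Integration.integrable_restrict_Int sub by (rule uz)
  qed
  also have "\<dots> = (\<Sum>z\<in>p ` S. integral {t \<in> S. p t = z} u \<bullet> z)"
    unfolding Henstock_Kurzweil_Integration.integral_restrict_Int sub
    by (intro sum.cong refl integral_component_eq uA)
  finally show "integral S (\<lambda>t. u t \<bullet> p t) = (\<Sum>z\<in>p ` S. integral {t \<in> S. p t = z} u \<bullet> z)" .
qed

context hamiltonian
begin

text \<open>Weak compactness of the velocities together with \<open>r \<ge> v \<bullet> p - H t x p\<close>, tested against
  simple functions \<open>p\<close> only, so that the running costs \<open>r\<close> themselves need not converge.\<close>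

lemma arc_limit:
  fixes s :: "nat \<Rightarrow> real" and \<xi> :: "nat \<Rightarrow> 'a"
  assumes t0: "t0 \<in> {0..T}" and s: "\<And>n. s n \<in> {0..T}"
    and s_lim: "s \<longlonglongrightarrow> t0" and \<xi>_lim: "\<xi> \<longlonglongrightarrow> x0"
    and arcs: "\<And>n. arc (s n) (\<xi> n) (x n) (v n) (r n)"
  obtains k w where "strict_mono (k :: nat \<Rightarrow> nat)" "w absolutely_integrable_on {t0..T}"
    "(\<lambda>n. x (k n) T) \<longlonglongrightarrow> x0 + integral {t0..T} w"
    "\<And>p. p \<in> borel_measurable (lebesgue_on {t0..T}) \<Longrightarrow> finite (p ` {t0..T}) \<Longrightarrow>
       \<exists>J. J \<longlonglongrightarrow> integral {t0..T} (\<lambda>t. w t \<bullet> p t - H t (x0 + integral {t0..t} w) (p t)) \<and>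
         (\<forall>n. J n \<le> integral {s (k n)..T} (r (k n)))"
proof -
  have t00: "0 \<le> t0" "t0 \<le> T" using t0 by auto
  have sn: "0 \<le> s n" "s n \<le> T" for n using s[of n] by auto
  obtain \<rho> where \<rho>: "0 < \<rho>" "\<And>n. norm (\<xi> n) \<le> \<rho>"
    using convergent_imp_Bseq[OF convergentI[OF \<xi>_lim]] by (auto elim: BseqE)
  define R where "R = 2 * (1 + \<rho>) * speed_factor"
  have sf1: "1 \<le> speed_factor" using integral_c_le[of T T] t0 by simp
  have \<rho>R: "\<rho> \<le> R"
  proof -
    have "(1 + \<rho>) * 1 \<le> (1 + \<rho>) * (2 * speed_factor)" using sf1 \<rho>(1) by (intro mult_left_mono) auto
    also have "\<dots> = R" by (simp add: R_def)
    finally show ?thesis by simp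
  qed
  then have R0: "R > 0" using \<rho>(1) by linarith
  have xR: "norm (x n t) \<le> R" if "t \<in> {s n..T}" for n t
  proof -
    have "1 + norm (x n t) \<le> 2 * (1 + norm (\<xi> n)) * speed_factor" by (rule arc_bound[OF arcs sn(1) that])
    also have "\<dots> \<le> R" unfolding R_def using sf1 \<rho>(2)[of n] by (intro mult_right_mono) auto
    finally show ?thesis by simp
  qed
  define v' where "v' n t = (if s n \<le> t then v n t else 0)" for n t
  define r' where "r' n t = (if s n \<le> t then r n t else 0)" for n t
  \<comment> \<open>The curve \<open>x n\<close>, continued by the constant \<open>\<xi> n\<close>
    before its initial time.\<close>
  define Z where "Z n t = \<xi> n + integral {0..t} (v' n)" for n t
  have v': "v' n absolutely_integrable_on {0..T}" and v'_int: "integral {0..t} (v' n) = integral {s n..t} (v n)" for n t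
    unfolding v'_def using extend_zero[OF arc_v[OF arcs[of n]] sn(1)] by auto
  have r': "r' n absolutely_integrable_on {0..T}" and r'_int: "integral {0..t} (r' n) = integral {s n..t} (r n)" for n t
    unfolding r'_def using extend_zero[OF arc_r[OF arcs[of n]] sn(1)] by auto
  have Zx: "Z n t = x n t" if "t \<in> {s n..T}" for n t
    using arc_x[OF arcs that] by (simp add: Z_def v'_int)
  have Z\<xi>: "Z n t = \<xi> n" if "t \<le> s n" for n t
    using that by (cases "t = s n") (simp_all add: Z_def v'_int)
  have ZR: "norm (Z n t) \<le> R" if "t \<in> {0..T}" for n t
  proof (cases "s n \<le> t")
    case True
    then show ?thesis using xR[of t n] Zx[of t n] that by simp
  next
    case False
    then show ?thesis using Z\<xi>[of t n] \<rho>(2)[of n] \<rho>R by simp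
  qed
  define C where "C t = c t * (1 + R)" for t
  have C: "C absolutely_integrable_on {0..T}"
    unfolding C_def by (intro set_integrable_mult_left c_int) auto
  have v'C: "norm (v' n t) \<le> C t" if t: "t \<in> {0..T}" for n t
  proof (cases "s n \<le> t")
    case True
    then have "norm (v n t) \<le> c t * (1 + norm (x n t))"
      using speed_le[OF t arc_mem[OF arcs, of t n]] t by simp
    also have "\<dots> \<le> C t"
      unfolding C_def using xR[of t n] True t H4_nonneg[OF t] by (intro mult_left_mono) auto
    finally show ?thesis using True by (simp add: v'_def)
  next
    case False
    then show ?thesis using H4_nonneg[OF t] R0 by (simp add: v'_def C_def)
  qed
  \<comment> \<open>A common modulus of continuity for all \<open>Z n\<close>, as required for
    Arzela-Ascoli.\<close>
  define D where "D t = integral {0..t} C" for t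
  have D_cont: "continuous_on {0..T} D" unfolding D_def by (rule continuous_on_integral[OF C])
  have ZD_le: "norm (Z n t - Z n \<tau>) \<le> \<bar>D t - D \<tau>\<bar>" if "0 \<le> \<tau>" "\<tau> \<le> t" "t \<le> T" for n t \<tau>
  proof -
    have "Z n t - Z n \<tau> = integral {\<tau>..t} (v' n)"
      unfolding Z_def using integral_split[OF v' that] by simp
    also have "norm \<dots> \<le> integral {\<tau>..t} C"
      using that v'C by (intro integral_norm_bound_integral abs_int_imp_integrable
          abs_int_subinterval[OF v'] abs_int_subinterval[OF C]) auto
    also have "\<dots> = D t - D \<tau>" unfolding D_def using integral_split[OF C that] by simp
    finally show ?thesis by simp
  qed
  have ZD: "norm (Z n t - Z n \<tau>) \<le> \<bar>D t - D \<tau>\<bar>" if "t \<in> {0..T}" "\<tau> \<in> {0..T}" for n t \<tau>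
    using ZD_le[of \<tau> t n] ZD_le[of t \<tau> n] that
    by (cases "\<tau> \<le> t") (auto simp: norm_minus_commute abs_minus_commute)
  obtain z k where k: "strict_mono (k :: nat \<Rightarrow> nat)"
    and zu: "\<And>e. 0 < e \<Longrightarrow> \<exists>N. \<forall>n t. N \<le> n \<and> t \<in> {0..T} \<longrightarrow> norm (Z (k n) t - z t) < e"
  proof (rule Arzela_Ascoli[where S = "{0..T}" and \<F> = Z and M = R])
    show "norm (Z n t) \<le> R" if "t \<in> {0..T}" for n t by (rule ZR[OF that])
    fix t and e :: real assume t: "t \<in> {0..T}" and e: "0 < e"
    obtain d where d: "d > 0" "\<And>\<tau>. \<tau> \<in> {0..T} \<Longrightarrow> dist \<tau> t < d \<Longrightarrow> dist (D \<tau>) (D t) < e"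
      using D_cont t e unfolding continuous_on_iff by metis
    show "\<exists>d>0. \<forall>n \<tau>. \<tau> \<in> {0..T} \<and> norm (t - \<tau>) < d \<longrightarrow> norm (Z n t - Z n \<tau>) < e"
    proof (intro exI[of _ d] conjI d(1) allI impI)
      fix n \<tau> assume \<tau>: "\<tau> \<in> {0..T} \<and> norm (t - \<tau>) < d"
      then have "\<bar>D t - D \<tau>\<bar> < e" using d(2)[of \<tau>] by (simp add: dist_real_def abs_minus_commute)
      then show "norm (Z n t - Z n \<tau>) < e" using ZD[OF t, of \<tau> n] \<tau> by simp
    qed
  qed auto
  have zlim: "(\<lambda>n. Z (k n) t) \<longlonglongrightarrow> z t" if "t \<in> {0..T}" for t
    using zu that unfolding LIMSEQ_iff by blast
  have \<xi>k: "(\<lambda>n. \<xi> (k n)) \<longlonglongrightarrow> x0" using LIMSEQ_subseq_LIMSEQ[OF \<xi>_lim k] by (simp add: o_def)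
  have sk: "(\<lambda>n. s (k n)) \<longlonglongrightarrow> t0" using LIMSEQ_subseq_LIMSEQ[OF s_lim k] by (simp add: o_def)
  have conv: "convergent (\<lambda>n. integral {0..t} (v' (k n)))" if "t \<in> {0..T}" for t
  proof -
    have "(\<lambda>n. Z (k n) t - \<xi> (k n)) \<longlonglongrightarrow> z t - x0" by (intro tendsto_diff zlim that \<xi>k)
    then show ?thesis by (auto simp: Z_def convergent_def)
  qed
  obtain w where w: "w absolutely_integrable_on {0..T}"
    and wlim: "\<And>A. A \<in> sets lebesgue \<Longrightarrow> A \<subseteq> {0..T} \<Longrightarrow> (\<lambda>n. integral A (v' (k n))) \<longlonglongrightarrow> integral A w"
    using weak_limit[where v = "\<lambda>n. v' (k n)", OF v' C v'C conv] by metis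
  have zw: "z t = x0 + integral {0..t} w" if t: "t \<in> {0..T}" for t
  proof -
    have "(\<lambda>n. Z (k n) t) \<longlonglongrightarrow> x0 + integral {0..t} w"
      unfolding Z_def using t by (intro tendsto_add \<xi>k wlim) auto
    then show ?thesis using zlim[OF t] LIMSEQ_unique by blast
  qed
  have D_lim: "(\<lambda>n. D (s (k n))) \<longlonglongrightarrow> D t0"
    by (rule continuous_on_tendsto_compose[OF D_cont sk t0]) (use s in auto)
  \<comment> \<open>The initial value is taken at the moving time \<open>s (k n)\<close>; the common
    modulus transfers it to \<open>t0\<close>.\<close>
  have "(\<lambda>n. Z (k n) t0 - \<xi> (k n)) \<longlonglongrightarrow> 0"
  proof (rule Lim_null_comparison)
    show "\<forall>\<^sub>F n in sequentially. norm (Z (k n) t0 - \<xi> (k n)) \<le> \<bar>D t0 - D (s (k n))\<bar>"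
      using ZD[OF t0 s] Z\<xi>[OF order_refl] by (intro always_eventually allI) metis
    have "(\<lambda>n. \<bar>D t0 - D (s (k n))\<bar>) \<longlonglongrightarrow> \<bar>D t0 - D t0\<bar>" by (intro tendsto_intros D_lim)
    then show "(\<lambda>n. \<bar>D t0 - D (s (k n))\<bar>) \<longlonglongrightarrow> 0" by simp
  qed
  from tendsto_add[OF this \<xi>k] have "z t0 = x0" using LIMSEQ_unique[OF zlim[OF t0]] by simp
  then have w0: "integral {0..t0} w = 0" using zw[OF t0] by simp
  have zt: "z t = x0 + integral {t0..t} w" if t: "t \<in> {t0..T}" for t
    using integral_split[OF w, of t0 t] t t00 zw[of t] w0 by simp
  show ?thesis
  proof (rule that[OF k])
    show wt: "w absolutely_integrable_on {t0..T}" using t00 by (intro abs_int_subinterval[OF w]) auto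
    have "x (k n) T = Z (k n) T" for n using Zx[of T "k n"] sn by simp
    then show "(\<lambda>n. x (k n) T) \<longlonglongrightarrow> x0 + integral {t0..T} w"
      using zlim[of T] zt[of T] t00 by simp
    fix p :: "real \<Rightarrow> 'a"
    assume p: "p \<in> borel_measurable (lebesgue_on {t0..T})" and fin: "finite (p ` {t0..T})"
    define P where "P = Max (insert 0 (norm ` p ` {t0..T}))"
    have P: "norm (p t) \<le> P" if "t \<in> {t0..T}" for t
      unfolding P_def using fin that by (intro Max_ge) auto
    have P0: "0 \<le> P" unfolding P_def using fin by (intro Max_ge) auto
    obtain b where b: "b absolutely_integrable_on {0..T}" "\<And>t. t \<in> {0..T} \<Longrightarrow> 0 \<le> b t"
      "\<And>t x p. t \<in> {0..T} \<Longrightarrow> norm x \<le> R \<Longrightarrow> norm p \<le> P \<Longrightarrow> \<bar>H t x p\<bar> \<le> b t"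
      by (rule H_bound[OF R0, of P]) auto
    define B where "B t = integral {0..t} b" for t
    have ts: "t \<in> {0..T}" if "t \<in> {t0..T}" for t using that t00 by auto
    define \<psi> where "\<psi> n t = v' n t \<bullet> p t - H t (Z n t) (p t)" for n t
    have Z_cont: "continuous_on {0..T} (Z n)" for n
      unfolding Z_def by (intro continuous_intros continuous_on_integral v')
    have Zm: "Z n \<in> borel_measurable (lebesgue_on {t0..T})" for n
      using t00 by (intro continuous_imp_measurable_on_sets_lebesgue continuous_on_subset[OF Z_cont]) auto
    have v't: "v' n absolutely_integrable_on {t0..T}" for n using t00 by (intro abs_int_subinterval[OF v']) auto
    have inner_int: "(\<lambda>t. u t \<bullet> p t) absolutely_integrable_on {t0..T}" if u: "u absolutely_integrable_on {t0..T}" for u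
    proof (rule measurable_bounded_by_integrable_imp_absolutely_integrable)
      show "(\<lambda>t. u t \<bullet> p t) \<in> borel_measurable (lebesgue_on {t0..T})"
        using absolutely_integrable_imp_borel_measurable[OF u] p by (intro borel_measurable_inner) auto
      show "(\<lambda>t. norm (u t) * P) integrable_on {t0..T}"
        using absolutely_integrable_norm[OF u]
        by (intro abs_int_imp_integrable set_integrable_mult_left) (auto simp: o_def)
      show "norm (u t \<bullet> p t) \<le> norm (u t) * P" if "t \<in> {t0..T}" for t
        using Cauchy_Schwarz_ineq2[of "u t" "p t"] mult_left_mono[OF P[OF that], of "norm (u t)"] by simp
    qed simp
    have H_int: "(\<lambda>t. H t (Z n t) (p t)) absolutely_integrable_on {t0..T}" for n
      using ZR ts P by (intro H_abs_int[OF t00(1) Zm p, where R = R and P = P]) auto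
    have \<psi>_int: "\<psi> n absolutely_integrable_on {t0..T}" for n
      unfolding \<psi>_def by (intro set_integral_diff(1) inner_int v't H_int)
    \<comment> \<open>Between \<open>s n\<close> and \<open>t0\<close> only one of the two
      integrands is present. There the mismatch is at most \<open>b\<close>, whose integral is
      \<open>\<bar>B (s n) - B t0\<bar>\<close>; elsewhere the epigraph inequality compares them
      directly.\<close>
    have ineq: "integral {t0..T} (\<psi> n) - \<bar>B (s n) - B t0\<bar> \<le> integral {s n..T} (r n)" for n
    proof -
      define lo hi where "lo = min (s n) t0" and "hi = max (s n) t0"
      have lh: "0 \<le> lo" "lo \<le> hi" "hi \<le> T" using sn[of n] t00 by (auto simp: lo_def hi_def)
      define e where "e t = (if t \<in> {lo..hi} then b t else 0)" for t
      have sub: "{lo..hi} \<inter> {0..T} = {lo..hi}" using lh by auto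
      have bl: "b integrable_on {lo..hi}" using lh by (intro abs_int_imp_integrable abs_int_subinterval[OF b(1)]) auto
      have e_int: "e integrable_on {0..T}"
        unfolding e_def Henstock_Kurzweil_Integration.integrable_restrict_Int sub by (rule bl)
      have "integral {0..T} e = integral {lo..hi} b"
        unfolding e_def Henstock_Kurzweil_Integration.integral_restrict_Int sub ..
      also have "\<dots> = B hi - B lo" unfolding B_def using integral_split[OF b(1) lh] by simp
      also have "\<dots> \<le> \<bar>B (s n) - B t0\<bar>" by (auto simp: lo_def hi_def min_def max_def)
      finally have e_le: "integral {0..T} e \<le> \<bar>B (s n) - B t0\<bar>" .
      define \<phi> where "\<phi> t = (if t0 \<le> t then \<psi> n t else 0)" for t
      have \<phi>: "\<phi> absolutely_integrable_on {0..T}" "integral {0..T} \<phi> = integral {t0..T} (\<psi> n)"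
        unfolding \<phi>_def using extend_zero[OF \<psi>_int t00(1)] by auto
      have "integral {0..T} (\<lambda>t. \<phi> t - e t) \<le> integral {0..T} (r' n)"
      proof (rule integral_le)
        show "(\<lambda>t. \<phi> t - e t) integrable_on {0..T}"
          using abs_int_imp_integrable[OF \<phi>(1)] e_int by (rule integrable_diff)
        show "r' n integrable_on {0..T}" by (rule abs_int_imp_integrable[OF r'])
        fix t assume t: "t \<in> {0..T}"
        show "\<phi> t - e t \<le> r' n t"
        proof (cases "s n \<le> t"; cases "t0 \<le> t")
          assume st: "s n \<le> t" "t0 \<le> t"
          then have "v n t \<bullet> p t - r n t \<le> H t (x n t) (p t)"
            using epi_conjD[OF arc_mem[OF arcs, of t n], of "p t"] t by simp
          moreover have "0 \<le> e t" using b(2)[OF t] by (simp add: e_def)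
          ultimately show ?thesis using st Zx[of t n] t by (simp add: \<phi>_def \<psi>_def v'_def r'_def)
        next
          assume st: "s n \<le> t" "\<not> t0 \<le> t"
          then have "- r n t \<le> H t (x n t) 0"
            using epi_conjD[OF arc_mem[OF arcs, of t n], of 0] t by simp
          moreover have "H t (x n t) 0 \<le> b t" using b(3)[OF t, of "x n t" 0] xR[of t n] st t P0 by auto
          moreover have "e t = b t" using st by (simp add: e_def lo_def hi_def)
          ultimately show ?thesis using st by (simp add: \<phi>_def r'_def)
        next
          assume st: "\<not> s n \<le> t" "t0 \<le> t"
          then have "- H t (Z n t) (p t) \<le> b t" using b(3)[OF t ZR[OF t, of n], of "p t"] P[of t] t by auto
          moreover have "e t = b t" using st by (simp add: e_def lo_def hi_def)
          ultimately show ?thesis using st by (simp add: \<phi>_def \<psi>_def r'_def v'_def)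
        next
          assume st: "\<not> s n \<le> t" "\<not> t0 \<le> t"
          then show ?thesis using b(2)[OF t] by (simp add: \<phi>_def r'_def e_def)
        qed
      qed
      moreover have "integral {0..T} (\<lambda>t. \<phi> t - e t) = integral {t0..T} (\<psi> n) - integral {0..T} e"
        using abs_int_imp_integrable[OF \<phi>(1)] e_int \<phi>(2) by (simp add: Henstock_Kurzweil_Integration.integral_diff)
      ultimately show ?thesis using e_le by (simp add: r'_int)
    qed
    have lim1: "(\<lambda>n. integral {t0..T} (\<lambda>t. v' (k n) t \<bullet> p t)) \<longlonglongrightarrow> integral {t0..T} (\<lambda>t. w t \<bullet> p t)"
    proof -
      have "{t \<in> {t0..T}. p t = z} \<subseteq> {0..T}" for z using t00 by auto
      then show ?thesis
        using integral_inner_finite_range[OF v't _ p fin] integral_inner_finite_range[OF wt _ p fin]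
        by (simp del: atLeastAtMost_iff) (intro tendsto_intros wlim, auto)
    qed
    have lim2: "(\<lambda>n. integral {t0..T} (\<lambda>t. H t (Z (k n) t) (p t))) \<longlonglongrightarrow> integral {t0..T} (\<lambda>t. H t (z t) (p t))"
    proof (rule dominated_convergence(2)[where h = b])
      show "(\<lambda>t. H t (Z (k n) t) (p t)) integrable_on {t0..T}" for n by (rule abs_int_imp_integrable[OF H_int])
      show "b integrable_on {t0..T}" using t00 by (intro abs_int_imp_integrable abs_int_subinterval[OF b(1)]) auto
      fix t assume t: "t \<in> {t0..T}"
      show "norm (H t (Z (k n) t) (p t)) \<le> b t" for n
        using b(3)[OF ts[OF t] ZR[OF ts[OF t]] P[OF t]] by simp
      have "isCont (\<lambda>x. H t x (p t)) (z t)"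
        using H_cont_x[OF ts[OF t], of "p t"] by (simp add: continuous_on_eq_continuous_at)
      then show "(\<lambda>n. H t (Z (k n) t) (p t)) \<longlonglongrightarrow> H t (z t) (p t)"
        using zlim[OF ts[OF t]] by (rule isCont_tendsto_compose)
    qed
    have z_cont: "continuous_on {t0..T} z"
    proof -
      have "continuous_on {t0..T} (\<lambda>t. x0 + integral {t0..t} w)"
        by (intro continuous_intros continuous_on_integral wt)
      then show ?thesis using zt continuous_on_cong by (metis (no_types, lifting))
    qed
    have zR: "norm (z t) \<le> R" if "t \<in> {0..T}" for t
      by (rule LIMSEQ_le_const2[OF tendsto_norm[OF zlim[OF that]]]) (use ZR[OF that] in blast)
    have Hz_int: "(\<lambda>t. H t (z t) (p t)) absolutely_integrable_on {t0..T}"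
      using zR ts P by (intro H_abs_int[OF t00(1) _ p, where y = z and R = R and P = P] continuous_imp_measurable_on_sets_lebesgue z_cont) auto
    have \<psi>_eq: "integral {t0..T} (\<psi> n) = integral {t0..T} (\<lambda>t. v' n t \<bullet> p t) - integral {t0..T} (\<lambda>t. H t (Z n t) (p t))" for n
      unfolding \<psi>_def
      by (intro Henstock_Kurzweil_Integration.integral_diff abs_int_imp_integrable inner_int v't H_int)
    have "integral {t0..T} (\<lambda>t. w t \<bullet> p t - H t (x0 + integral {t0..t} w) (p t))
        = integral {t0..T} (\<lambda>t. w t \<bullet> p t - H t (z t) (p t))"
      by (intro integral_cong) (simp add: zt)
    also have "\<dots> = integral {t0..T} (\<lambda>t. w t \<bullet> p t) - integral {t0..T} (\<lambda>t. H t (z t) (p t))"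
      by (intro Henstock_Kurzweil_Integration.integral_diff abs_int_imp_integrable inner_int wt Hz_int)
    finally have target: "integral {t0..T} (\<lambda>t. w t \<bullet> p t - H t (x0 + integral {t0..t} w) (p t))
        = integral {t0..T} (\<lambda>t. w t \<bullet> p t) - integral {t0..T} (\<lambda>t. H t (z t) (p t))" .
    have B_lim: "(\<lambda>n. B (s (k n))) \<longlonglongrightarrow> B t0"
      unfolding B_def by (rule continuous_on_tendsto_compose[OF continuous_on_integral[OF b(1)] sk t0]) (use s in auto)
    have "(\<lambda>n. integral {t0..T} (\<psi> (k n)) - \<bar>B (s (k n)) - B t0\<bar>)
        \<longlonglongrightarrow> (integral {t0..T} (\<lambda>t. w t \<bullet> p t) - integral {t0..T} (\<lambda>t. H t (z t) (p t))) - \<bar>B t0 - B t0\<bar>"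
      unfolding \<psi>_eq by (intro tendsto_diff tendsto_rabs lim1 lim2 B_lim tendsto_const)
    then show "\<exists>J. J \<longlonglongrightarrow> integral {t0..T} (\<lambda>t. w t \<bullet> p t - H t (x0 + integral {t0..t} w) (p t)) \<and>
         (\<forall>n. J n \<le> integral {s (k n)..T} (r (k n)))"
      unfolding target using ineq by (intro exI[of _ "\<lambda>n. integral {t0..T} (\<psi> (k n)) - \<bar>B (s (k n)) - B t0\<bar>"]) simp
  qed
qed

end

lemma lsc_on_real_sequentially:
  fixes g :: "'a::metric_space \<Rightarrow> real"
  assumes "lsc_on UNIV (\<lambda>x. ereal (g x))" "X \<longlonglongrightarrow> x" "\<epsilon> > 0"
  shows "\<forall>\<^sub>F n in sequentially. g x - \<epsilon> < g (X n)"
proof -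
  have "\<forall>\<^sub>F w in at x. ereal (g x - \<epsilon>) < ereal (g w)"
    using assms(1,3) unfolding lsc_on_def by (metis UNIV_I diff_less_eq less_add_same_cancel1 less_ereal.simps(1))
  then have "\<forall>\<^sub>F w in nhds x. g x - \<epsilon> < g w"
    using assms(3) by (simp add: eventually_nhds_conv_at)
  then show ?thesis using assms(2) by (rule eventually_compose_filterlim)
qed

context hamiltonian
begin

text \<open>Moves the supremum over \<open>p\<close> under the integral. The best of the first
  \<open>m + 1\<close> points of a dense sequence depends measurably on \<open>t\<close> and takes
  finitely many values, so \<open>bnd\<close> applies to it. The integrands increase with
  \<open>m\<close>, and an integrable bound above all of them is an admissible cost for the velocity
  \<open>w\<close>.\<close>

lemma value_fun_le_of_lower_bounds:
  assumes t0: "t0 \<in> {0..T}" and w: "w absolutely_integrable_on {t0..T}"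
    and bnd: "\<And>p. p \<in> borel_measurable (lebesgue_on {t0..T}) \<Longrightarrow> finite (p ` {t0..T}) \<Longrightarrow>
      g (x0 + integral {t0..T} w) + integral {t0..T} (\<lambda>t. w t \<bullet> p t - H t (x0 + integral {t0..t} w) (p t)) \<le> \<alpha>"
  shows "value_fun H g T t0 x0 \<le> ereal \<alpha>"
proof -
  define Z where "Z t = x0 + integral {t0..t} w" for t
  have Z_cont: "continuous_on {t0..T} Z"
    unfolding Z_def by (intro continuous_intros continuous_on_integral w)
  then have "bounded (Z ` {t0..T})" by (intro compact_imp_bounded compact_continuous_image) auto
  then obtain R where R: "\<And>t. t \<in> {t0..T} \<Longrightarrow> norm (Z t) \<le> R" unfolding bounded_iff by blast
  have Zm: "Z \<in> borel_measurable (lebesgue_on {t0..T})"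
    by (intro continuous_imp_measurable_on_sets_lebesgue Z_cont) simp
  have wm: "w \<in> borel_measurable (lebesgue_on {t0..T})"
    by (rule absolutely_integrable_imp_borel_measurable[OF w]) simp
  have ts: "t \<in> {0..T}" if "t \<in> {t0..T}" for t using that t0 by auto
  obtain D :: "'a set" where D: "countable D" "\<And>X. open X \<Longrightarrow> X \<noteq> {} \<Longrightarrow> \<exists>d\<in>D. d \<in> X"
    by (erule countable_dense_setE)
  have Dne: "D \<noteq> {}" using D(2)[of UNIV] by auto
  define d where "d = from_nat_into D"
  have d: "\<And>X. open X \<Longrightarrow> X \<noteq> {} \<Longrightarrow> \<exists>j. d j \<in> X"
    using D Dne by (metis from_nat_into_surj d_def)
  define \<phi> where "\<phi> t p = w t \<bullet> p - H t (Z t) p" for t p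
  \<comment> \<open>A running maximizer of \<open>\<phi> t\<close> over the points
    \<open>d 0\<close>, ..., \<open>d m\<close>.\<close>
  define q where "q = rec_nat (\<lambda>t. d 0) (\<lambda>m qm t. if \<phi> t (qm t) < \<phi> t (d (Suc m)) then d (Suc m) else qm t)"
  have q0: "q 0 t = d 0" for t by (simp add: q_def)
  have qS: "q (Suc m) t = (if \<phi> t (q m t) < \<phi> t (d (Suc m)) then d (Suc m) else q m t)" for m t
    by (simp add: q_def)
  have \<phi>m: "(\<lambda>t. \<phi> t (p t)) \<in> borel_measurable (lebesgue_on {t0..T})"
    if p: "p \<in> borel_measurable (lebesgue_on {t0..T})" for p
    unfolding \<phi>_def using t0 by (intro borel_measurable_diff borel_measurable_inner wm p H_measurable Zm) auto
  have qm: "q m \<in> borel_measurable (lebesgue_on {t0..T})" for m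
  proof (induction m)
    case 0
    then show ?case unfolding q0[abs_def] by simp
  next
    case (Suc m)
    note [measurable] = Suc \<phi>m[OF Suc] \<phi>m[OF borel_measurable_const[of "d (Suc m)"]]
    show ?case unfolding qS[abs_def] by measurable
  qed
  have qf: "finite (q m ` {t0..T})" for m
  proof (induction m)
    case 0
    have "q 0 ` {t0..T} \<subseteq> {d 0}" by (auto simp: q0)
    then show ?case by (rule finite_subset) simp
  next
    case (Suc m)
    have "q (Suc m) ` {t0..T} \<subseteq> insert (d (Suc m)) (q m ` {t0..T})" by (auto simp: qS)
    then show ?case using Suc by (auto intro: finite_subset)
  qed
  define f where "f m t = \<phi> t (q m t)" for m t
  have f_mono: "f m t \<le> f (Suc m) t" for m t by (simp add: f_def qS)
  have f_ge: "\<phi> t (d m) \<le> f m t" for m t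
    by (cases m) (simp_all add: f_def q0 qS)
  have f_int: "f m absolutely_integrable_on {t0..T}" for m
  proof -
    obtain P where P: "\<And>t. t \<in> {t0..T} \<Longrightarrow> norm (q m t) \<le> P"
      using finite_imp_bounded[OF qf[of m]] unfolding bounded_iff by blast
    have "(\<lambda>t. w t \<bullet> q m t) absolutely_integrable_on {t0..T}"
    proof (rule measurable_bounded_by_integrable_imp_absolutely_integrable)
      show "(\<lambda>t. w t \<bullet> q m t) \<in> borel_measurable (lebesgue_on {t0..T})"
        by (intro borel_measurable_inner wm qm)
      show "(\<lambda>t. norm (w t) * P) integrable_on {t0..T}"
        using absolutely_integrable_norm[OF w]
        by (intro abs_int_imp_integrable set_integrable_mult_left) (auto simp: o_def)
      show "norm (w t \<bullet> q m t) \<le> norm (w t) * P" if "t \<in> {t0..T}" for t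
        using Cauchy_Schwarz_ineq2[of "w t" "q m t"] mult_left_mono[OF P[OF that], of "norm (w t)"] by simp
    qed simp
    moreover have "(\<lambda>t. H t (Z t) (q m t)) absolutely_integrable_on {t0..T}"
      using t0 by (intro H_abs_int[OF _ Zm qm R P]) auto
    ultimately show ?thesis unfolding f_def \<phi>_def by (rule set_integral_diff(1))
  qed
  obtain r N where N: "negligible N" and r: "r absolutely_integrable_on {t0..T}"
    and r_le: "integral {t0..T} r \<le> \<alpha> - g (Z T)" and fr: "\<And>t m. t \<in> {t0..T} - N \<Longrightarrow> f m t \<le> r t"
  proof (rule beppo_levi[where f = f and S = "{t0..T}" and L = "\<alpha> - g (Z T)"])
    show "integral {t0..T} (f m) \<le> \<alpha> - g (Z T)" for m
      using bnd[OF qm qf, of m] by (simp add: f_def[abs_def] \<phi>_def Z_def)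
  qed (use f_int f_mono in auto)
  have mem: "(w t, r t) \<in> epi_conj (H t (Z t))" if t: "t \<in> {t0..T} - N" for t
  proof (rule epi_conj_denseI[OF H_cont_p d])
    show "t \<in> {0..T}" using t ts by blast
    show "fst (w t, r t) \<bullet> d j - snd (w t, r t) \<le> H t (Z t) (d j)" for j
      using f_ge[of t j] fr[OF t, of j] by (simp add: \<phi>_def)
  qed
  \<comment> \<open>Restores the inclusion on the null set \<open>N\<close>; an arbitrary choice
    does, since integrals ignore its values there.\<close>
  define e where "e t = (SOME z. z \<in> epi_conj (H t (Z t)))" for t
  have e: "e t \<in> epi_conj (H t (Z t))" if "t \<in> {t0..T}" for t
    unfolding e_def using epi_conj_nonempty[OF H3[OF ts[OF that]]] by (simp add: some_in_eq)
  define v' where "v' t = (if t \<in> N then fst (e t) else w t)" for t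
  define r' where "r' t = (if t \<in> N then snd (e t) else r t)" for t
  have int_eq: "integral {t0..t} v' = integral {t0..t} w" "integral {t0..t} r' = integral {t0..t} r" for t
    by (rule integral_spike[OF N]; simp add: v'_def r'_def)+
  have "arc t0 x0 Z v' r'"
    unfolding arc_def
  proof (intro conjI ballI)
    show "v' absolutely_integrable_on {t0..T}"
      by (rule absolutely_integrable_spike[OF w N]) (simp add: v'_def)
    show "r' absolutely_integrable_on {t0..T}"
      by (rule absolutely_integrable_spike[OF r N]) (simp add: r'_def)
    fix t assume t: "t \<in> {t0..T}"
    show "Z t = x0 + integral {t0..t} v'" by (simp add: int_eq Z_def)
    show "(v' t, r' t) \<in> epi_conj (H t (Z t))"
      using e[OF t] mem[of t] t by (cases "t \<in> N") (auto simp: v'_def r'_def)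
  qed
  from value_fun_le_arc[OF this t0, of g]
  have "value_fun H g T t0 x0 \<le> ereal (g (Z T) + integral {t0..T} r)" by (simp add: int_eq)
  also have "\<dots> \<le> ereal \<alpha>" using r_le by simp
  finally show ?thesis .
qed

text \<open>The limit in \<open>n\<close> is taken for each fixed simple \<open>p\<close>, jointly
  with the lower semicontinuity of \<open>g\<close> at the endpoints; the supremum over
  \<open>p\<close> comes only afterwards.\<close>

lemma value_fun_lower_semicontinuous:
  fixes s :: "nat \<Rightarrow> real" and \<xi> :: "nat \<Rightarrow> 'a"
  assumes g: "lsc_on UNIV (\<lambda>x. ereal (g x))" and t0: "t0 \<in> {0..T}" and s: "\<And>n. s n \<in> {0..T}"
    and s_lim: "s \<longlonglongrightarrow> t0" and \<xi>_lim: "\<xi> \<longlonglongrightarrow> x0"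
    and less: "\<And>n. value_fun H g T (s n) (\<xi> n) < ereal \<alpha>"
  shows "value_fun H g T t0 x0 \<le> ereal \<alpha>"
proof -
  have "\<forall>n. \<exists>x v r. arc (s n) (\<xi> n) x v r \<and> g (x T) + integral {s n..T} r < \<alpha>"
    using arc_of_value_fun_less[OF s less] by metis
  then obtain x v r where arcs: "\<And>n. arc (s n) (\<xi> n) (x n) (v n) (r n)"
    and cost: "\<And>n. g (x n T) + integral {s n..T} (r n) < \<alpha>" by metis
  obtain k w where w: "w absolutely_integrable_on {t0..T}"
    and xT: "(\<lambda>n. x (k n) T) \<longlonglongrightarrow> x0 + integral {t0..T} w"
    and lower: "\<And>p. p \<in> borel_measurable (lebesgue_on {t0..T}) \<Longrightarrow> finite (p ` {t0..T}) \<Longrightarrow>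
       \<exists>J. J \<longlonglongrightarrow> integral {t0..T} (\<lambda>t. w t \<bullet> p t - H t (x0 + integral {t0..t} w) (p t)) \<and>
         (\<forall>n. J n \<le> integral {s (k n)..T} (r (k n)))"
  proof (rule arc_limit[OF t0 s s_lim \<xi>_lim arcs], goal_cases)
    case (1 k w)
    show thesis by (rule that[OF 1(3-5)])
  qed
  show ?thesis
  proof (rule value_fun_le_of_lower_bounds[OF t0 w])
    fix p :: "real \<Rightarrow> 'a"
    assume p: "p \<in> borel_measurable (lebesgue_on {t0..T})" "finite (p ` {t0..T})"
    let ?I = "integral {t0..T} (\<lambda>t. w t \<bullet> p t - H t (x0 + integral {t0..t} w) (p t))"
    obtain J where J: "J \<longlonglongrightarrow> ?I" "\<And>n. J n \<le> integral {s (k n)..T} (r (k n))" using lower[OF p] by blast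
    show "g (x0 + integral {t0..T} w) + ?I \<le> \<alpha>"
    proof (rule field_le_epsilon)
      fix \<epsilon> :: real assume \<epsilon>: "0 < \<epsilon>"
      have "\<forall>\<^sub>F n in sequentially. J n \<le> \<alpha> - g (x0 + integral {t0..T} w) + \<epsilon>"
        using lsc_on_real_sequentially[OF g xT \<epsilon>]
      proof eventually_elim
        case (elim n)
        then show ?case using J(2)[of n] cost[of "k n"] by linarith
      qed
      then have "?I \<le> \<alpha> - g (x0 + integral {t0..T} w) + \<epsilon>"
        by (rule tendsto_upperbound[OF J(1)]) simp
      then show "g (x0 + integral {t0..T} w) + ?I \<le> \<alpha> + \<epsilon>" by simp
    qed
  qed
qed

text \<open>By contradiction along a subsequence with values at most \<alpha>. An intermediate real
  \<beta> turns this into a strict bound and still lies below the value at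
  \<open>z0\<close>.\<close>

lemma value_fun_lsc_eventually:
  fixes z :: "nat \<Rightarrow> real \<times> 'a"
  assumes g: "lsc_on UNIV (\<lambda>x. ereal (g x))" and z: "\<And>n. z n \<in> {0..T} \<times> UNIV"
    and z0: "z0 \<in> {0..T} \<times> UNIV" and lim: "z \<longlonglongrightarrow> z0"
    and less: "\<alpha> < (case z0 of (t, x) \<Rightarrow> value_fun H g T t x)"
  shows "\<forall>\<^sub>F n in sequentially. \<alpha> < (case z n of (t, x) \<Rightarrow> value_fun H g T t x)"
proof (rule ccontr)
  let ?V = "\<lambda>z. case z of (t, x) \<Rightarrow> value_fun H g T t x"
  assume "\<not> ?thesis"
  then have "\<exists>\<^sub>F n in sequentially. ?V (z n) \<le> \<alpha>" by (simp add: frequently_def not_le)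
  then have "infinite {n. ?V (z n) \<le> \<alpha>}"
    by (simp add: frequently_sequentially infinite_nat_iff_unbounded_le)
  then obtain k :: "nat \<Rightarrow> nat" where k: "strict_mono k" "\<And>n. ?V (z (k n)) \<le> \<alpha>"
    using infinite_enumerate by blast
  obtain \<beta> where \<beta>: "\<alpha> < ereal \<beta>" "ereal \<beta> < ?V z0" using ereal_dense2[OF less] by blast
  have zk: "(\<lambda>n. z (k n)) \<longlonglongrightarrow> z0" using LIMSEQ_subseq_LIMSEQ[OF lim k(1)] by (simp add: o_def)
  have "value_fun H g T (fst z0) (snd z0) \<le> ereal \<beta>"
  proof (rule value_fun_lower_semicontinuous[OF g])
    show "fst z0 \<in> {0..T}" "fst (z (k n)) \<in> {0..T}" for n
      using z0 z[of "k n"] by (auto simp: mem_Times_iff)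
    show "(\<lambda>n. fst (z (k n))) \<longlonglongrightarrow> fst z0" "(\<lambda>n. snd (z (k n))) \<longlonglongrightarrow> snd z0"
      by (intro tendsto_intros zk)+
    show "value_fun H g T (fst (z (k n))) (snd (z (k n))) < ereal \<beta>" for n
      using le_less_trans[OF k(2) \<beta>(1), of n] by (simp add: case_prod_beta)
  qed
  then show False using \<beta>(2) by (simp add: case_prod_beta)
qed

lemma value_fun_usc_eventually:
  fixes z :: "nat \<Rightarrow> real \<times> 'a"
  assumes g: "continuous_on UNIV g" and z: "\<And>n. z n \<in> {0..T} \<times> UNIV"
    and z0: "z0 \<in> {0..T} \<times> UNIV" and lim: "z \<longlonglongrightarrow> z0"
    and less: "(case z0 of (t, x) \<Rightarrow> value_fun H g T t x) < \<alpha>"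
  shows "\<forall>\<^sub>F n in sequentially. (case z n of (t, x) \<Rightarrow> value_fun H g T t x) < \<alpha>"
proof -
  obtain \<beta> where \<beta>: "value_fun H g T (fst z0) (snd z0) < ereal \<beta>" "ereal \<beta> < \<alpha>"
    using ereal_dense2[OF less] by (auto simp: case_prod_beta)
  have "\<forall>\<^sub>F n in sequentially. value_fun H g T (fst (z n)) (snd (z n)) < ereal \<beta>"
  proof (rule value_fun_upper_semicontinuous[OF g _ _ _ _ \<beta>(1)])
    show "fst z0 \<in> {0..T}" "fst (z n) \<in> {0..T}" for n
      using z0 z[of n] by (auto simp: mem_Times_iff)
    show "(\<lambda>n. fst (z n)) \<longlonglongrightarrow> fst z0" "(\<lambda>n. snd (z n)) \<longlonglongrightarrow> snd z0"
      by (intro tendsto_intros lim)+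
  qed
  then show ?thesis by eventually_elim (use \<beta>(2) in \<open>auto simp: case_prod_beta intro: less_trans\<close>)
qed

end

lemma lsc_on_continuous:
  fixes g :: "'a::metric_space \<Rightarrow> real"
  assumes "continuous_on UNIV g"
  shows "lsc_on UNIV (\<lambda>x. ereal (g x))"
  unfolding lsc_on_def
proof (intro ballI allI impI)
  fix z c assume c: "c < ereal (g z)"
  have "(g \<longlongrightarrow> g z) (at z)" using assms by (simp add: continuous_on_def)
  then have "((\<lambda>x. ereal (g x)) \<longlongrightarrow> ereal (g z)) (at z)" by simp
  then show "\<forall>\<^sub>F w in at z. c < ereal (g w)" using c by (rule order_tendstoD(1))
qed

theorem theorem4p10:
  fixes H :: "real \<Rightarrow> 'a::euclidean_space \<Rightarrow> 'a \<Rightarrow> real"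
    and g :: "'a \<Rightarrow> real" and T :: real and c :: "real \<Rightarrow> real"
  assumes H1: "\<And>x p. (\<lambda>t. H t x p) \<in> borel_measurable (lebesgue_on {0..T})"
    and H2: "\<And>t. t \<in> {0..T} \<Longrightarrow> continuous_on UNIV (\<lambda>(x, p). H t x p)"
    and H3: "\<And>t x. t \<in> {0..T} \<Longrightarrow> convex_on UNIV (H t x)"
    and H4_meas: "c \<in> borel_measurable (lebesgue_on {0..T})"
    and H4_int: "integrable (lebesgue_on {0..T}) c"
    and H4_nonneg: "\<And>t. t \<in> {0..T} \<Longrightarrow> 0 \<le> c t"
    and H4: "\<And>t x p q. t \<in> {0..T} \<Longrightarrow>
               \<bar>H t x p - H t x q\<bar> \<le> c t * (1 + norm x) * norm (p - q)"
    and HLC: "\<And>R. R > 0 \<Longrightarrow> \<exists>k :: real \<Rightarrow> real.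
               k \<in> borel_measurable (lebesgue_on {0..T}) \<and>
               integrable (lebesgue_on {0..T}) k \<and>
               (\<forall>t\<in>{0..T}. 0 \<le> k t) \<and>
               (\<forall>t\<in>{0..T}. \<forall>x\<in>cball 0 R. \<forall>y\<in>cball 0 R. \<forall>p.
                  \<bar>H t x p - H t y p\<bar> \<le> k t * (1 + norm p) * norm (x - y))"
    and H00: "integrable (lebesgue_on {0..T}) (\<lambda>t. H t 0 0)"
  shows "(continuous_on UNIV g \<longrightarrow>
            (\<forall>t\<in>{0..T}. \<forall>x. \<bar>value_fun H g T t x\<bar> \<noteq> \<infinity>) \<and>
            continuous_on ({0..T} \<times> UNIV) (\<lambda>(t, x). value_fun H g T t x)) \<and>
         (lsc_on UNIV (\<lambda>x. ereal (g x)) \<longrightarrow>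
            lsc_on ({0..T} \<times> UNIV) (\<lambda>(t, x). value_fun H g T t x))"
proof -
  interpret hamiltonian H T c
    by (rule hamiltonian.intro[OF H1 H2 H3 H4_int H4_nonneg H4 HLC H00])
  let ?D = "{0..T} \<times> (UNIV :: 'a set)"
  let ?V = "\<lambda>(t, x). value_fun H g T t x"
  show ?thesis
  proof (intro conjI impI ballI allI)
    \<comment> \<open>Continuity below is meant in the extended reals; with this finiteness it is
      continuity of a real-valued function.\<close>
    fix t x assume g: "continuous_on UNIV g" and t: "t \<in> {0..T}"
    show "\<bar>value_fun H g T t x\<bar> \<noteq> \<infinity>"
      using value_fun_less_infinity[OF t, of g x] value_fun_gt_minus_infinity[OF t g, of x] by auto
  next
    assume g: "continuous_on UNIV g"
    show "continuous_on ?D ?V"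
      unfolding continuous_on_def
    proof (intro ballI order_tendstoI)
      fix z \<alpha> assume z: "z \<in> ?D"
      show "\<forall>\<^sub>F w in at z within ?D. \<alpha> < ?V w" if "\<alpha> < ?V z"
        using value_fun_lsc_eventually[OF lsc_on_continuous[OF g] _ z _ that]
        by (intro sequentially_imp_eventually_within) blast
      show "\<forall>\<^sub>F w in at z within ?D. ?V w < \<alpha>" if "?V z < \<alpha>"
        using value_fun_usc_eventually[OF g _ z _ that]
        by (intro sequentially_imp_eventually_within) blast
    qed
  next
    assume g: "lsc_on UNIV (\<lambda>x. ereal (g x))"
    show "lsc_on ?D ?V"
      unfolding lsc_on_def
    proof (intro ballI allI impI)
      fix z \<alpha> assume z: "z \<in> ?D" and less: "\<alpha> < ?V z"
      show "\<forall>\<^sub>F w in at z within ?D. \<alpha> < ?V w"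
        using value_fun_lsc_eventually[OF g _ z _ less]
        by (intro sequentially_imp_eventually_within) blast
    qed
  qed
qed

end
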